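(* For every $\varepsilon>0$ there exists a norm $|||\cdot|||$ on $L_1[0,1]$ (with respect to Lebesgue measure) satisfying $$\|f\|_1\leq |||f|||\leq (1+\varepsilon)\|f\|_1\qquad\text{for every } f\in L_1[0,1],$$ such that $(L_1[0,1],|||\cdot|||)$ is weakly midpoint locally uniformly rotund (wMLUR) and Gâteaux smooth, and such that the dual Banach space $(L_1[0,1],|||\cdot|||)^*$ has the Daugavet property. In particular, there exists a Banach space which is strictly convex, Gâteaux smooth and has the Daugavet property.
   Context: Banach spaces are over $\mathbb{K}=\mathbb{R}$ or $\mathbb{C}$; $S_X$ is the unit sphere of a Banach space $X$. - $X$ is wMLUR if, whenever $x\in S_X$ and $(h_n)\subseteq X$ satisfy $\|x+h_n\|\to 1$ and $\|x-h_n\|\to 1$, then $h_n\to 0$ weakly. - $X$ is strictly convex if $\|\frac{x+y}{2}\|<1$ for all $x,y\in S_X$ with $x\neq y$. - $X$ is Gâteaux smooth if for every $x\in S_X$ and $y\in X$ the limit $\lim_{t\to 0}\frac{\|x+ty\|-\|x\|}{t}$ (with $t$ real) exists. - $X$ has the Daugavet property if $\|I+R\|=1+\|R\|$ for every rank-one bounded linear operator $R:X\to X$, where $I$ is the identity of $X$. *)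

theory Defs
  imports "HOL-Analysis.Analysis" "HOL-Library.Function_Algebras"
begin

text \<open>
  The statement varies the norm on a fixed vector space, speaks about dual spaces of the resulting
  spaces, and allows real and complex scalars.  A normed space is therefore a structure: a scalar
  multiplication on an ambient abelian group, a subspace of the ambient space, and a norm whose
  values matter on that subspace only.
\<close>

record ('k, 'a) nspace =
  vscale :: "'k \<Rightarrow> 'a \<Rightarrow> 'a"
  vcar :: "'a set"
  vnorm :: "'a \<Rightarrow> real"

definition normed_space :: "('k::real_normed_field, 'a::ab_group_add) nspace \<Rightarrow> bool" where
  "normed_space X \<longleftrightarrow>
     vector_space (vscale X) \<and>
     module.subspace (vscale X) (vcar X) \<and>
     (\<forall>x\<in>vcar X. 0 \<le> vnorm X x) \<and>
     (\<forall>x\<in>vcar X. vnorm X x = 0 \<longleftrightarrow> x = 0) \<and>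
     (\<forall>c. \<forall>x\<in>vcar X. vnorm X (vscale X c x) = norm c * vnorm X x) \<and>
     (\<forall>x\<in>vcar X. \<forall>y\<in>vcar X. vnorm X (x + y) \<le> vnorm X x + vnorm X y)"

definition banach_space :: "('k::real_normed_field, 'a::ab_group_add) nspace \<Rightarrow> bool" where
  "banach_space X \<longleftrightarrow>
     normed_space X \<and>
     (\<forall>h :: nat \<Rightarrow> 'a.
        (\<forall>n. h n \<in> vcar X) \<and>
        (\<forall>e>0. \<exists>M. \<forall>m\<ge>M. \<forall>n\<ge>M. vnorm X (h m - h n) < e) \<longrightarrow>
        (\<exists>x\<in>vcar X. (\<lambda>n. vnorm X (h n - x)) \<longlonglongrightarrow> 0))"

definition unit_sphere :: "('k, 'a) nspace \<Rightarrow> 'a set" where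
  "unit_sphere X = {x \<in> vcar X. vnorm X x = 1}"

text \<open>Bounded linear maps on the carrier of \<open>X\<close>; nothing is required outside the carrier.\<close>

definition bounded_linear_between ::
    "('k, 'a::ab_group_add) nspace \<Rightarrow> ('k, 'b::ab_group_add) nspace \<Rightarrow> ('a \<Rightarrow> 'b) \<Rightarrow> bool" where
  "bounded_linear_between X Y T \<longleftrightarrow>
     (\<forall>x\<in>vcar X. T x \<in> vcar Y) \<and>
     (\<forall>x\<in>vcar X. \<forall>y\<in>vcar X. T (x + y) = T x + T y) \<and>
     (\<forall>c. \<forall>x\<in>vcar X. T (vscale X c x) = vscale Y c (T x)) \<and>
     (\<exists>C. \<forall>x\<in>vcar X. vnorm Y (T x) \<le> C * vnorm X x)"

definition op_norm :: "('k, 'a) nspace \<Rightarrow> ('k, 'b) nspace \<Rightarrow> ('a \<Rightarrow> 'b) \<Rightarrow> real" where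
  "op_norm X Y T = (SUP x\<in>{x \<in> vcar X. vnorm X x \<le> 1}. vnorm Y (T x))"

definition scalar_space :: "('k::real_normed_field, 'k) nspace" where
  "scalar_space = \<lparr>vscale = (*), vcar = UNIV, vnorm = norm\<rparr>"

text \<open>
  Functionals are set to \<open>0\<close> outside the carrier of \<open>X\<close>, so that each functional on \<open>X\<close> is
  represented by exactly one function.
\<close>

definition dual_space ::
    "('k::real_normed_field, 'a::ab_group_add) nspace \<Rightarrow> ('k, 'a \<Rightarrow> 'k) nspace" where
  "dual_space X =
     \<lparr>vscale = (\<lambda>c \<phi> x. c * \<phi> x),
      vcar = {\<phi>. bounded_linear_between X scalar_space \<phi> \<and> (\<forall>x. x \<notin> vcar X \<longrightarrow> \<phi> x = 0)},
      vnorm = op_norm X scalar_space\<rparr>"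

definition weakly_null :: "('k::real_normed_field, 'a::ab_group_add) nspace \<Rightarrow> (nat \<Rightarrow> 'a) \<Rightarrow> bool" where
  "weakly_null X h \<longleftrightarrow> (\<forall>\<phi>\<in>vcar (dual_space X). (\<lambda>n. \<phi> (h n)) \<longlonglongrightarrow> 0)"

definition wMLUR :: "('k::real_normed_field, 'a::ab_group_add) nspace \<Rightarrow> bool" where
  "wMLUR X \<longleftrightarrow>
     (\<forall>x\<in>unit_sphere X. \<forall>h :: nat \<Rightarrow> 'a.
        (\<forall>n. h n \<in> vcar X) \<and>
        (\<lambda>n. vnorm X (x + h n)) \<longlonglongrightarrow> 1 \<and>
        (\<lambda>n. vnorm X (x - h n)) \<longlonglongrightarrow> 1 \<longrightarrow>
        weakly_null X h)"

definition strictly_convex :: "('k::real_normed_field, 'a::ab_group_add) nspace \<Rightarrow> bool" where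
  "strictly_convex X \<longleftrightarrow>
     (\<forall>x\<in>unit_sphere X. \<forall>y\<in>unit_sphere X.
        x \<noteq> y \<longrightarrow> vnorm X (vscale X (1 / 2) (x + y)) < 1)"

definition gateaux_smooth :: "('k::real_normed_field, 'a::ab_group_add) nspace \<Rightarrow> bool" where
  "gateaux_smooth X \<longleftrightarrow>
     (\<forall>x\<in>unit_sphere X. \<forall>y\<in>vcar X. \<exists>L.
        ((\<lambda>t::real. (vnorm X (x + vscale X (of_real t) y) - vnorm X x) / t) \<longlongrightarrow> L) (at 0))"

definition rank_one :: "('k::real_normed_field, 'a::ab_group_add) nspace \<Rightarrow> ('a \<Rightarrow> 'a) \<Rightarrow> bool" where
  "rank_one X R \<longleftrightarrow> vector_space.dim (vscale X) (R ` vcar X) = 1"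

definition daugavet_property :: "('k::real_normed_field, 'a::ab_group_add) nspace \<Rightarrow> bool" where
  "daugavet_property X \<longleftrightarrow>
     (\<forall>R. bounded_linear_between X X R \<and> rank_one X R \<longrightarrow>
        op_norm X X (\<lambda>x. x + R x) = 1 + op_norm X X R)"

text \<open>The space of classes of integrable functions on the unit interval modulo null sets.\<close>

definition L1_rel ::
    "(real \<Rightarrow> 'k::{real_normed_field, banach, second_countable_topology}) \<Rightarrow> (real \<Rightarrow> 'k) \<Rightarrow> bool" where
  "L1_rel f g \<longleftrightarrow>
     integrable (lebesgue_on {0..1}) f \<and> integrable (lebesgue_on {0..1}) g \<and>
     (AE x in lebesgue_on {0..1}. f x = g x)"

quotient_type (overloaded) 'k L1 =
  "real \<Rightarrow> 'k::{real_normed_field, banach, second_countable_topology}" / partial: L1_rel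
proof (rule part_equivpI)
  show "\<exists>f :: real \<Rightarrow> 'k. L1_rel f f"
    by (rule exI[of _ "\<lambda>_. 0"]) (simp add: L1_rel_def)
  show "symp (L1_rel :: (real \<Rightarrow> 'k) \<Rightarrow> _)"
    by (auto simp: symp_def L1_rel_def eq_commute)
  show "transp (L1_rel :: (real \<Rightarrow> 'k) \<Rightarrow> _)"
    unfolding transp_def L1_rel_def by (auto elim: eventually_elim2)
qed

instantiation L1 :: ("{real_normed_field, banach, second_countable_topology}") ab_group_add
begin

lift_definition zero_L1 :: "'a L1" is "\<lambda>_. 0"
  by (simp add: L1_rel_def)

lift_definition plus_L1 :: "'a L1 \<Rightarrow> 'a L1 \<Rightarrow> 'a L1" is "\<lambda>f g x. f x + g x"
  unfolding L1_rel_def by (auto elim: eventually_elim2)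

lift_definition minus_L1 :: "'a L1 \<Rightarrow> 'a L1 \<Rightarrow> 'a L1" is "\<lambda>f g x. f x - g x"
  unfolding L1_rel_def by (auto elim: eventually_elim2)

lift_definition uminus_L1 :: "'a L1 \<Rightarrow> 'a L1" is "\<lambda>f x. - f x"
  unfolding L1_rel_def by auto

instance
  by standard (transfer, auto simp: L1_rel_def algebra_simps)+

end

lift_definition scale_L1 ::
    "'k::{real_normed_field, banach, second_countable_topology} \<Rightarrow> 'k L1 \<Rightarrow> 'k L1"
  is "\<lambda>c f x. c * f x"
  unfolding L1_rel_def by auto

lift_definition norm1 :: "'k::{real_normed_field, banach, second_countable_topology} L1 \<Rightarrow> real"
  is "\<lambda>f. \<integral>x. norm (f x) \<partial>lebesgue_on {0..1}"
  unfolding L1_rel_def by (intro integral_cong_AE) auto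

text \<open>The vector space \<open>L\<^sub>1[0,1]\<close> equipped with a given norm \<open>N\<close>.\<close>

definition L1_with ::
    "('k::{real_normed_field, banach, second_countable_topology} L1 \<Rightarrow> real) \<Rightarrow> ('k, 'k L1) nspace" where
  "L1_with N = \<lparr>vscale = scale_L1, vcar = UNIV, vnorm = N\<rparr>"

end

theory Submission
  imports Defs "HOL-Probability.Probability_Measure"
begin


text \<open>
  Let \<open>\<tau>\<^sub>i\<close> be the rotation of the unit interval by \<open>2\<^bsup>-(i+1)\<^esup>\<close> and \<open>p\<^sub>i = 1 + \<delta>\<^sub>i\<close> with
  \<open>\<delta>\<^sub>i\<close> positive and rapidly decreasing.  Starting from \<open>\<bar>f\<bar>\<close>, replace a function repeatedly by its
  \<open>p\<^sub>i\<close>-mean along \<open>\<tau>\<^sub>i\<close>.  The integrals of the functions \<open>G\<^sub>i f\<close> obtained in this way are norms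
  \<open>N\<^sub>i\<close>, which increase to a norm \<open>N\<close> with \<open>N \<le> \<kappa>\<^sub>i N\<^sub>i\<close>, where \<open>\<kappa>\<^sub>i\<close> is \<open>2\<close> to the power
  \<open>\<delta>\<^sub>i + \<delta>\<^sub>i\<^sub>+\<^sub>1 + \<dots>\<close>.  So \<open>\<kappa>\<^sub>i\<close> tends to \<open>1\<close>, and \<open>N\<close> is as close to the \<open>L\<^sub>1\<close>-norm \<open>N\<^sub>0\<close> as
  desired if the \<open>\<delta>\<^sub>i\<close> are small.  Informally, \<open>N\<close> is an infinitely
  iterated \<open>\<ell>\<^sub>p\<close>-sum over orbits, in which the exponents of the outer sums tend to \<open>1\<close>.

  \<^emph>\<open>Daugavet property.\<close>  The norm \<open>N\<^sub>i\<close> is additive over sets that are invariant under the first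
  \<open>i\<close> rotations, and there are arbitrarily small such sets.  So \<open>N\<close> is an \<open>L\<^sub>1\<close>-sum of small pieces up
  to a factor close to \<open>1\<close> (\<open>almost_additive_pieces\<close>), which gives the Daugavet property of the
  space and of its dual (\<open>fine_splitting.daugavet\<close>, \<open>fine_splitting.daugavet_dual\<close>).

  \<^emph>\<open>Smoothness and strict convexity.\<close>  Differentiating the means formally, the gradient of \<open>N\<close> at
  \<open>z\<close> is \<open>y \<mapsto> \<integral> (y \<bullet> sgn z) V z\<close> with \<open>V z\<close> the infinite product of the ratios
  \<open>(G\<^sub>i z / G\<^sub>i\<^sub>+\<^sub>1 z)\<^bsup>\<delta>\<^sub>i\<^esup>\<close>.  By Hoelder's inequality for each mean, this functional has norm one and attains
  it at \<open>z\<close>.  It depends continuously on \<open>z\<close> along lines, by dominated convergence in the exponent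
  of the product, whence \<open>N\<close> is Gateaux smooth (\<open>N_has_directional_derivative\<close>).  If it also attains
  its norm at \<open>u\<close>, then all the Hoelder inequalities are equalities; so
  \<open>G\<^sub>i u\<close> and \<open>G\<^sub>i z\<close> are proportional along the levels with a factor that cannot depend on the
  point, by ergodicity, and \<open>u = z\<close> follows (\<open>norming_unique\<close>).

  \<^emph>\<open>Midpoint rotundity.\<close>  If a functional stayed away from \<open>0\<close> on some \<open>h\<^sub>n\<close> with
  \<open>N (x \<plusminus> h\<^sub>n) \<rightarrow> 1\<close>, then the \<open>h\<close> with \<open>N (x \<plusminus> h)\<close> close to \<open>1\<close> on which it stays away from
  \<open>0\<close> would form decreasing nonempty convex sets.  In such sets there are \<open>g\<^sub>k\<close> that converge almost
  everywhere, to \<open>g\<close> say (\<open>decreasing_midconvex_AE_limit\<close>).  Since a null sequence for almost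
  everywhere convergence is asymptotically disjoint from any given function
  (\<open>asymptotically_additive\<close>), \<open>N (x \<plusminus> g) + lim N (g\<^sub>k - g) \<le> 1\<close>; strict convexity forces \<open>g = 0\<close>
  and \<open>g\<^sub>k \<rightarrow> 0\<close> in norm (\<open>midpoint_sequences\<close>), which is absurd.
\<close>

section \<open>Power means of two numbers\<close>

text \<open>The parameter \<open>d\<close> is the distance of the exponent from \<open>1\<close>, the exponent of the arithmetic mean.\<close>

definition pmean :: "real \<Rightarrow> real \<Rightarrow> real \<Rightarrow> real" where
  "pmean d a b = ((a powr (1 + d) + b powr (1 + d)) / 2) powr (1 / (1 + d))"

lemma pmean_nonneg [simp]: "0 \<le> pmean d a b"
  by (simp add: pmean_def)

lemma pmean_commute: "pmean d a b = pmean d b a"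
  by (simp add: pmean_def add.commute)

lemma pmean_powr:
  assumes "0 < d"
  shows "pmean d a b powr (1 + d) = (a powr (1 + d) + b powr (1 + d)) / 2"
  using assms by (simp add: pmean_def powr_powr)

lemma pmean_eq_0_iff:
  assumes "0 < d" "0 \<le> a" "0 \<le> b"
  shows "pmean d a b = 0 \<longleftrightarrow> a = 0 \<and> b = 0"
proof -
  have "a powr (1 + d) + b powr (1 + d) = 0 \<longleftrightarrow> a = 0 \<and> b = 0"
    by (subst add_nonneg_eq_0_iff) auto
  then show ?thesis using assms by (simp add: pmean_def)
qed

lemma pmean_mono:
  assumes "0 < d" "0 \<le> a" "a \<le> a'" "0 \<le> b" "b \<le> b'"
  shows "pmean d a b \<le> pmean d a' b'"
  unfolding pmean_def using assms
  by (intro powr_mono2 divide_right_mono add_mono) (auto intro!: add_nonneg_nonneg)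

lemma pmean_scale:
  assumes "0 < d" "0 \<le> c" "0 \<le> a" "0 \<le> b"
  shows "pmean d (c * a) (c * b) = c * pmean d a b"
proof -
  have "pmean d (c * a) (c * b) = (c powr (1 + d) * ((a powr (1 + d) + b powr (1 + d)) / 2)) powr (1 / (1 + d))"
    using assms by (simp add: pmean_def powr_mult algebra_simps)
  also have "\<dots> = (c powr (1 + d)) powr (1 / (1 + d)) * pmean d a b"
    by (subst powr_mult) (auto simp: pmean_def)
  also have "\<dots> = c * pmean d a b"
    using assms by (simp add: powr_powr)
  finally show ?thesis .
qed

lemma pmean_same:
  assumes "0 < d" "0 \<le> a"
  shows "pmean d a a = a"
  using assms by (simp add: pmean_def powr_powr)

lemma le_two_pmean:
  assumes "0 < d" "0 \<le> a" "0 \<le> b"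
  shows "a \<le> 2 * pmean d a b"
proof -
  have "a = (a powr (1 + d)) powr (1 / (1 + d))"
    using assms by (simp add: powr_powr)
  also have "\<dots> \<le> (2 * (pmean d a b powr (1 + d))) powr (1 / (1 + d))"
    using assms by (intro powr_mono2) (auto simp: pmean_powr)
  also have "\<dots> = 2 powr (1 / (1 + d)) * pmean d a b"
    using assms by (subst powr_mult) (auto simp: powr_powr)
  also have "\<dots> \<le> 2 * pmean d a b"
    using assms powr_mono[of "1 / (1 + d)" 1 2] by (intro mult_right_mono) auto
  finally show ?thesis .
qed

text \<open>The weighted inequality of arithmetic and geometric means, proved by bounding logarithms by
  their tangent at \<open>1\<close>; the strictness of that bound away from \<open>1\<close> gives the equality case.\<close>

lemma young_powr:
  fixes s t d :: real
  assumes "0 < d" "0 \<le> s" "0 \<le> t"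
  shows "(1 + d) * (s * t powr d) \<le> s powr (1 + d) + d * t powr (1 + d)"
    and "(1 + d) * (s * t powr d) = s powr (1 + d) + d * t powr (1 + d) \<Longrightarrow> s = t"
proof -
  have *: "(1 + d) * (s * t powr d) \<le> s powr (1 + d) + d * t powr (1 + d) \<and>
     ((1 + d) * (s * t powr d) = s powr (1 + d) + d * t powr (1 + d) \<longrightarrow> s = t)"
  proof (cases "s = 0 \<or> t = 0")
    case True
    then show ?thesis using assms by auto
  next
    case False
    then have st: "0 < s" "0 < t" using assms by auto
    define u where "u = (s / t) powr (1 + d)"
    define v where "v = u / (1 + d) + d / (1 + d)"
    have u: "u > 0" using st by (simp add: u_def)
    have v: "v > 0" using u assms by (simp add: v_def add_pos_pos)
    have lnst: "(1 + d) * ln (s / t) = ln u" using st by (simp add: u_def ln_powr)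
    have vv: "u + d = (1 + d) * v" using assms by (simp add: v_def distrib_left)
    have 1: "ln (u / v) \<le> u / v - 1" "ln (1 / v) \<le> 1 / v - 1"
      using u v by (auto intro!: ln_le_minus_one)
    have sum: "(u / v - 1) + d * (1 / v - 1) = 0"
    proof -
      have "(u / v - 1) + d * (1 / v - 1) = (u + d) / v - (1 + d)"
        by (simp add: add_divide_distrib right_diff_distrib)
      then show ?thesis unfolding vv using v by simp
    qed
    have 2: "ln (u / v) + d * ln (1 / v) = (1 + d) * (ln (s / t) - ln v)"
      using u v lnst by (simp add: ln_div algebra_simps)
    have 3: "ln (u / v) + d * ln (1 / v) \<le> 0"
      using 1 sum mult_left_mono[OF 1(2), of d] assms by linarith
    then have "ln (s / t) \<le> ln v" using 2 assms by (simp add: mult_le_0_iff)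
    then have rv: "s / t \<le> v" using st v by (subst (asm) ln_le_cancel_iff) auto
    have key: "s * t powr d = (s / t) * t powr (1 + d)"
      using st by (simp add: powr_add)
    have key2: "s powr (1 + d) = u * t powr (1 + d)"
      using st by (simp add: u_def powr_divide)
    have eqn: "s powr (1 + d) + d * t powr (1 + d) = (1 + d) * (v * t powr (1 + d))"
      unfolding key2 using vv by (metis distrib_right mult.assoc)
    have le: "(1 + d) * (s * t powr d) \<le> s powr (1 + d) + d * t powr (1 + d)"
      unfolding eqn key using rv assms by (intro mult_left_mono mult_right_mono) auto
    moreover have "s = t" if "(1 + d) * (s * t powr d) = s powr (1 + d) + d * t powr (1 + d)"
    proof -
      have "(1 + d) * ((s / t) * t powr (1 + d)) = (1 + d) * (v * t powr (1 + d))"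
        using that unfolding eqn key .
      moreover have "t powr (1 + d) \<noteq> 0" "1 + d \<noteq> 0" using st assms by auto
      ultimately have "s / t = v" by (metis mult_cancel_left mult_cancel_right)
      then have "ln (u / v) + d * ln (1 / v) = 0" using 2 by simp
      then have "ln (u / v) = u / v - 1"
        using 1 sum mult_left_mono[OF 1(2), of d] assms by linarith
      then have "u / v = 1" using u v by (intro ln_eq_minus_one) auto
      then have "u = v" using v by simp
      then have "v = 1" using vv assms by (simp add: algebra_simps)
      then show "s = t" using \<open>s / t = v\<close> st by simp
    qed
    ultimately show ?thesis by blast
  qed
  show "(1 + d) * (s * t powr d) \<le> s powr (1 + d) + d * t powr (1 + d)"
    "(1 + d) * (s * t powr d) = s powr (1 + d) + d * t powr (1 + d) \<Longrightarrow> s = t"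
    using * by auto
qed

text \<open>Hoelder's inequality, normalised by the mean of \<open>x\<close> and \<open>y\<close>: the weights are the
  partial derivatives of the mean at \<open>(x, y)\<close>.  Its equality case is the source of strict convexity.\<close>

lemma pmean_holder:
  assumes d: "0 < d" and nn: "0 \<le> a" "0 \<le> b" "0 \<le> x" "0 \<le> y" and m: "0 < pmean d x y"
  defines "w \<equiv> (a * (x / pmean d x y) powr d + b * (y / pmean d x y) powr d) / 2"
  shows "w \<le> pmean d a b"
    and "w = pmean d a b \<Longrightarrow> a * pmean d x y = pmean d a b * x"
    and "w = pmean d a b \<Longrightarrow> b * pmean d x y = pmean d a b * y"
proof -
  define m where "m = pmean d x y"
  define A where "A = pmean d a b"
  have m0: "m > 0" using m by (simp add: m_def)
  have wm: "w = (a * (x / m) powr d + b * (y / m) powr d) / 2" by (simp add: w_def m_def)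
  have *: "w \<le> A \<and> (w = A \<longrightarrow> a * m = A * x \<and> b * m = A * y)"
  proof (cases "A = 0")
    case True
    then have "a = 0" "b = 0" using pmean_eq_0_iff[OF d nn(1,2)] by (auto simp: A_def)
    then show ?thesis using True by (simp add: wm)
  next
    case False
    then have A0: "A > 0" by (simp add: A_def less_le)
    define s1 s2 t1 t2 where "s1 = a / A" "s2 = b / A" "t1 = x / m" "t2 = y / m"
    note st = this
    have nn': "0 \<le> s1" "0 \<le> s2" "0 \<le> t1" "0 \<le> t2" using nn A0 m0 by (auto simp: st)
    have sumS: "s1 powr (1 + d) + s2 powr (1 + d) = 2"
    proof -
      have "s1 powr (1 + d) + s2 powr (1 + d) = (a powr (1 + d) + b powr (1 + d)) / A powr (1 + d)"
        using nn A0 by (simp add: st powr_divide add_divide_distrib)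
      also have "a powr (1 + d) + b powr (1 + d) = 2 * A powr (1 + d)"
        using pmean_powr[OF d, of a b] by (simp add: A_def)
      finally show ?thesis using A0 by simp
    qed
    have sumT: "t1 powr (1 + d) + t2 powr (1 + d) = 2"
    proof -
      have "t1 powr (1 + d) + t2 powr (1 + d) = (x powr (1 + d) + y powr (1 + d)) / m powr (1 + d)"
        using nn m0 by (simp add: st powr_divide add_divide_distrib)
      also have "x powr (1 + d) + y powr (1 + d) = 2 * m powr (1 + d)"
        using pmean_powr[OF d, of x y] by (simp add: m_def)
      finally show ?thesis using m0 by simp
    qed
    have wA: "w = A * ((s1 * t1 powr d + s2 * t2 powr d) / 2)"
      using A0 by (simp add: wm st field_simps)
    note y1 = young_powr[OF d nn'(1) nn'(3)] and y2 = young_powr[OF d nn'(2) nn'(4)]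
    define q1 q2 where "q1 = s1 * t1 powr d" "q2 = s2 * t2 powr d"
    note q = this
    have tot: "(s1 powr (1 + d) + d * t1 powr (1 + d)) + (s2 powr (1 + d) + d * t2 powr (1 + d)) = (1 + d) * 2"
      using sumS sumT by (metis add.commute add.left_commute distrib_left distrib_right mult_1)
    have "(1 + d) * (q1 + q2) \<le> (1 + d) * 2"
      using y1(1) y2(1) tot by (simp add: q distrib_left)
    then have qle: "q1 + q2 \<le> 2" using d by (subst (asm) mult_le_cancel_left_pos) auto
    then have le: "w \<le> A" using A0 by (simp add: wA flip: q)
    have "a * m = A * x \<and> b * m = A * y" if "w = A"
    proof -
      have "q1 + q2 = 2" using that A0 by (simp add: wA flip: q)
      then have "(1 + d) * q1 + (1 + d) * q2 = (1 + d) * 2" by (metis distrib_left)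
      then have e: "(1 + d) * q1 = s1 powr (1 + d) + d * t1 powr (1 + d)"
          "(1 + d) * q2 = s2 powr (1 + d) + d * t2 powr (1 + d)"
        using y1(1) y2(1) tot unfolding q by linarith+
      have "s1 = t1" "s2 = t2" using y1(2) y2(2) e unfolding q by auto
      then show ?thesis using A0 m0 by (simp add: st field_simps)
    qed
    then show ?thesis using le by auto
  qed
  show "w \<le> pmean d a b" "w = pmean d a b \<Longrightarrow> a * pmean d x y = pmean d a b * x"
    "w = pmean d a b \<Longrightarrow> b * pmean d x y = pmean d a b * y"
    using * by (auto simp: A_def m_def)
qed

lemma pmean_holder_self:
  assumes d: "0 < d" and nn: "0 \<le> x" "0 \<le> y" and m: "0 < pmean d x y"
  shows "(x * (x / pmean d x y) powr d + y * (y / pmean d x y) powr d) / 2 = pmean d x y"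
proof -
  define m where "m = pmean d x y"
  have m0: "m > 0" using m by (simp add: m_def)
  have "x * (x / m) powr d = x powr (1 + d) / m powr d" if "0 \<le> x" for x
    using that m0 by (cases "x = 0") (auto simp: powr_divide powr_add)
  then have "(x * (x / m) powr d + y * (y / m) powr d) / 2 = ((x powr (1 + d) + y powr (1 + d)) / 2) / m powr d"
    using nn by (simp add: add_divide_distrib)
  also have "\<dots> = m powr (1 + d) / m powr d"
    unfolding m_def pmean_powr[OF d] ..
  also have "\<dots> = m" using m0 by (simp add: powr_add)
  finally show ?thesis by (simp add: m_def)
qed

text \<open>Evaluate the mean of the sum by its own Hoelder weights.\<close>

lemma pmean_add:
  assumes d: "0 < d" and nn: "0 \<le> a" "0 \<le> b" "0 \<le> a'" "0 \<le> b'"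
  shows "pmean d (a + a') (b + b') \<le> pmean d a b + pmean d a' b'"
proof (cases "pmean d (a + a') (b + b') = 0")
  case True
  then show ?thesis by simp
next
  case False
  then have m: "0 < pmean d (a + a') (b + b')" by (simp add: less_le)
  define r s where "r = ((a + a') / pmean d (a + a') (b + b')) powr d"
    "s = ((b + b') / pmean d (a + a') (b + b')) powr d"
  have "pmean d (a + a') (b + b') = ((a + a') * r + (b + b') * s) / 2"
    using pmean_holder_self[OF d _ _ m] nn by (simp add: r_s_def)
  also have "\<dots> = (a * r + b * s) / 2 + (a' * r + b' * s) / 2"
    by (simp add: add_divide_distrib distrib_right)
  also have "\<dots> \<le> pmean d a b + pmean d a' b'"
    unfolding r_s_def by (intro add_mono pmean_holder(1) d nn m add_nonneg_nonneg)
  finally show ?thesis .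
qed

text \<open>Constant weights in Hoelder's inequality.\<close>

lemma mean_le_pmean:
  assumes d: "0 < d" and nn: "0 \<le> a" "0 \<le> b"
  shows "(a + b) / 2 \<le> pmean d a b"
  using pmean_holder(1)[OF d nn, of 1 1] d by (simp add: pmean_same)

lemma pmean_le_mean:
  assumes d: "0 < d" and nn: "0 \<le> a" "0 \<le> b"
  shows "pmean d a b \<le> 2 powr d * ((a + b) / 2)"
proof (cases "pmean d a b = 0")
  case True
  then show ?thesis using nn by simp
next
  case False
  then have m: "0 < pmean d a b" by (simp add: less_le)
  have *: "(a / pmean d a b) powr d \<le> 2 powr d" "(b / pmean d a b) powr d \<le> 2 powr d"
    using le_two_pmean[OF d nn] le_two_pmean[OF d nn(2,1)] m nn d
    by (auto intro!: powr_mono2 simp: pmean_commute[of d b a] divide_le_eq)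
  have "pmean d a b = (a * (a / pmean d a b) powr d + b * (b / pmean d a b) powr d) / 2"
    using pmean_holder_self[OF d nn m] by simp
  also have "\<dots> \<le> (a * 2 powr d + b * 2 powr d) / 2"
    using nn * by (intro divide_right_mono add_mono mult_left_mono) auto
  finally show ?thesis by (simp add: algebra_simps)
qed

lemma pmean_measurable [measurable]:
  assumes [measurable]: "f \<in> borel_measurable M" "g \<in> borel_measurable M"
  shows "(\<lambda>x. pmean d (f x) (g x)) \<in> borel_measurable M"
  unfolding pmean_def by measurable


section \<open>Iterated power means along a tower of transformations\<close>

text \<open>The model is the tower of rotations by \<open>2\<^bsup>-(i+1)\<^esup>\<close>: the first \<open>i\<close> maps generate a group with
  \<open>2\<^bsup>i\<^esup>\<close> elements.  Ergodicity concerns all maps together, whereas for each \<open>i\<close> there are fine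
  partitions into sets invariant under the first \<open>i\<close> maps.\<close>

locale mean_tower = prob_space M for M :: "'a measure" +
  fixes \<tau> :: "nat \<Rightarrow> 'a \<Rightarrow> 'a" and \<delta> :: "nat \<Rightarrow> real"
  assumes \<tau>_measurable [measurable]: "\<And>i. \<tau> i \<in> M \<rightarrow>\<^sub>M M"
    and \<tau>_distr: "\<And>i. distr M M (\<tau> i) = M"
    and \<tau>_commute: "\<And>i j x. x \<in> space M \<Longrightarrow> \<tau> i (\<tau> j x) = \<tau> j (\<tau> i x)"
    and \<tau>_0: "\<And>x. x \<in> space M \<Longrightarrow> \<tau> 0 (\<tau> 0 x) = x"
    and \<tau>_Suc: "\<And>i x. x \<in> space M \<Longrightarrow> \<tau> (Suc i) (\<tau> (Suc i) x) = \<tau> i x"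
    and ergodic: "\<And>S. S \<in> sets M \<Longrightarrow> (\<And>i x. x \<in> space M \<Longrightarrow> \<tau> i x \<in> S \<longleftrightarrow> x \<in> S) \<Longrightarrow>
          prob S = 0 \<or> prob S = 1"
    and fine_partition: "\<And>i e. 0 < e \<Longrightarrow> \<exists>n. \<exists>J \<in> M \<rightarrow>\<^sub>M count_space UNIV.
          (\<forall>x\<in>space M. J x < n \<and> (\<forall>j<i. J (\<tau> j x) = J x)) \<and>
          (\<forall>k<n. prob {x\<in>space M. J x = (k::nat)} < e)"
    and \<delta>_pos: "\<And>i. 0 < \<delta> i"
    and \<delta>_summable: "summable \<delta>"
    and \<delta>_summable': "summable (\<lambda>i. real i * \<delta> i)"
begin

lemma \<tau>_space [simp]: "x \<in> space M \<Longrightarrow> \<tau> i x \<in> space M"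
  by (rule measurable_space[OF \<tau>_measurable])

lemma integral_\<tau>:
  fixes f :: "'a \<Rightarrow> 'b::{banach, second_countable_topology}"
  assumes [measurable]: "f \<in> borel_measurable M"
  shows "(\<integral>x. f (\<tau> i x) \<partial>M) = integral\<^sup>L M f"
proof -
  have "integral\<^sup>L (distr M M (\<tau> i)) f = (\<integral>x. f (\<tau> i x) \<partial>M)"
    by (rule integral_distr) auto
  then show ?thesis by (simp add: \<tau>_distr)
qed

lemma integrable_\<tau>:
  fixes f :: "'a \<Rightarrow> 'b::{banach, second_countable_topology}"
  assumes "integrable M f"
  shows "integrable M (\<lambda>x. f (\<tau> i x))"
  using assms integrable_distr[of "\<tau> i" M M f] by (simp add: \<tau>_distr)

lemma AE_\<tau>:
  assumes "AE x in M. P x"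
  shows "AE x in M. P (\<tau> i x)"
proof (rule AE_distrD[OF \<tau>_measurable])
  show "AE x in distr M M (\<tau> i). P x"
    unfolding \<tau>_distr by (rule assms)
qed

text \<open>The function \<open>G i f\<close> is constant on the orbits of the group generated by the first \<open>i\<close> maps, and its
  value there is a norm of the restriction of \<open>f\<close> to the orbit.\<close>

primrec G :: "nat \<Rightarrow> ('a \<Rightarrow> 'b::real_normed_vector) \<Rightarrow> 'a \<Rightarrow> real" where
  "G 0 f = (\<lambda>x. norm (f x))"
| "G (Suc i) f = (\<lambda>x. pmean (\<delta> i) (G i f x) (G i f (\<tau> i x)))"

lemma G_nonneg [simp]: "0 \<le> G i f x"
  by (cases i) auto

lemma G_measurable [measurable]:
  fixes f :: "'a \<Rightarrow> 'b::{real_normed_vector, second_countable_topology}"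
  assumes [measurable]: "f \<in> borel_measurable M"
  shows "G i f \<in> borel_measurable M"
proof (induction i)
  case (Suc i)
  note [measurable] = Suc
  show ?case by simp
qed simp

lemma G_invariant:
  assumes "x \<in> space M" "j < i"
  shows "G i f (\<tau> j x) = G i f x"
  using assms
proof (induction i arbitrary: x j)
  case (Suc i)
  note IH = Suc.IH and x = Suc.prems(1) and ji = Suc.prems(2)
  show ?case
  proof (cases "j = i")
    case True
    have "G i f (\<tau> i (\<tau> i x)) = G i f x"
    proof (cases i)
      case 0
      then show ?thesis by (simp add: \<tau>_0 x)
    next
      case i: (Suc k)
      have "G i f (\<tau> k x) = G i f x" by (rule IH) (use i x in auto)
      then show ?thesis unfolding i \<tau>_Suc[OF x] .
    qed
    then show ?thesis unfolding True G.simps by (subst pmean_commute) simp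
  next
    case False
    then have "j < i" using ji by simp
    then have "G i f (\<tau> j x) = G i f x" "G i f (\<tau> j (\<tau> i x)) = G i f (\<tau> i x)"
      by (auto intro!: IH x \<tau>_space)
    then show ?thesis unfolding G.simps by (simp only: \<tau>_commute[OF x, of i j])
  qed
qed simp

lemma G_scale:
  assumes "\<And>x. norm (g x) = c * norm (f x)" "0 \<le> c"
  shows "G i g x = c * G i f x"
  using assms by (induction i arbitrary: x) (auto simp: pmean_scale \<delta>_pos)

lemma G_mono:
  assumes "\<And>x. norm (f x) \<le> norm (g x)"
  shows "G i f x \<le> G i g x"
  using assms by (induction i arbitrary: x) (auto intro!: pmean_mono simp: \<delta>_pos)

lemma G_add: "G i (\<lambda>x. f x + g x) x \<le> G i f x + G i g x"
proof (induction i arbitrary: x)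
  case (Suc i)
  have "G (Suc i) (\<lambda>x. f x + g x) x \<le> pmean (\<delta> i) (G i f x + G i g x) (G i f (\<tau> i x) + G i g (\<tau> i x))"
    using Suc by (auto intro!: pmean_mono simp: \<delta>_pos)
  also have "\<dots> \<le> G (Suc i) f x + G (Suc i) g x"
    by (simp add: pmean_add \<delta>_pos)
  finally show ?case .
qed (simp add: norm_triangle_ineq)

lemma G_uminus: "G i (\<lambda>x. - f x) x = G i f x"
  using G_scale[of "\<lambda>x. - f x" 1 f] by simp

lemma G_diff_le: "\<bar>G i f x - G i g x\<bar> \<le> G i (\<lambda>x. f x - g x) x"
proof -
  have "G i f x \<le> G i (\<lambda>x. f x - g x) x + G i g x"
    using G_add[of i "\<lambda>x. f x - g x" g x] by simp
  moreover have "G i g x \<le> G i (\<lambda>x. g x - f x) x + G i f x"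
    using G_add[of i "\<lambda>x. g x - f x" f x] by simp
  moreover have "G i (\<lambda>x. g x - f x) x = G i (\<lambda>x. f x - g x) x"
    using G_uminus[of i "\<lambda>x. f x - g x" x] by simp
  ultimately show ?thesis by linarith
qed

lemma G_add_diff_le: "\<bar>G i (\<lambda>x. f x + g x) x - G i g x\<bar> \<le> G i f x"
  using G_diff_le[of i "\<lambda>x. f x + g x" x g] by simp

lemma G_le_two_Suc: "G i f x \<le> 2 * G (Suc i) f x"
  by (simp add: le_two_pmean \<delta>_pos)

lemma G_le_two_power: "G i f x \<le> 2 ^ k * G (i + k) f x"
proof (induction k)
  case (Suc k)
  have "G i f x \<le> 2 ^ k * G (i + k) f x" by (rule Suc)
  also have "\<dots> \<le> 2 ^ k * (2 * G (Suc (i + k)) f x)"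
    by (intro mult_left_mono G_le_two_Suc) auto
  finally show ?case by simp
qed simp

lemma G_pos_mono:
  assumes "0 < G i f x" "i \<le> k"
  shows "0 < G k f x"
proof -
  have "0 < 2 ^ (k - i) * G k f x"
    using G_le_two_power[of i f x "k - i"] assms by simp
  then show ?thesis by (simp add: zero_less_mult_iff)
qed

text \<open>The first \<open>i\<close> maps do not leave an invariant set; so level \<open>i\<close> is an \<open>L\<^sub>1\<close>-sum over
  such sets.\<close>

lemma G_restrict:
  fixes f :: "'a \<Rightarrow> 'b::real_normed_vector"
  assumes "x \<in> space M" "\<And>y j. y \<in> space M \<Longrightarrow> j < i \<Longrightarrow> \<tau> j y \<in> A \<longleftrightarrow> y \<in> A"
  shows "G i (\<lambda>x. if x \<in> A then f x else 0) x = (if x \<in> A then G i f x else 0)"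
  using assms
proof (induction i arbitrary: x)
  case (Suc i)
  have inv: "\<tau> j y \<in> A \<longleftrightarrow> y \<in> A" if "y \<in> space M" "j < i" for y j
    using Suc.prems(2)[of y j] that by simp
  have "G i (\<lambda>x. if x \<in> A then f x else 0) x = (if x \<in> A then G i f x else 0)"
    "G i (\<lambda>x. if x \<in> A then f x else 0) (\<tau> i x) = (if \<tau> i x \<in> A then G i f (\<tau> i x) else 0)"
    using Suc.IH[OF _ inv] Suc.prems(1) \<tau>_space by blast+
  moreover have "\<tau> i x \<in> A \<longleftrightarrow> x \<in> A"
    using Suc.prems by blast
  moreover have "pmean (\<delta> i) 0 0 = 0" by (simp add: pmean_eq_0_iff \<delta>_pos)
  ultimately show ?case by simp
qed auto

lemma G_cong_AE:
  assumes "AE x in M. f x = g x"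
  shows "AE x in M. G i f x = G i g x"
proof (induction i)
  case 0
  then show ?case using assms by (auto elim: eventually_mono)
next
  case (Suc i)
  show ?case using Suc AE_\<tau>[OF Suc, of i] by eventually_elim auto
qed

lemma G_integrable [simp]:
  fixes f :: "'a \<Rightarrow> 'b::{banach, second_countable_topology}"
  assumes f: "integrable M f"
  shows "integrable M (G i f)"
proof (induction i)
  case (Suc i)
  note I = Suc integrable_\<tau>[OF Suc, of i]
  have fm[measurable]: "f \<in> borel_measurable M" using f by simp
  have "integrable M (\<lambda>x. 2 powr \<delta> i * ((G i f x + G i f (\<tau> i x)) / 2))"
    using I by auto
  then show ?case
  proof (rule Bochner_Integration.integrable_bound)
    have "norm (G (Suc i) f x) \<le> norm (2 powr \<delta> i * ((G i f x + G i f (\<tau> i x)) / 2))" for x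
    proof -
      have "G (Suc i) f x \<le> 2 powr \<delta> i * ((G i f x + G i f (\<tau> i x)) / 2)"
        using pmean_le_mean[of "\<delta> i" "G i f x" "G i f (\<tau> i x)"] \<delta>_pos by simp
      then show ?thesis using G_nonneg[of "Suc i" f x] by (metis abs_ge_self abs_of_nonneg order_trans real_norm_def)
    qed
    then show "AE x in M. norm (G (Suc i) f x) \<le> norm (2 powr \<delta> i * ((G i f x + G i f (\<tau> i x)) / 2))"
      by simp
  qed measurable
qed (use f in auto)

definition Nl :: "nat \<Rightarrow> ('a \<Rightarrow> 'b::{banach, second_countable_topology}) \<Rightarrow> real" where
  "Nl i f = (\<integral>x. G i f x \<partial>M)"

definition N :: "('a \<Rightarrow> 'b::{banach, second_countable_topology}) \<Rightarrow> real" where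
  "N f = lim (\<lambda>i. Nl i f)"

text \<open>The factor by which the levels from \<open>i\<close> onwards can increase the norm.\<close>

definition \<kappa> :: "nat \<Rightarrow> real" where
  "\<kappa> i = 2 powr (\<Sum>j. \<delta> (j + i))"

lemma \<delta>_tail_summable: "summable (\<lambda>j. \<delta> (j + i))"
  using \<delta>_summable by (simp add: summable_iff_shift)

lemma prod_le_\<kappa>: "(\<Prod>j<n. 2 powr \<delta> (j + i)) \<le> \<kappa> i"
proof -
  have "(\<Prod>j<n. 2 powr \<delta> (j + i)) = 2 powr (\<Sum>j<n. \<delta> (j + i))"
    by (simp add: powr_sum)
  also have "\<dots> \<le> \<kappa> i"
    unfolding \<kappa>_def by (intro powr_mono sum_le_suminf \<delta>_tail_summable) (auto simp: \<delta>_pos less_imp_le)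
  finally show ?thesis .
qed

lemma \<kappa>_ge_1: "1 \<le> \<kappa> i"
  using prod_le_\<kappa>[of i 0] by simp

lemma \<kappa>_tendsto: "\<kappa> \<longlonglongrightarrow> 1"
proof -
  have "(\<lambda>i. \<Sum>j. \<delta> (j + i)) \<longlonglongrightarrow> 0"
    by (rule suminf_exist_split2[OF \<delta>_summable])
  then have "(\<lambda>i. 2 powr (\<Sum>j. \<delta> (j + i))) \<longlonglongrightarrow> 2 powr 0"
    by (intro tendsto_intros) auto
  then show ?thesis by (simp add: \<kappa>_def[abs_def])
qed

context
  fixes f :: "'a \<Rightarrow> 'b::{banach, second_countable_topology}"
  assumes f: "integrable M f"
begin

lemma Nl_nonneg: "0 \<le> Nl i f"
  by (simp add: Nl_def)

lemma Nl_Suc: "Nl i f \<le> Nl (Suc i) f" "Nl (Suc i) f \<le> 2 powr \<delta> i * Nl i f"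
proof -
  have fm[measurable]: "f \<in> borel_measurable M" using f by simp
  note I = G_integrable[OF f, of i] integrable_\<tau>[OF G_integrable[OF f, of i], of i]
  have eq: "(\<integral>x. (G i f x + G i f (\<tau> i x)) / 2 \<partial>M) = Nl i f"
    using I by (simp add: Nl_def integral_\<tau>)
  have "(\<integral>x. (G i f x + G i f (\<tau> i x)) / 2 \<partial>M) \<le> Nl (Suc i) f"
    unfolding Nl_def using I G_integrable[OF f, of "Suc i"]
  proof (intro integral_mono)
    show "(G i f x + G i f (\<tau> i x)) / 2 \<le> G (Suc i) f x" for x
      using mean_le_pmean[of "\<delta> i" "G i f x" "G i f (\<tau> i x)"] \<delta>_pos by simp
  qed auto
  then show "Nl i f \<le> Nl (Suc i) f" unfolding eq .
  have "Nl (Suc i) f \<le> (\<integral>x. 2 powr \<delta> i * ((G i f x + G i f (\<tau> i x)) / 2) \<partial>M)"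
    unfolding Nl_def using I G_integrable[OF f, of "Suc i"]
  proof (intro integral_mono)
    show "G (Suc i) f x \<le> 2 powr \<delta> i * ((G i f x + G i f (\<tau> i x)) / 2)" for x
      using pmean_le_mean[of "\<delta> i" "G i f x" "G i f (\<tau> i x)"] \<delta>_pos by simp
  qed auto
  then show "Nl (Suc i) f \<le> 2 powr \<delta> i * Nl i f" by (simp only: integral_mult_right_zero eq)
qed

lemma Nl_mono: "i \<le> k \<Longrightarrow> Nl i f \<le> Nl k f"
  by (rule lift_Suc_mono_le[of "\<lambda>i. Nl i f"]) (rule Nl_Suc)

lemma Nl_le_\<kappa>: "Nl k f \<le> \<kappa> i * Nl i f"
proof (cases "i \<le> k")
  case True
  have "Nl (i + n) f \<le> (\<Prod>j<n. 2 powr \<delta> (j + i)) * Nl i f" for n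
  proof (induction n)
    case (Suc n)
    have "Nl (i + Suc n) f \<le> 2 powr \<delta> (i + n) * Nl (i + n) f"
      unfolding add_Suc_right by (rule Nl_Suc(2))
    also have "\<dots> \<le> 2 powr \<delta> (i + n) * ((\<Prod>j<n. 2 powr \<delta> (j + i)) * Nl i f)"
      by (intro mult_left_mono Suc) auto
    also have "\<dots> = (\<Prod>j<Suc n. 2 powr \<delta> (j + i)) * Nl i f"
      unfolding prod.lessThan_Suc by (simp only: mult_ac add_ac)
    finally show ?case .
  qed simp
  from this[of "k - i"] have "Nl k f \<le> (\<Prod>j<k-i. 2 powr \<delta> (j + i)) * Nl i f"
    unfolding le_add_diff_inverse[OF True] .
  also have "\<dots> \<le> \<kappa> i * Nl i f" by (intro mult_right_mono prod_le_\<kappa> Nl_nonneg)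
  finally show ?thesis .
next
  case False
  then have "Nl k f \<le> Nl i f" by (intro Nl_mono) auto
  also have "\<dots> \<le> \<kappa> i * Nl i f" using mult_right_mono[OF \<kappa>_ge_1 Nl_nonneg, of i] by simp
  finally show ?thesis .
qed

lemma Nl_tendsto: "(\<lambda>i. Nl i f) \<longlonglongrightarrow> N f"
proof -
  have "incseq (\<lambda>i. Nl i f)" unfolding incseq_def by (blast intro: Nl_mono)
  moreover have "\<forall>i. Nl i f \<le> \<kappa> 0 * Nl 0 f" by (blast intro: Nl_le_\<kappa>)
  ultimately obtain L where "(\<lambda>i. Nl i f) \<longlonglongrightarrow> L" by (rule incseq_convergent)
  then show ?thesis by (simp add: N_def limI)
qed

lemma Nl_le_N: "Nl i f \<le> N f"
  by (rule LIMSEQ_le_const[OF Nl_tendsto]) (auto intro: Nl_mono)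

lemma N_le_\<kappa>: "N f \<le> \<kappa> i * Nl i f"
  by (rule LIMSEQ_le_const2[OF Nl_tendsto]) (auto intro: Nl_le_\<kappa>)

lemma N_nonneg: "0 \<le> N f"
  using Nl_nonneg[of 0] Nl_le_N[of 0] by linarith

lemma L1_le_N: "(\<integral>x. norm (f x) \<partial>M) \<le> N f"
  using Nl_le_N[of 0] by (simp add: Nl_def)

lemma N_le_L1: "N f \<le> \<kappa> 0 * (\<integral>x. norm (f x) \<partial>M)"
  using N_le_\<kappa>[of 0] by (simp add: Nl_def)

lemma N_eq_0_iff: "N f = 0 \<longleftrightarrow> (AE x in M. f x = 0)"
proof -
  have *: "(\<integral>x. norm (f x) \<partial>M) = 0 \<longleftrightarrow> (AE x in M. f x = 0)"
    using f by (subst integral_nonneg_eq_0_iff_AE) auto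
  have "0 \<le> (\<integral>x. norm (f x) \<partial>M)" by simp
  moreover have "(\<integral>x. norm (f x) \<partial>M) = 0 \<Longrightarrow> N f = 0"
    using N_le_L1 N_nonneg by simp
  ultimately have "N f = 0 \<longleftrightarrow> (\<integral>x. norm (f x) \<partial>M) = 0"
    using L1_le_N by linarith
  then show ?thesis using * by simp
qed

end

lemma Nl_cong_AE:
  assumes "integrable M f" "integrable M g" "AE x in M. f x = g x"
  shows "Nl i f = Nl i g"
proof -
  have [measurable]: "f \<in> borel_measurable M" "g \<in> borel_measurable M" using assms by auto
  show ?thesis unfolding Nl_def
    by (intro integral_cong_AE G_cong_AE assms) auto
qed

lemma N_cong_AE:
  assumes "integrable M f" "integrable M g" "AE x in M. f x = g x"
  shows "N f = N g"
  unfolding N_def using Nl_cong_AE[OF assms] by simp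

lemma Nl_add:
  assumes "integrable M f" "integrable M g"
  shows "Nl i (\<lambda>x. f x + g x) \<le> Nl i f + Nl i g"
proof -
  have "Nl i (\<lambda>x. f x + g x) \<le> (\<integral>x. G i f x + G i g x \<partial>M)"
    unfolding Nl_def using assms by (intro integral_mono G_add) auto
  then show ?thesis using assms by (simp add: Nl_def)
qed

lemma N_add:
  assumes "integrable M f" "integrable M g"
  shows "N (\<lambda>x. f x + g x) \<le> N f + N g"
  using assms by (intro LIMSEQ_le[OF Nl_tendsto tendsto_add[OF Nl_tendsto Nl_tendsto]])
    (auto intro!: exI[of _ 0] Nl_add)

lemma Nl_scale:
  assumes "\<And>x. norm (g x) = c * norm (f x)" "0 \<le> c"
  shows "Nl i g = c * Nl i f"
proof -
  have "G i g = (\<lambda>x. c * G i f x)"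
    by (rule ext, rule G_scale) (use assms in auto)
  then show ?thesis by (simp add: Nl_def)
qed

lemma N_scale:
  assumes "integrable M f" "integrable M g" "\<And>x. norm (g x) = c * norm (f x)" "0 \<le> c"
  shows "N g = c * N f"
proof (rule LIMSEQ_unique[OF Nl_tendsto[OF assms(2)]])
  show "(\<lambda>i. Nl i g) \<longlonglongrightarrow> c * N f"
    unfolding Nl_scale[OF assms(3,4)] by (intro tendsto_intros Nl_tendsto assms)
qed

end


lemma AE_summable_of_integral_summable:
  fixes f :: "nat \<Rightarrow> 'a \<Rightarrow> real"
  assumes int: "\<And>i. integrable M (f i)" and nn: "\<And>i x. 0 \<le> f i x"
    and sm: "summable (\<lambda>i. \<integral>x. f i x \<partial>M)"
  shows "AE x in M. summable (\<lambda>i. f i x)"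
proof -
  have [measurable]: "f i \<in> borel_measurable M" for i using int by simp
  have "(\<integral>\<^sup>+x. (\<Sum>i. ennreal (f i x)) \<partial>M) = (\<Sum>i. \<integral>\<^sup>+x. ennreal (f i x) \<partial>M)"
    by (rule nn_integral_suminf) simp
  also have "\<dots> = (\<Sum>i. ennreal (\<integral>x. f i x \<partial>M))"
    using int nn by (intro suminf_cong nn_integral_eq_integral) auto
  also have "\<dots> \<noteq> \<infinity>"
    using sm nn by (simp add: suminf_ennreal2)
  finally have "AE x in M. (\<Sum>i. ennreal (f i x)) \<noteq> \<infinity>"
    by (intro nn_integral_PInf_AE) auto
  then show ?thesis
    by eventually_elim (use nn in \<open>auto intro!: summable_suminf_not_top\<close>)
qed

context mean_tower begin

section \<open>The weights of the norming functionals\<close>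

text \<open>The ratios \<open>r i z\<close> are the Hoelder weights of level \<open>i\<close>, and \<open>V i z\<close> is the infinite product of
  \<open>r i z\<close>, \<open>r (i + 1) z\<close>, and so on.  The formal derivative of \<open>N\<close> at \<open>z\<close>, as a function of \<open>G i z\<close>, has
  density \<open>V i z\<close>.  Where a ratio is \<open>0 / 0\<close> it counts as \<open>0\<close>, which is the right value: the
  product then vanishes almost everywhere exactly where \<open>G i z\<close> does.\<close>

definition r :: "nat \<Rightarrow> ('a \<Rightarrow> 'b::real_normed_vector) \<Rightarrow> 'a \<Rightarrow> real" where
  "r i z x = (G i z x / G (Suc i) z x) powr \<delta> i"

primrec W :: "nat \<Rightarrow> nat \<Rightarrow> ('a \<Rightarrow> 'b::real_normed_vector) \<Rightarrow> 'a \<Rightarrow> real" where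
  "W 0 i z x = 1"
| "W (Suc n) i z x = r i z x * W n (Suc i) z x"

definition V :: "nat \<Rightarrow> ('a \<Rightarrow> 'b::real_normed_vector) \<Rightarrow> 'a \<Rightarrow> real" where
  "V i z x = lim (\<lambda>n. W n i z x)"

lemma r_nonneg [simp]: "0 \<le> r i z x"
  by (simp add: r_def)

lemma r_le: "r i z x \<le> 2 powr \<delta> i"
proof -
  have "G i z x / G (Suc i) z x \<le> 2"
  proof (cases "G (Suc i) z x = 0")
    case False
    then have "0 < G (Suc i) z x" using G_nonneg[of "Suc i" z x] by linarith
    then show ?thesis using G_le_two_Suc[of i z x] by (simp add: divide_le_eq del: G.simps)
  qed simp
  then show ?thesis unfolding r_def
    using \<delta>_pos[of i] by (intro powr_mono2) (auto simp del: G.simps)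
qed

lemma r_measurable [measurable]:
  fixes z :: "'a \<Rightarrow> 'b::{real_normed_vector, second_countable_topology}"
  assumes [measurable]: "z \<in> borel_measurable M"
  shows "r i z \<in> borel_measurable M"
  unfolding r_def[abs_def] by (simp del: G.simps)

lemma W_measurable [measurable]:
  fixes z :: "'a \<Rightarrow> 'b::{real_normed_vector, second_countable_topology}"
  assumes [measurable]: "z \<in> borel_measurable M"
  shows "W n i z \<in> borel_measurable M"
proof (induction n arbitrary: i)
  case (Suc n)
  note [measurable] = Suc
  have "W (Suc n) i z = (\<lambda>x. r i z x * W n (Suc i) z x)" by auto
  then show ?case by simp
next
  case 0
  have "W 0 i z = (\<lambda>x. 1)" by auto
  then show ?case by simp
qed

lemma V_measurable [measurable]:
  fixes z :: "'a \<Rightarrow> 'b::{real_normed_vector, second_countable_topology}"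
  assumes [measurable]: "z \<in> borel_measurable M"
  shows "V i z \<in> borel_measurable M"
  unfolding V_def[abs_def] by simp

lemma W_nonneg [simp]: "0 \<le> W n i z x"
  by (induction n arbitrary: i) auto

lemma W_le: "W n i z x \<le> \<kappa> i"
proof -
  have "W n i z x \<le> (\<Prod>j<n. 2 powr \<delta> (j + i))"
  proof (induction n arbitrary: i)
    case (Suc n)
    have "W (Suc n) i z x \<le> 2 powr \<delta> i * (\<Prod>j<n. 2 powr \<delta> (j + Suc i))"
      unfolding W.simps by (intro mult_mono Suc r_le) auto
    also have "\<dots> = (\<Prod>j<Suc n. 2 powr \<delta> (j + i))"
      by (subst prod.lessThan_Suc_shift) simp
    finally show ?case .
  qed simp
  then show ?thesis using prod_le_\<kappa> order_trans by blast
qed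

lemma W_Suc_right: "W (Suc n) i z x = W n i z x * r (i + n) z x"
proof (induction n arbitrary: i)
  case (Suc n)
  have "W (Suc (Suc n)) i z x = r i z x * W (Suc n) (Suc i) z x" by simp
  also have "\<dots> = r i z x * (W n (Suc i) z x * r (Suc i + n) z x)" by (subst Suc) simp
  finally show ?case by simp
qed simp

lemma r_invariant: "x \<in> space M \<Longrightarrow> j < i \<Longrightarrow> r i z (\<tau> j x) = r i z x"
  unfolding r_def using G_invariant[of x j i z] G_invariant[of x j "Suc i" z] by (simp del: G.simps)

lemma W_invariant: "x \<in> space M \<Longrightarrow> j < i \<Longrightarrow> W n i z (\<tau> j x) = W n i z x"
  by (induction n arbitrary: i) (auto simp: r_invariant)

lemma V_invariant: "x \<in> space M \<Longrightarrow> j < i \<Longrightarrow> V i z (\<tau> j x) = V i z x"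
  by (simp add: V_def W_invariant)

text \<open>The average of \<open>G i u \<cdot> r i z\<close> over the pair \<open>x\<close>, \<open>\<tau> i x\<close>, to which Hoelder's inequality applies.\<close>

definition avg :: "nat \<Rightarrow> ('a \<Rightarrow> 'b::real_normed_vector) \<Rightarrow> ('a \<Rightarrow> 'b) \<Rightarrow> 'a \<Rightarrow> real" where
  "avg i u z x = (G i u x * r i z x + G i u (\<tau> i x) * r i z (\<tau> i x)) / 2"

lemma r_\<tau>: "x \<in> space M \<Longrightarrow> r i z (\<tau> i x) = (G i z (\<tau> i x) / G (Suc i) z x) powr \<delta> i"
  using G_invariant[of x i "Suc i" z] by (simp add: r_def del: G.simps)

lemma avg_le:
  assumes "x \<in> space M"
  shows "avg i u z x \<le> G (Suc i) u x"
proof (cases "G (Suc i) z x = 0")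
  case True
  then have "r i z (\<tau> i x) = 0" "r i z x = 0"
    unfolding r_\<tau>[OF assms] by (simp_all add: r_def del: G.simps)
  then show ?thesis by (simp add: avg_def del: G.simps)
next
  case False
  then have "0 < pmean (\<delta> i) (G i z x) (G i z (\<tau> i x))"
    by (simp add: less_le)
  from pmean_holder(1)[OF \<delta>_pos _ _ _ _ this, of "G i u x" "G i u (\<tau> i x)"]
  show ?thesis using r_\<tau>[OF assms, of i z] by (simp add: avg_def r_def)
qed

lemma avg_eq_imp:
  assumes "x \<in> space M" and z: "0 < G (Suc i) z x" and eq: "avg i u z x = G (Suc i) u x"
  shows "G i u x * G (Suc i) z x = G (Suc i) u x * G i z x"
proof -
  have m: "0 < pmean (\<delta> i) (G i z x) (G i z (\<tau> i x))" using z by simp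
  from pmean_holder(2)[OF \<delta>_pos _ _ _ _ this, of "G i u x" "G i u (\<tau> i x)"]
  show ?thesis using eq r_\<tau>[OF assms(1), of i z] by (simp add: avg_def r_def)
qed

lemma avg_self:
  assumes "x \<in> space M"
  shows "avg i z z x = G (Suc i) z x"
proof (cases "G (Suc i) z x = 0")
  case True
  then have "G i z x = 0" "G i z (\<tau> i x) = 0"
    using pmean_eq_0_iff[OF \<delta>_pos[of i] G_nonneg[of i z x] G_nonneg[of i z "\<tau> i x"]] by auto
  then show ?thesis using True by (simp add: avg_def del: G.simps)
next
  case False
  then have m: "0 < pmean (\<delta> i) (G i z x) (G i z (\<tau> i x))"
    by (simp add: less_le)
  from pmean_holder_self[OF \<delta>_pos _ _ this]
  show ?thesis using r_\<tau>[OF assms(1), of i z] by (simp add: avg_def r_def)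
qed

lemma integrable_mult_bounded:
  fixes f g :: "'a \<Rightarrow> real"
  assumes f: "integrable M f" and [measurable]: "g \<in> borel_measurable M" and g: "AE x in M. \<bar>g x\<bar> \<le> c"
  shows "integrable M (\<lambda>x. f x * g x)"
proof (rule Bochner_Integration.integrable_bound)
  show "integrable M (\<lambda>x. c * f x)" using f by simp
  have [measurable]: "f \<in> borel_measurable M" using f by simp
  show "(\<lambda>x. f x * g x) \<in> borel_measurable M" by measurable
  show "AE x in M. norm (f x * g x) \<le> norm (c * f x)"
    using g
  proof eventually_elim
    case (elim x)
    have "\<bar>f x\<bar> * \<bar>g x\<bar> \<le> \<bar>f x\<bar> * \<bar>c\<bar>" using elim by (intro mult_left_mono) auto
    then show ?case by (simp add: abs_mult mult.commute)
  qed
qed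

lemma integrable_Gr:
  fixes u z :: "'a \<Rightarrow> 'b::{banach, second_countable_topology}"
  assumes u: "integrable M u" and z: "integrable M z"
  shows "integrable M (\<lambda>x. G i u x * r i z x)"
proof -
  have [measurable]: "z \<in> borel_measurable M" using z by simp
  show ?thesis
    by (rule integrable_mult_bounded[where c="2 powr \<delta> i"]) (use u in \<open>auto simp: r_le\<close>)
qed

lemma integrable_avg:
  fixes u z :: "'a \<Rightarrow> 'b::{banach, second_countable_topology}"
  assumes u: "integrable M u" and z: "integrable M z"
  shows "integrable M (avg i u z)"
  unfolding avg_def[abs_def] using integrable_Gr[OF u z, of i] integrable_\<tau>[OF integrable_Gr[OF u z, of i], of i]
  by simp

text \<open>The map \<open>\<tau> i\<close> preserves the measure and the weight.\<close>

lemma integral_avg: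
  fixes u z :: "'a \<Rightarrow> 'b::{banach, second_countable_topology}"
  assumes u: "integrable M u" and z: "integrable M z"
    and w [measurable]: "w \<in> borel_measurable M" and wb: "AE x in M. \<bar>w x\<bar> \<le> c"
    and inv: "\<And>x. x \<in> space M \<Longrightarrow> w (\<tau> i x) = w x"
  shows "(\<integral>x. avg i u z x * w x \<partial>M) = (\<integral>x. G i u x * r i z x * w x \<partial>M)"
proof -
  let ?h = "\<lambda>x. G i u x * r i z x * w x"
  have h: "integrable M ?h"
    by (rule integrable_mult_bounded[OF integrable_Gr[OF u z] w wb])
  have "(\<integral>x. avg i u z x * w x \<partial>M) = (\<integral>x. (?h x + ?h (\<tau> i x)) / 2 \<partial>M)"
    by (rule Bochner_Integration.integral_cong) (auto simp: avg_def inv algebra_simps add_divide_distrib)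
  also have "\<dots> = ((\<integral>x. ?h x \<partial>M) + (\<integral>x. ?h (\<tau> i x) \<partial>M)) / 2"
    using h integrable_\<tau>[OF h, of i] by simp
  also have "(\<integral>x. ?h (\<tau> i x) \<partial>M) = (\<integral>x. ?h x \<partial>M)"
    using h by (intro integral_\<tau>) auto
  finally show ?thesis by simp
qed

text \<open>Peel off the levels one by one: the remaining product is invariant under \<open>\<tau> i\<close>, so averaging over
  \<open>\<tau> i\<close> turns the innermost factor into a Hoelder sum.\<close>

lemma integral_GW:
  fixes u z :: "'a \<Rightarrow> 'b::{banach, second_countable_topology}"
  assumes u: "integrable M u" and z: "integrable M z"
  shows "(\<integral>x. G i u x * W n i z x \<partial>M) \<le> Nl (i + n) u"
    and "(\<integral>x. G i z x * W n i z x \<partial>M) = Nl (i + n) z"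
proof -
  have [measurable]: "z \<in> borel_measurable M" using z by simp
  have *: "(\<integral>x. G i u x * W n i z x \<partial>M) \<le> Nl (i + n) u \<and>
     (\<integral>x. G i z x * W n i z x \<partial>M) = Nl (i + n) z"
  proof (induction n arbitrary: i)
    case 0
    then show ?case by (simp add: Nl_def)
  next
    case (Suc n)
    let ?w = "W n (Suc i) z"
    have wb: "AE x in M. \<bar>?w x\<bar> \<le> \<kappa> (Suc i)" by (auto simp: W_le)
    have inv: "?w (\<tau> i x) = ?w x" if "x \<in> space M" for x using that by (simp add: W_invariant)
    have eq: "(\<integral>x. G i v x * W (Suc n) i z x \<partial>M) = (\<integral>x. avg i v z x * ?w x \<partial>M)" if "integrable M v" for v
      by (subst integral_avg[OF that z _ wb inv]) (auto simp: mult.assoc)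
    have "(\<integral>x. avg i u z x * ?w x \<partial>M) \<le> (\<integral>x. G (Suc i) u x * ?w x \<partial>M)"
      by (intro integral_mono mult_right_mono avg_le integrable_mult_bounded[OF _ _ wb]
          integrable_avg G_integrable u z) auto
    moreover have "(\<integral>x. avg i z z x * ?w x \<partial>M) = (\<integral>x. G (Suc i) z x * ?w x \<partial>M)"
      by (intro Bochner_Integration.integral_cong) (auto simp: avg_self simp del: G.simps)
    ultimately show ?case using eq[OF u] eq[OF z] Suc[of "Suc i"] by (simp del: G.simps W.simps)
  qed
  show "(\<integral>x. G i u x * W n i z x \<partial>M) \<le> Nl (i + n) u"
    "(\<integral>x. G i z x * W n i z x \<partial>M) = Nl (i + n) z"
    using * by auto
qed

text \<open>Tameness controls the logarithms of the levels from above; from below they decrease at most linearly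
  in the level, since \<open>G i f \<le> 2 G (i + 1) f\<close>.\<close>

definition tame :: "('a \<Rightarrow> 'b::real_normed_vector) \<Rightarrow> 'a \<Rightarrow> bool" where
  "tame f x \<longleftrightarrow> summable (\<lambda>i. \<delta> i * G i f x) \<and> summable (\<lambda>i. \<delta> i * G (Suc i) f x)"

lemma AE_tame:
  fixes f :: "'a \<Rightarrow> 'b::{banach, second_countable_topology}"
  assumes f: "integrable M f"
  shows "AE x in M. tame f x"
proof -
  have sm: "summable (\<lambda>i. \<delta> i * N f)" using \<delta>_summable by (rule summable_mult2)
  have "AE x in M. summable (\<lambda>i. \<delta> i * G (i + k) f x)" for k
  proof (rule AE_summable_of_integral_summable)
    show "integrable M (\<lambda>x. \<delta> i * G (i + k) f x)" for i using f by simp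
    show "0 \<le> \<delta> i * G (i + k) f x" for i x using \<delta>_pos[of i] by simp
    show "summable (\<lambda>i. \<integral>x. \<delta> i * G (i + k) f x \<partial>M)"
      by (rule summable_comparison_test'[OF sm, of 0])
        (use \<delta>_pos Nl_le_N[OF f] Nl_nonneg[OF f] in \<open>auto simp: abs_mult less_imp_le mult_left_mono simp flip: Nl_def\<close>)
  qed
  from this[of 0] this[of 1] show ?thesis
    by eventually_elim (simp add: tame_def del: G.simps)
qed

lemma abs_ln_G_le:
  assumes "0 < G i z x" "i \<le> k"
  shows "\<bar>ln (G k z x)\<bar> \<le> G k z x + \<bar>ln (G i z x)\<bar> + k"
proof -
  have k: "0 < G k z x" using G_pos_mono[OF assms] .
  have u: "ln (G k z x) \<le> G k z x" using ln_le_minus_one[OF k] by simp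
  have "ln (G i z x) \<le> ln (2 ^ (k - i) * G k z x)"
    using G_le_two_power[of i z x "k - i"] assms k by simp
  also have "\<dots> = (k - i) * ln 2 + ln (G k z x)"
    using k by (simp add: ln_mult ln_realpow)
  also have "real (k - i) * ln 2 \<le> real k * 1"
    using ln_2_less_1 by (intro mult_mono) auto
  finally have "ln (G i z x) - k \<le> ln (G k z x)" by simp
  then show ?thesis using u k by linarith
qed

lemma r_eq_exp:
  assumes "0 < G i z x"
  shows "r i z x = exp (\<delta> i * (ln (G i z x) - ln (G (Suc i) z x)))"
proof -
  have "0 < G (Suc i) z x" using G_pos_mono[OF assms, of "Suc i"] by simp
  then show ?thesis using assms unfolding r_def
    by (subst powr_def) (simp add: ln_div algebra_simps del: G.simps)
qed

lemma W_eq_exp: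
  assumes "0 < G i z x"
  shows "W n i z x = exp (\<Sum>j<n. \<delta> (i + j) * (ln (G (i + j) z x) - ln (G (Suc (i + j)) z x)))"
proof (induction n)
  case (Suc n)
  have "0 < G (i + n) z x" using G_pos_mono[OF assms, of "i + n"] by simp
  from r_eq_exp[OF this] show ?case unfolding W_Suc_right Suc by (simp add: exp_add del: G.simps)
qed simp

lemma summable_majorant:
  assumes "tame f x"
  shows "summable (\<lambda>j. \<delta> (i + j) * (G (i + j) f x + G (Suc (i + j)) f x + 2 * L + 2 * real (i + j) + 1))"
proof -
  have "summable (\<lambda>j. \<delta> j * (G j f x + G (Suc j) f x + 2 * L + 2 * real j + 1))"
  proof -
    have "summable (\<lambda>j. \<delta> j * G j f x + \<delta> j * G (Suc j) f x + \<delta> j * (2 * L + 1) + 2 * (real j * \<delta> j))"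
      using assms \<delta>_summable \<delta>_summable' unfolding tame_def
      by (intro summable_add summable_mult summable_mult2) auto
    then show ?thesis by (simp add: algebra_simps del: G.simps)
  qed
  from summable_ignore_initial_segment[OF this, of i] show ?thesis by (simp add: add.commute del: G.simps)
qed

text \<open>A majorant of the exponents, uniform in all functions dominated by \<open>f\<close>; it gives the
  convergence of the weights as well as their continuous dependence on the function.\<close>

lemma exponent_le:
  assumes "0 < G i z x" "\<bar>ln (G i z x)\<bar> \<le> L" "\<And>k. G k z x \<le> G k f x"
  shows "norm (\<delta> (i + j) * (ln (G (i + j) z x) - ln (G (Suc (i + j)) z x)))
    \<le> \<delta> (i + j) * (G (i + j) f x + G (Suc (i + j)) f x + 2 * L + 2 * real (i + j) + 1)"
proof -
  have "\<bar>ln (G (i + j) z x) - ln (G (Suc (i + j)) z x)\<bar>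
      \<le> G (i + j) f x + G (Suc (i + j)) f x + 2 * L + 2 * real (i + j) + 1"
    using abs_ln_G_le[OF assms(1), of "i + j"] abs_ln_G_le[OF assms(1), of "Suc (i + j)"]
      assms(2) assms(3)[of "i + j"] assms(3)[of "Suc (i + j)"] by (simp del: G.simps)
  then show ?thesis using \<delta>_pos[of "i + j"]
    by (simp add: abs_mult mult_left_mono less_imp_le del: G.simps)
qed

lemma W_tendsto_V_pos:
  assumes "0 < G i z x" "tame z x"
  shows "(\<lambda>n. W n i z x) \<longlonglongrightarrow> V i z x"
    and "V i z x = exp (\<Sum>j. \<delta> (i + j) * (ln (G (i + j) z x) - ln (G (Suc (i + j)) z x)))"
proof -
  let ?c = "\<lambda>j. \<delta> (i + j) * (ln (G (i + j) z x) - ln (G (Suc (i + j)) z x))"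
  have "summable ?c"
    by (rule summable_comparison_test'[OF summable_majorant[OF assms(2)] exponent_le[OF assms(1)]]) auto
  then have "(\<lambda>n. exp (\<Sum>j<n. ?c j)) \<longlonglongrightarrow> exp (suminf ?c)"
    by (intro tendsto_exp summable_LIMSEQ)
  then have *: "(\<lambda>n. W n i z x) \<longlonglongrightarrow> exp (suminf ?c)"
    by (simp only: W_eq_exp[OF assms(1)])
  then show "V i z x = exp (suminf ?c)" unfolding V_def by (rule limI)
  with * show "(\<lambda>n. W n i z x) \<longlonglongrightarrow> V i z x" by simp
qed

lemma W_tendsto_V:
  assumes "tame z x"
  shows "(\<lambda>n. W n i z x) \<longlonglongrightarrow> V i z x" "0 < V i z x \<longleftrightarrow> 0 < G i z x"
proof -
  have "(\<lambda>n. W n i z x) \<longlonglongrightarrow> V i z x \<and> (0 < V i z x \<longleftrightarrow> 0 < G i z x)"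
  proof (cases "G i z x = 0")
    case True
    then have "(\<lambda>n. W (Suc n) i z x) = (\<lambda>n. 0)" by (simp add: r_def)
    then have "(\<lambda>n. W (Suc n) i z x) \<longlonglongrightarrow> 0" by (simp only: tendsto_const)
    then have "(\<lambda>n. W n i z x) \<longlonglongrightarrow> 0" by (rule LIMSEQ_imp_Suc)
    then show ?thesis using True by (simp add: V_def limI)
  next
    case False
    then have "0 < G i z x" using G_nonneg[of i z x] by linarith
    then show ?thesis using W_tendsto_V_pos[OF _ assms] by simp
  qed
  then show "(\<lambda>n. W n i z x) \<longlonglongrightarrow> V i z x" "0 < V i z x \<longleftrightarrow> 0 < G i z x" by auto
qed

lemma V_bounds:
  assumes "tame z x"
  shows "0 \<le> V i z x" "V i z x \<le> \<kappa> i"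
  by (auto intro!: LIMSEQ_le_const[OF W_tendsto_V(1)[OF assms]]
      LIMSEQ_le_const2[OF W_tendsto_V(1)[OF assms]] simp: W_le)

lemma V_Suc:
  assumes "tame z x"
  shows "V i z x = r i z x * V (Suc i) z x"
proof (rule LIMSEQ_unique)
  show "(\<lambda>n. W (Suc n) i z x) \<longlonglongrightarrow> V i z x"
    by (rule LIMSEQ_Suc[OF W_tendsto_V(1)[OF assms]])
  show "(\<lambda>n. W (Suc n) i z x) \<longlonglongrightarrow> r i z x * V (Suc i) z x"
    unfolding W.simps by (intro tendsto_intros W_tendsto_V assms)
qed

context
  fixes u z :: "'a \<Rightarrow> 'b::{banach, second_countable_topology}"
  assumes u: "integrable M u" and z: "integrable M z"
begin

lemma AE_V_bound: "AE x in M. \<bar>V i z x\<bar> \<le> \<kappa> i"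
  using AE_tame[OF z] by eventually_elim (auto simp: V_bounds)

lemma integrable_GV: "integrable M (\<lambda>x. G i u x * V i z x)"
  using u z by (intro integrable_mult_bounded[OF _ _ AE_V_bound]) auto

lemma GW_tendsto: "(\<lambda>n. \<integral>x. G i u x * W n i z x \<partial>M) \<longlonglongrightarrow> (\<integral>x. G i u x * V i z x \<partial>M)"
proof (rule integral_dominated_convergence)
  have [measurable]: "z \<in> borel_measurable M" "u \<in> borel_measurable M" using u z by auto
  show "(\<lambda>x. G i u x * V i z x) \<in> borel_measurable M" "(\<lambda>x. G i u x * W n i z x) \<in> borel_measurable M" for n
    by measurable
  show "integrable M (\<lambda>x. G i u x * \<kappa> i)" using u by simp
  show "AE x in M. (\<lambda>n. G i u x * W n i z x) \<longlonglongrightarrow> G i u x * V i z x"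
    using AE_tame[OF z] by eventually_elim (intro tendsto_intros W_tendsto_V)
  show "AE x in M. norm (G i u x * W n i z x) \<le> G i u x * \<kappa> i" for n
    by (auto simp: abs_mult intro!: mult_left_mono W_le)
qed

lemma integral_GV_le: "(\<integral>x. G i u x * V i z x \<partial>M) \<le> N u"
proof (rule LIMSEQ_le_const2[OF GW_tendsto])
  show "\<exists>k. \<forall>n\<ge>k. (\<integral>x. G i u x * W n i z x \<partial>M) \<le> N u"
    using integral_GW(1)[OF u z] Nl_le_N[OF u] order_trans by blast
qed

lemma integral_GV_Suc:
  "(\<integral>x. G i u x * V i z x \<partial>M) = (\<integral>x. avg i u z x * V (Suc i) z x \<partial>M)"
proof -
  have [measurable]: "z \<in> borel_measurable M" "u \<in> borel_measurable M" using u z by auto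
  have "(\<integral>x. G i u x * V i z x \<partial>M) = (\<integral>x. G i u x * r i z x * V (Suc i) z x \<partial>M)"
  proof (rule integral_cong_AE)
    show "AE x in M. G i u x * V i z x = G i u x * r i z x * V (Suc i) z x"
      using AE_tame[OF z] by eventually_elim (simp only: V_Suc[where i=i] mult.assoc)
  qed measurable
  then show ?thesis
    by (subst integral_avg[OF u z _ AE_V_bound]) (auto simp: V_invariant)
qed

lemma integral_GV_mono:
  "(\<integral>x. G i u x * V i z x \<partial>M) \<le> (\<integral>x. G (Suc i) u x * V (Suc i) z x \<partial>M)"
proof -
  have [measurable]: "z \<in> borel_measurable M" "u \<in> borel_measurable M" using u z by auto
  show ?thesis unfolding integral_GV_Suc[of i]
  proof (rule integral_mono_AE)
    show "integrable M (\<lambda>x. avg i u z x * V (Suc i) z x)"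
      using u z by (intro integrable_mult_bounded[OF _ _ AE_V_bound] integrable_avg) auto
    show "integrable M (\<lambda>x. G (Suc i) u x * V (Suc i) z x)"
      by (intro integrable_mult_bounded[OF _ _ AE_V_bound] G_integrable u) auto
    show "AE x in M. avg i u z x * V (Suc i) z x \<le> G (Suc i) u x * V (Suc i) z x"
      using AE_tame[OF z] AE_space
      by eventually_elim (auto intro!: mult_right_mono avg_le V_bounds simp del: G.simps)
  qed
qed

end

lemma integral_GV_self:
  fixes z :: "'a \<Rightarrow> 'b::{banach, second_countable_topology}"
  assumes z: "integrable M z"
  shows "(\<integral>x. G i z x * V i z x \<partial>M) = N z"
proof (rule LIMSEQ_unique[OF GW_tendsto[OF z z]])
  show "(\<lambda>n. \<integral>x. G i z x * W n i z x \<partial>M) \<longlonglongrightarrow> N z"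
    unfolding integral_GW(2)[OF z z]
    using LIMSEQ_ignore_initial_segment[OF Nl_tendsto[OF z], of i] by (simp add: add.commute)
qed

end


context mean_tower begin

section \<open>The norming functional and strict convexity\<close>

text \<open>The derivative of \<open>N\<close> at \<open>z\<close> in direction \<open>y\<close>; compare \<open>N_has_directional_derivative\<close> below.\<close>

definition grad :: "('a \<Rightarrow> 'b::euclidean_space) \<Rightarrow> ('a \<Rightarrow> 'b) \<Rightarrow> real" where
  "grad z y = (\<integral>x. (y x \<bullet> sgn (z x)) * V 0 z x \<partial>M)"

lemma inner_sgn_le: "\<bar>a \<bullet> sgn b\<bar> \<le> norm (a :: 'b::euclidean_space)"
  using Cauchy_Schwarz_ineq2[of a "sgn b"] mult_left_mono[of "norm (sgn b)" 1 "norm a"]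
  by (auto simp: norm_sgn split: if_splits)

lemma inner_sgn_self: "a \<bullet> sgn a = norm (a :: 'b::euclidean_space)"
  by (cases "a = 0") (auto simp: sgn_div_norm power2_norm_eq_inner[symmetric] power2_eq_square)

lemma integrable_inner_sgn:
  fixes y z :: "'a \<Rightarrow> 'b::euclidean_space"
  assumes "integrable M y" and z: "integrable M z"
  shows "integrable M (\<lambda>x. y x \<bullet> sgn (z x))"
proof (rule Bochner_Integration.integrable_bound)
  have [measurable]: "z \<in> borel_measurable M" "y \<in> borel_measurable M" using assms by auto
  show "(\<lambda>x. y x \<bullet> sgn (z x)) \<in> borel_measurable M" by measurable
qed (use assms inner_sgn_le in auto)

lemma integrable_grad:
  fixes y z :: "'a \<Rightarrow> 'b::euclidean_space"
  assumes "integrable M y" and z: "integrable M z"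
  shows "integrable M (\<lambda>x. (y x \<bullet> sgn (z x)) * V 0 z x)"
proof (rule integrable_mult_bounded[OF integrable_inner_sgn[OF assms] _ AE_V_bound[OF assms]])
  have [measurable]: "z \<in> borel_measurable M" using z by simp
  show "V 0 z \<in> borel_measurable M" by measurable
qed

lemma integrable_norm_V:
  fixes y z :: "'a \<Rightarrow> 'b::{banach, second_countable_topology}"
  assumes "integrable M y" and z: "integrable M z"
  shows "integrable M (\<lambda>x. norm (y x) * V 0 z x)"
  using integrable_GV[OF assms, of 0] by simp

lemma grad_le_norm:
  fixes y z :: "'a \<Rightarrow> 'b::euclidean_space"
  assumes y: "integrable M y" and z: "integrable M z"
  shows "grad z y \<le> (\<integral>x. norm (y x) * V 0 z x \<partial>M)"
  unfolding grad_def
proof (rule integral_mono_AE[OF integrable_grad[OF assms] integrable_norm_V[OF assms]])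
  show "AE x in M. (y x \<bullet> sgn (z x)) * V 0 z x \<le> norm (y x) * V 0 z x"
    using AE_tame[OF z] by eventually_elim (intro mult_right_mono order_trans[OF abs_ge_self inner_sgn_le] V_bounds)
qed

lemma grad_le_N:
  fixes y z :: "'a \<Rightarrow> 'b::euclidean_space"
  assumes y: "integrable M y" and z: "integrable M z"
  shows "grad z y \<le> N y"
  using grad_le_norm[OF assms] integral_GV_le[OF assms, of 0] by simp

lemma grad_self:
  fixes z :: "'a \<Rightarrow> 'b::euclidean_space"
  assumes z: "integrable M z"
  shows "grad z z = N z"
  using integral_GV_self[OF z, of 0] by (simp add: grad_def inner_sgn_self)

lemma grad_add:
  fixes y z :: "'a \<Rightarrow> 'b::euclidean_space"
  assumes "integrable M y" "integrable M w" "integrable M z"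
  shows "grad z (\<lambda>x. y x + w x) = grad z y + grad z w"
  using integrable_grad[OF assms(1,3)] integrable_grad[OF assms(2,3)]
  by (simp add: grad_def inner_add_left distrib_right)

lemma grad_diff:
  fixes y z :: "'a \<Rightarrow> 'b::euclidean_space"
  assumes "integrable M y" "integrable M w" "integrable M z"
  shows "grad z (\<lambda>x. y x - w x) = grad z y - grad z w"
  using integrable_grad[OF assms(1,3)] integrable_grad[OF assms(2,3)]
  by (simp add: grad_def inner_diff_left left_diff_distrib)

lemma grad_scaleR:
  fixes y z :: "'a \<Rightarrow> 'b::euclidean_space"
  shows "grad z (\<lambda>x. c *\<^sub>R y x) = c * grad z y"
  by (simp add: grad_def mult.assoc)

lemma AE_eq_of_integral_eq:
  fixes f g :: "'a \<Rightarrow> real"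
  assumes "integrable M f" "integrable M g" "AE x in M. f x \<le> g x" "integral\<^sup>L M f = integral\<^sup>L M g"
  shows "AE x in M. f x = g x"
proof -
  have "(\<integral>x. g x - f x \<partial>M) = 0" using assms by simp
  then have "AE x in M. g x - f x = 0"
    using assms by (subst (asm) integral_nonneg_eq_0_iff_AE) auto
  then show ?thesis by eventually_elim simp
qed

text \<open>The set where some level is positive is invariant under all maps.\<close>

lemma AE_G_pos:
  fixes z :: "'a \<Rightarrow> 'b::{banach, second_countable_topology}"
  assumes z: "integrable M z" and "N z \<noteq> 0"
  shows "AE x in M. \<exists>i. 0 < G i z x"
proof -
  have [measurable]: "z \<in> borel_measurable M" using z by simp
  define S where "S = {x \<in> space M. \<exists>i. 0 < G i z x}"
  have S: "S \<in> sets M" unfolding S_def by measurable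
  have inv: "\<tau> j x \<in> S \<longleftrightarrow> x \<in> S" if x: "x \<in> space M" for j x
  proof -
    have "(\<exists>i. 0 < G i z y) \<longleftrightarrow> (\<exists>i>j. 0 < G i z y)" for y
    proof
      assume "\<exists>i. 0 < G i z y"
      then obtain i where "0 < G i z y" ..
      then have "0 < G (max i (Suc j)) z y" by (rule G_pos_mono) simp
      then show "\<exists>i>j. 0 < G i z y" by (intro exI[of _ "max i (Suc j)"]) auto
    qed blast
    then show ?thesis using x by (auto simp: S_def G_invariant)
  qed
  have "prob S \<noteq> 0"
  proof
    assume "prob S = 0"
    then have "AE x in M. x \<notin> S" using S by (simp add: prob_eq_0)
    then have "AE x in M. z x = 0"
      using AE_space
    proof eventually_elim
      case (elim x)
      then have "\<not> 0 < G 0 z x" unfolding S_def by blast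
      then show ?case by simp
    qed
    then show False using N_eq_0_iff[OF z] assms by simp
  qed
  then have "prob S = 1" using ergodic[OF S inv] by auto
  then have "AE x in M. x \<in> S" using S by (simp add: prob_eq_1)
  then show ?thesis by eventually_elim (auto simp: S_def)
qed

text \<open>From the first level at which \<open>z\<close> is positive the factor propagates upwards; below that level both
  functions vanish.\<close>

lemma G_proportional:
  assumes eq: "\<And>i. G i u x * G (Suc i) z x = G (Suc i) u x * G i z x" and pos: "0 < G m z x"
  obtains c where "\<And>k. G k u x = c * G k z x"
proof
  define c where "c = G m u x / G m z x"
  have m: "G m u x = c * G m z x" using pos by (simp add: c_def)
  fix k
  show "G k u x = c * G k z x"
  proof (cases "k \<le> m")
    case True
    then show ?thesis
    proof (induction k rule: inc_induct)
      case (step k)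
      show ?case
      proof (cases "G (Suc k) z x = 0")
        case True
        then have "G (Suc k) u x = 0" using step.IH by simp
        then have "G k u x = 0" "G k z x = 0"
          using G_le_two_Suc[of k u x] G_le_two_Suc[of k z x] True
            G_nonneg[of k u x] G_nonneg[of k z x] by linarith+
        then show ?thesis by simp
      next
        case False
        then show ?thesis using eq[of k] step.IH by simp
      qed
    qed (rule m)
  next
    case False
    then have "m \<le> k" by simp
    then show ?thesis
    proof (induction k rule: dec_induct)
      case (step k)
      have "0 < G k z x" using G_pos_mono[OF pos] step.hyps by simp
      then show ?case using eq[of k] step.IH by simp
    qed (rule m)
  qed
qed

text \<open>As \<open>u\<close> attains the norm of the gradient at \<open>z\<close>, the integrals of \<open>G i u \<cdot> V i z\<close>, which increase with
  \<open>i\<close>, are all equal, so Hoelder's inequality is an equality at almost every point and at every level.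
  The resulting pointwise factor between the levels of \<open>u\<close> and of \<open>z\<close> is invariant under all maps; it
  suffices to compare it with \<open>1\<close> by ergodicity, because the weighted integrals of \<open>\<bar>u\<bar>\<close> and
  \<open>\<bar>z\<bar>\<close> agree.\<close>

lemma norming_unique:
  fixes u z :: "'a \<Rightarrow> 'b::euclidean_space"
  assumes u: "integrable M u" and z: "integrable M z" and Nu: "N u = N z" and lu: "grad z u = N u"
  shows "AE x in M. u x = z x"
proof (cases "N z = 0")
  case True
  then have "AE x in M. u x = 0" "AE x in M. z x = 0"
    using N_eq_0_iff[OF u] N_eq_0_iff[OF z] Nu by auto
  then show ?thesis by eventually_elim simp
next
  case False
  have [measurable]: "u \<in> borel_measurable M" "z \<in> borel_measurable M" using u z by auto
  let ?T = "\<lambda>i. \<integral>x. G i u x * V i z x \<partial>M"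
  have T0: "N u \<le> ?T 0" using grad_le_norm[OF u z] lu by simp
  have "?T 0 \<le> ?T i" for i
    by (rule lift_Suc_mono_le[of ?T 0 i]) (auto intro: integral_GV_mono[OF u z] simp del: G.simps)
  then have T: "?T i = N u" for i
    using T0 integral_GV_le[OF u z, of i] by (meson order_antisym order_trans)
  have level: "AE x in M. G i u x * G (Suc i) z x = G (Suc i) u x * G i z x" for i
  proof -
    have "AE x in M. avg i u z x * V (Suc i) z x = G (Suc i) u x * V (Suc i) z x"
    proof (rule AE_eq_of_integral_eq)
      show "integrable M (\<lambda>x. avg i u z x * V (Suc i) z x)"
        using u z by (intro integrable_mult_bounded[OF _ _ AE_V_bound] integrable_avg) auto
      show "integrable M (\<lambda>x. G (Suc i) u x * V (Suc i) z x)"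
        by (rule integrable_GV[OF u z])
      show "AE x in M. avg i u z x * V (Suc i) z x \<le> G (Suc i) u x * V (Suc i) z x"
        using AE_tame[OF z] AE_space
        by eventually_elim (auto intro!: mult_right_mono avg_le V_bounds simp del: G.simps)
      show "(\<integral>x. avg i u z x * V (Suc i) z x \<partial>M) = (\<integral>x. G (Suc i) u x * V (Suc i) z x \<partial>M)"
        using T[of i] T[of "Suc i"] integral_GV_Suc[OF u z, of i] by simp
    qed
    then show ?thesis using AE_tame[OF z] AE_space
    proof eventually_elim
      case (elim x)
      show ?case
      proof (cases "0 < G (Suc i) z x")
        case True
        then have "V (Suc i) z x \<noteq> 0" using W_tendsto_V(2)[OF elim(2), of "Suc i"] by simp
        then have "avg i u z x = G (Suc i) u x" using elim(1) by (simp del: G.simps)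
        then show ?thesis by (rule avg_eq_imp[OF elim(3) True])
      next
        case False
        then have "G (Suc i) z x = 0" using G_nonneg[of "Suc i" z x] by linarith
        then show ?thesis using G_le_two_Suc[of i z x] G_nonneg[of i z x] by (simp del: G.simps)
      qed
    qed
  qed
  have ratio: "AE x in M. \<exists>c. (\<forall>k. G k u x = c * G k z x) \<and> (\<exists>m. 0 < G m z x)"
  proof -
    have "AE x in M. \<forall>i. G i u x * G (Suc i) z x = G (Suc i) u x * G i z x"
      using level by (simp only: AE_all_countable) blast
    then show ?thesis using AE_G_pos[OF z False]
    proof eventually_elim
      case (elim x)
      then obtain m where m: "0 < G m z x" by blast
      obtain c where "\<And>k. G k u x = c * G k z x"
        using G_proportional[OF spec[OF elim(1)] m] by blast
      then show ?case using m by blast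
    qed
  qed
  \<comment> \<open>The event that the factor is at most \<open>1\<close>, written as an eventual property of the levels, which
    makes it invariant at every point.\<close>
  define S where "S = {x \<in> space M. \<exists>m. \<forall>k\<ge>m. G k u x \<le> G k z x}"
  have S: "S \<in> sets M" unfolding S_def by measurable
  have inv: "\<tau> j x \<in> S \<longleftrightarrow> x \<in> S" if x: "x \<in> space M" for j x
  proof -
    have *: "(\<exists>m. \<forall>k\<ge>m. P k) \<longleftrightarrow> (\<exists>m>j. \<forall>k\<ge>m. P k)" for P :: "nat \<Rightarrow> bool"
    proof
      assume "\<exists>m. \<forall>k\<ge>m. P k"
      then obtain m where "\<forall>k\<ge>m. P k" ..
      then show "\<exists>m>j. \<forall>k\<ge>m. P k" by (intro exI[of _ "max m (Suc j)"]) auto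
    qed blast
    have "(\<exists>m>j. \<forall>k\<ge>m. G k u (\<tau> j x) \<le> G k z (\<tau> j x)) \<longleftrightarrow> (\<exists>m>j. \<forall>k\<ge>m. G k u x \<le> G k z x)"
      by (auto simp: G_invariant[OF x])
    then show ?thesis using x unfolding S_def by (simp add: *)
  qed
  have norm_eq: "AE x in M. norm (u x) = norm (z x)"
  proof -
    have alt: "(AE x in M. norm (u x) * V 0 z x \<le> norm (z x) * V 0 z x) \<or>
      (AE x in M. norm (z x) * V 0 z x \<le> norm (u x) * V 0 z x)"
    proof (cases "prob S = 1")
      case True
      then have "AE x in M. x \<in> S" using S by (simp add: prob_eq_1)
      then have "AE x in M. norm (u x) * V 0 z x \<le> norm (z x) * V 0 z x"
        using ratio AE_tame[OF z]
      proof eventually_elim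
        case (elim x)
        from elim(2) obtain c m where c: "\<And>k. G k u x = c * G k z x" and m: "0 < G m z x" by blast
        from elim(1) obtain m' where m': "\<And>k. k \<ge> m' \<Longrightarrow> G k u x \<le> G k z x" by (auto simp: S_def)
        define k where "k = max m m'"
        have "c * G k z x \<le> 1 * G k z x" using c[of k] m'[of k] by (simp add: k_def)
        moreover have "0 < G k z x" using G_pos_mono[OF m, of k] by (simp add: k_def)
        ultimately have "c \<le> 1" by (simp add: mult_le_cancel_right_pos)
        then have "norm (u x) \<le> norm (z x)" using c[of 0] mult_right_mono[of c 1 "norm (z x)"] by simp
        then show ?case by (intro mult_right_mono V_bounds elim)
      qed
      then show ?thesis ..
    next
      case False
      then have "prob S = 0" using ergodic[OF S inv] by auto
      then have "AE x in M. x \<notin> S" using S by (simp add: prob_eq_0)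
      then have "AE x in M. norm (z x) * V 0 z x \<le> norm (u x) * V 0 z x"
        using ratio AE_tame[OF z] AE_space
      proof eventually_elim
        case (elim x)
        from elim(2) obtain c where c: "\<And>k. G k u x = c * G k z x" by blast
        have "\<not> c \<le> 1"
        proof
          assume "c \<le> 1"
          then have "G k u x \<le> G k z x" for k using c[of k] mult_right_mono[of c 1 "G k z x"] by simp
          then show False using elim(1,4) by (auto simp: S_def)
        qed
        then have "norm (z x) \<le> norm (u x)" using c[of 0] mult_right_mono[of 1 c "norm (z x)"] by simp
        then show ?case by (intro mult_right_mono V_bounds elim)
      qed
      then show ?thesis ..
    qed
    have int: "(\<integral>x. norm (u x) * V 0 z x \<partial>M) = (\<integral>x. norm (z x) * V 0 z x \<partial>M)"
      using T[of 0] integral_GV_self[OF z, of 0] Nu by simp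
    have "AE x in M. norm (u x) * V 0 z x = norm (z x) * V 0 z x"
    proof (rule disjE[OF alt])
      assume "AE x in M. norm (u x) * V 0 z x \<le> norm (z x) * V 0 z x"
      from AE_eq_of_integral_eq[OF _ _ this int] show ?thesis
        by (simp add: integrable_norm_V u z)
    next
      assume "AE x in M. norm (z x) * V 0 z x \<le> norm (u x) * V 0 z x"
      from AE_eq_of_integral_eq[OF _ _ this int[symmetric]]
      have "AE x in M. norm (z x) * V 0 z x = norm (u x) * V 0 z x"
        by (simp add: integrable_norm_V u z)
      then show ?thesis by eventually_elim (rule sym)
    qed
    then show ?thesis using ratio AE_tame[OF z]
    proof eventually_elim
      case (elim x)
      show ?case
      proof (cases "z x = 0")
        case True
        then have "G 0 z x = 0" by simp
        then have "G 0 u x = 0" using elim(2) by (metis mult_zero_right)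
        then show ?thesis using True by simp
      next
        case False
        then have "V 0 z x \<noteq> 0" using W_tendsto_V(2)[OF elim(3), of 0] by auto
        then show ?thesis using elim(1) by simp
      qed
    qed
  qed
  have "AE x in M. (u x \<bullet> sgn (z x)) * V 0 z x = norm (u x) * V 0 z x"
  proof (rule AE_eq_of_integral_eq[OF integrable_grad[OF u z] integrable_norm_V[OF u z]])
    show "AE x in M. (u x \<bullet> sgn (z x)) * V 0 z x \<le> norm (u x) * V 0 z x"
      using AE_tame[OF z]
      by eventually_elim (intro mult_right_mono order_trans[OF abs_ge_self inner_sgn_le] V_bounds)
    show "(\<integral>x. (u x \<bullet> sgn (z x)) * V 0 z x \<partial>M) = (\<integral>x. norm (u x) * V 0 z x \<partial>M)"
      using T[of 0] lu by (simp add: grad_def)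
  qed
  then show ?thesis using norm_eq AE_tame[OF z]
  proof eventually_elim
    case (elim x)
    show ?case
    proof (cases "z x = 0")
      case True
      then show ?thesis using elim(2) by simp
    next
      case False
      then have "V 0 z x \<noteq> 0" using W_tendsto_V(2)[OF elim(3), of 0] by auto
      then have "u x \<bullet> sgn (z x) = norm (z x)" using elim by simp
      then have "u x \<bullet> z x = norm (z x) * norm (z x)"
        using False by (simp add: sgn_div_norm field_simps)
      moreover have "u x \<bullet> u x = norm (z x) * norm (z x)" "z x \<bullet> z x = norm (z x) * norm (z x)"
        using elim(2) by (metis dot_square_norm power2_eq_square)+
      moreover have "(u x - z x) \<bullet> (u x - z x) = u x \<bullet> u x - 2 * (u x \<bullet> z x) + z x \<bullet> z x"
        by (simp add: inner_diff_left inner_diff_right inner_commute)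
      ultimately have "(u x - z x) \<bullet> (u x - z x) = 0" by linarith
      then show ?thesis by simp
    qed
  qed
qed

lemma midpoint_unique:
  fixes z h :: "'a \<Rightarrow> 'b::euclidean_space"
  assumes z: "integrable M z" and h: "integrable M h"
    and le: "N (\<lambda>x. z x + h x) \<le> N z" "N (\<lambda>x. z x - h x) \<le> N z"
  shows "AE x in M. h x = 0"
proof -
  have p: "integrable M (\<lambda>x. z x + h x)" and m: "integrable M (\<lambda>x. z x - h x)" using z h by auto
  have "grad z (\<lambda>x. z x + h x) + grad z (\<lambda>x. z x - h x) = 2 * N z"
    using z h by (simp add: grad_add grad_diff grad_self)
  then have "grad z (\<lambda>x. z x + h x) = N (\<lambda>x. z x + h x)" "N (\<lambda>x. z x + h x) = N z"
    using grad_le_N[OF p z] grad_le_N[OF m z] le by linarith+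
  from norming_unique[OF p z this(2,1)] show ?thesis by eventually_elim simp
qed

end


lemma tendsto_0_le:
  fixes a :: "'c \<Rightarrow> 'b::real_normed_vector"
  assumes "(g \<longlongrightarrow> 0) F" "\<And>n. norm (a n) \<le> g n"
  shows "(a \<longlongrightarrow> 0) F"
  by (rule Lim_null_comparison[OF always_eventually assms(1)]) (use assms(2) in auto)

context mean_tower begin

section \<open>Smoothness\<close>

lemma G_scaleR: "G i (\<lambda>x. c *\<^sub>R f x) x = \<bar>c\<bar> * G i f x"
  by (rule G_scale) auto

lemma G_along_line:
  fixes y z :: "'a \<Rightarrow> 'b::real_normed_vector"
  assumes "t \<longlonglongrightarrow> (0::real)"
  shows "(\<lambda>n. G i (\<lambda>x. z x + t n *\<^sub>R y x) x) \<longlonglongrightarrow> G i z x"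
proof -
  have "(\<lambda>n. \<bar>t n\<bar> * G i y x) \<longlonglongrightarrow> 0 * G i y x"
    using assms by (intro tendsto_intros) (simp add: tendsto_rabs_zero_iff)
  moreover have "\<bar>G i (\<lambda>x. z x + t n *\<^sub>R y x) x - G i z x\<bar> \<le> \<bar>t n\<bar> * G i y x" for n
    using G_diff_le[of i "\<lambda>x. z x + t n *\<^sub>R y x" x z] by (simp add: G_scaleR)
  ultimately have "(\<lambda>n. G i (\<lambda>x. z x + t n *\<^sub>R y x) x - G i z x) \<longlonglongrightarrow> 0"
    using tendsto_0_le[of "\<lambda>n. \<bar>t n\<bar> * G i y x" _ "\<lambda>n. G i (\<lambda>x. z x + t n *\<^sub>R y x) x - G i z x"] by simp
  then show ?thesis by (rule LIM_zero_cancel)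
qed

text \<open>A single small ratio makes the whole product small.\<close>

lemma V_le_r:
  assumes "tame z x"
  shows "V 0 z x \<le> \<kappa> 0 * (r j z x * \<kappa> (Suc j))"
proof -
  have "V 0 z x = W j 0 z x * V j z x"
  proof (induction j)
    case (Suc j)
    then show ?case using V_Suc[OF assms, of j] W_Suc_right[of j 0 z x] by simp
  qed simp
  also have "\<dots> = W j 0 z x * (r j z x * V (Suc j) z x)" using V_Suc[OF assms, of j] by simp
  also have "\<dots> \<le> \<kappa> 0 * (r j z x * \<kappa> (Suc j))"
    using V_bounds[OF assms, of "Suc j"] \<kappa>_ge_1[of 0]
    by (intro mult_mono mult_left_mono W_le) auto
  finally show ?thesis .
qed

text \<open>Where \<open>z\<close> vanishes the weight tends to \<open>0\<close> because one of its factors does; elsewhere the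
  exponents converge termwise under a common summable majorant.\<close>

lemma weighted_sgn_tendsto:
  fixes y z :: "'a \<Rightarrow> 'b::euclidean_space"
  assumes t: "t \<longlonglongrightarrow> (0::real)" and pos: "0 < G m z x"
    and tame: "tame z x" "tame (\<lambda>x. norm (z x) + norm (y x)) x"
    and tame_n: "\<And>n. tame (\<lambda>x. z x + t n *\<^sub>R y x) x"
  shows "(\<lambda>n. (v \<bullet> sgn (z x + t n *\<^sub>R y x)) * V 0 (\<lambda>x. z x + t n *\<^sub>R y x) x)
    \<longlonglongrightarrow> (v \<bullet> sgn (z x)) * V 0 z x"
proof (cases "z x = 0")
  case True
  let ?z = "\<lambda>n x. z x + t n *\<^sub>R y x"
  define j where "j = (LEAST j. 0 < G (Suc j) z x)"
  have m0: "m \<noteq> 0" using pos True by (cases m) auto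
  then have ex: "0 < G (Suc (m - 1)) z x" using pos by simp
  have j: "0 < G (Suc j) z x" unfolding j_def by (rule LeastI[of _ "m - 1"]) (rule ex)
  have j0: "G j z x = 0"
  proof (cases j)
    case (Suc i)
    have "\<not> 0 < G (Suc i) z x" using not_less_Least[of i "\<lambda>j. 0 < G (Suc j) z x"] Suc
      by (auto simp: j_def simp del: G.simps)
    then have "G (Suc i) z x = 0" using G_nonneg[of "Suc i" z x] by linarith
    then show ?thesis using Suc by (simp only:)
  qed (simp add: True)
  have "(\<lambda>n. r j (?z n) x) \<longlonglongrightarrow> (G j z x / G (Suc j) z x) powr \<delta> j"
    unfolding r_def using j
    by (intro tendsto_powr' tendsto_divide G_along_line t tendsto_const)
      (auto simp: \<delta>_pos simp del: G.simps intro!: divide_nonneg_nonneg)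
  then have r: "(\<lambda>n. r j (?z n) x) \<longlonglongrightarrow> 0" by (simp add: j0)
  have "(\<lambda>n. norm v * (\<kappa> 0 * (r j (?z n) x * \<kappa> (Suc j)))) \<longlonglongrightarrow> norm v * (\<kappa> 0 * (0 * \<kappa> (Suc j)))"
    by (intro tendsto_intros r)
  then have "(\<lambda>n. norm v * (\<kappa> 0 * (r j (?z n) x * \<kappa> (Suc j)))) \<longlonglongrightarrow> 0"
    unfolding mult_zero_left mult_zero_right .
  moreover have "norm ((v \<bullet> sgn (?z n x)) * V 0 (?z n) x) \<le> norm v * (\<kappa> 0 * (r j (?z n) x * \<kappa> (Suc j)))" for n
    using V_bounds(1)[OF tame_n] V_le_r[OF tame_n]
    unfolding norm_mult by (intro mult_mono) (auto intro: inner_sgn_le)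
  ultimately have "(\<lambda>n. (v \<bullet> sgn (?z n x)) * V 0 (?z n) x) \<longlonglongrightarrow> 0"
    by (rule tendsto_0_le)
  then show ?thesis by (simp add: True)
next
  case False
  let ?z = "\<lambda>n x. z x + t n *\<^sub>R y x"
  let ?f = "\<lambda>x. norm (z x) + norm (y x)"
  let ?c = "\<lambda>z j. \<delta> j * (ln (G j z x) - ln (G (Suc j) z x))"
  have z0: "0 < G 0 z x" using False by simp
  have zk: "0 < G k z x" for k using G_pos_mono[OF z0] by simp
  have zn: "(\<lambda>n. ?z n x) \<longlonglongrightarrow> z x + 0 *\<^sub>R y x" by (intro tendsto_intros t)
  then have zn': "(\<lambda>n. G 0 (?z n) x) \<longlonglongrightarrow> G 0 z x" by (auto intro: tendsto_norm)
  have lnlim: "(\<lambda>n. \<bar>ln (G 0 (?z n) x)\<bar>) \<longlonglongrightarrow> \<bar>ln (G 0 z x)\<bar>"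
    using z0 by (intro tendsto_intros zn') auto
  define L where "L = \<bar>ln (G 0 z x)\<bar> + 1"
  have evL: "\<forall>\<^sub>F n in sequentially. \<bar>ln (G 0 (?z n) x)\<bar> < L"
    using order_tendstoD(2)[OF lnlim, of L] by (simp add: L_def)
  have evp: "\<forall>\<^sub>F n in sequentially. 0 < G 0 (?z n) x"
    using order_tendstoD(1)[OF zn' z0] .
  have evt: "\<forall>\<^sub>F n in sequentially. \<bar>t n\<bar> < 1"
    using order_tendstoD(2)[OF tendsto_rabs_zero[OF t], of 1] by simp
  define B where "B j = \<delta> j * (G j ?f x + G (Suc j) ?f x + 2 * L + 2 * real j + 1)" for j
  have sB: "summable B" using summable_majorant[OF tame(2), of 0 L] by (simp add: B_def[abs_def] del: G.simps)
  have bound: "\<forall>\<^sub>F n in sequentially. \<forall>j. norm (?c (?z n) j) \<le> B j"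
    using evL evp evt
  proof eventually_elim
    case (elim n)
    have "G k (?z n) x \<le> G k ?f x" for k
    proof (rule G_mono)
      fix x
      have "norm (t n *\<^sub>R y x) \<le> 1 * norm (y x)"
        unfolding norm_scaleR using elim(3) by (intro mult_right_mono) auto
      then show "norm (z x + t n *\<^sub>R y x) \<le> norm (norm (z x) + norm (y x))"
        using norm_triangle_ineq[of "z x" "t n *\<^sub>R y x"] by simp
    qed
    from exponent_le[OF elim(2) less_imp_le[OF elim(1)] this] show ?case
      by (simp add: B_def del: G.simps)
  qed
  have lim: "(\<lambda>n. ?c (?z n) j) \<longlonglongrightarrow> ?c z j" for j
    using zk[of j] zk[of "Suc j"] by (intro tendsto_intros G_along_line t) auto
  have "(\<lambda>n. suminf (?c (?z n))) \<longlonglongrightarrow> suminf (?c z)"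
  proof -
    have ev: "\<forall>\<^sub>F (j, n) in at_top \<times>\<^sub>F sequentially. norm (?c (?z n) j) \<le> B j"
      unfolding eventually_prod_filter
      by (rule exI[of _ "\<lambda>_. True"], rule exI, rule conjI[OF _ conjI[OF bound]]) auto
    from tannerys_theorem[where a="\<lambda>j n. ?c (?z n) j", OF lim ev sB] show ?thesis by simp
  qed
  then have "(\<lambda>n. exp (suminf (?c (?z n)))) \<longlonglongrightarrow> exp (suminf (?c z))" by (rule tendsto_exp)
  moreover have "V 0 z x = exp (suminf (?c z))"
    using W_tendsto_V_pos(2)[OF z0 tame(1)] by (simp del: G.simps)
  moreover have "\<forall>\<^sub>F n in sequentially. exp (suminf (?c (?z n))) = V 0 (?z n) x"
    using evp by eventually_elim (use W_tendsto_V_pos(2)[OF _ tame_n] in \<open>simp del: G.simps\<close>)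
  ultimately have "(\<lambda>n. V 0 (?z n) x) \<longlonglongrightarrow> V 0 z x"
    using Lim_transform_eventually by fastforce
  then show ?thesis using False zn by (intro tendsto_intros) auto
qed

lemma grad_tendsto:
  fixes y z :: "'a \<Rightarrow> 'b::euclidean_space"
  assumes t: "t \<longlonglongrightarrow> (0::real)" and y: "integrable M y" and z: "integrable M z" and "N z \<noteq> 0"
  shows "(\<lambda>n. grad (\<lambda>x. z x + t n *\<^sub>R y x) y) \<longlonglongrightarrow> grad z y"
  unfolding grad_def
proof (rule integral_dominated_convergence)
  let ?z = "\<lambda>n x. z x + t n *\<^sub>R y x"
  have zn: "integrable M (?z n)" for n using y z by simp
  have [measurable]: "y \<in> borel_measurable M" "z \<in> borel_measurable M" "?z n \<in> borel_measurable M" for n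
    using y z by auto
  have all: "AE x in M. \<forall>n. tame (?z n) x" using AE_tame[OF zn] by (simp add: AE_all_countable)
  show "(\<lambda>x. (y x \<bullet> sgn (z x)) * V 0 z x) \<in> borel_measurable M"
    "(\<lambda>x. (y x \<bullet> sgn (?z n x)) * V 0 (?z n) x) \<in> borel_measurable M" for n
    by measurable
  show "integrable M (\<lambda>x. norm (y x) * \<kappa> 0)" using y by simp
  show "AE x in M. norm ((y x \<bullet> sgn (?z n x)) * V 0 (?z n) x) \<le> norm (y x) * \<kappa> 0" for n
    using AE_tame[OF zn[of n]]
    by eventually_elim (unfold norm_mult, intro mult_mono, auto simp: V_bounds intro: inner_sgn_le)
  have "integrable M (\<lambda>x. norm (z x) + norm (y x))" using y z by simp
  from AE_tame[OF this] AE_tame[OF z] all AE_G_pos[OF z \<open>N z \<noteq> 0\<close>]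
  show "AE x in M. (\<lambda>n. (y x \<bullet> sgn (?z n x)) * V 0 (?z n) x) \<longlonglongrightarrow> (y x \<bullet> sgn (z x)) * V 0 z x"
    by eventually_elim (blast intro: weighted_sgn_tendsto[OF t])
qed

text \<open>Both \<open>grad z\<close> and the gradient at \<open>z + t y\<close> are subgradients.\<close>

lemma quotient_between:
  fixes y z :: "'a \<Rightarrow> 'b::euclidean_space"
  assumes y: "integrable M y" and z: "integrable M z" and "t \<noteq> 0"
  shows "\<bar>(N (\<lambda>x. z x + t *\<^sub>R y x) - N z) / t - grad z y\<bar> \<le> \<bar>grad (\<lambda>x. z x + t *\<^sub>R y x) y - grad z y\<bar>"
proof -
  let ?z = "\<lambda>x. z x + t *\<^sub>R y x"
  have zt: "integrable M ?z" and ty: "integrable M (\<lambda>x. t *\<^sub>R y x)" using y z by auto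
  have 1: "N z + t * grad z y \<le> N ?z"
    using grad_le_N[OF zt z] grad_add[OF z ty z] by (simp add: grad_self[OF z] grad_scaleR)
  have 2: "N ?z - t * grad ?z y \<le> N z"
    using grad_le_N[OF z zt] grad_diff[OF zt ty zt] by (simp add: grad_self[OF zt] grad_scaleR)
  show ?thesis
  proof (cases "0 < t")
    case True
    then have "grad z y \<le> (N ?z - N z) / t" "(N ?z - N z) / t \<le> grad ?z y"
      using 1 2 by (simp_all add: field_simps)
    then show ?thesis by linarith
  next
    case False
    then have "t < 0" using assms by simp
    then have "(N ?z - N z) / t \<le> grad z y" "grad ?z y \<le> (N ?z - N z) / t"
      using 1 2 by (simp_all add: field_simps)
    then show ?thesis by linarith
  qed
qed

lemma N_has_directional_derivative:
  fixes y z :: "'a \<Rightarrow> 'b::euclidean_space"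
  assumes y: "integrable M y" and z: "integrable M z" and "N z \<noteq> 0"
  shows "((\<lambda>t. (N (\<lambda>x. z x + t *\<^sub>R y x) - N z) / t) \<longlongrightarrow> grad z y) (at 0)"
  unfolding tendsto_at_iff_sequentially comp_def
proof (intro allI impI)
  fix t :: "nat \<Rightarrow> real" assume t0: "\<forall>n. t n \<in> UNIV - {0}" and t: "t \<longlonglongrightarrow> 0"
  have "(\<lambda>n. \<bar>grad (\<lambda>x. z x + t n *\<^sub>R y x) y - grad z y\<bar>) \<longlonglongrightarrow> 0"
    using LIM_zero[OF grad_tendsto[OF t y z \<open>N z \<noteq> 0\<close>]] by (rule tendsto_rabs_zero)
  then have "(\<lambda>n. (N (\<lambda>x. z x + t n *\<^sub>R y x) - N z) / t n - grad z y) \<longlonglongrightarrow> 0"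
    by (rule Lim_null_comparison[rotated]) (use t0 quotient_between[OF y z] in auto)
  then show "(\<lambda>n. (N (\<lambda>x. z x + t n *\<^sub>R y x) - N z) / t n) \<longlonglongrightarrow> grad z y"
    by (rule LIM_zero_cancel)
qed

section \<open>Asymptotic additivity\<close>

lemma AE_G_tendsto_0:
  fixes f :: "nat \<Rightarrow> 'a \<Rightarrow> 'b::real_normed_vector"
  assumes "AE x in M. (\<lambda>n. f n x) \<longlonglongrightarrow> 0"
  shows "AE x in M. (\<lambda>n. G i (f n) x) \<longlonglongrightarrow> 0"
proof (induction i)
  case 0
  then show ?case using assms by (auto elim: eventually_mono intro: tendsto_norm_zero)
next
  case (Suc i)
  show ?case using Suc AE_\<tau>[OF Suc, of i]
  proof eventually_elim
    case (elim x)
    have "(\<lambda>n. 2 powr \<delta> i * ((G i (f n) x + G i (f n) (\<tau> i x)) / 2)) \<longlonglongrightarrow> 2 powr \<delta> i * ((0 + 0) / 2)"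
      by (intro tendsto_intros elim) auto
    moreover have "G (Suc i) (f n) x \<le> 2 powr \<delta> i * ((G i (f n) x + G i (f n) (\<tau> i x)) / 2)" for n
      using pmean_le_mean[of "\<delta> i" "G i (f n) x" "G i (f n) (\<tau> i x)"] \<delta>_pos by simp
    ultimately show ?case
      using tendsto_0_le[of "\<lambda>n. 2 powr \<delta> i * ((G i (f n) x + G i (f n) (\<tau> i x)) / 2)" sequentially
          "\<lambda>n. G (Suc i) (f n) x"]
      by (simp del: G.simps times_divide_eq_right)
  qed
qed

text \<open>In the spirit of the Brezis-Lieb lemma: a bounded sequence that vanishes in the limit almost
  everywhere is asymptotically disjoint from \<open>f\<close>, and each level norm is an integral.\<close>

lemma asymptotically_additive:
  fixes f :: "'a \<Rightarrow> 'b::{banach, second_countable_topology}"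
  assumes f: "integrable M f" and h: "\<And>n. integrable M (h n)"
    and bd: "\<And>n. (\<integral>x. norm (h n x) \<partial>M) \<le> C" and lim: "AE x in M. (\<lambda>n. h n x) \<longlonglongrightarrow> 0"
    and e: "0 < e"
  shows "\<forall>\<^sub>F n in sequentially. N f + N (h n) \<le> N (\<lambda>x. f x + h n x) + e"
proof -
  have fh: "integrable M (\<lambda>x. f x + h n x)" for n using f h by simp
  have [measurable]: "f \<in> borel_measurable M" "h n \<in> borel_measurable M" for n using f h[of n] by auto
  have Nh: "N (h n) \<le> \<kappa> 0 * C" for n
    using N_le_L1[OF h[of n]] bd[of n] \<kappa>_ge_1[of 0]
    by (meson mult_left_mono order_trans zero_le_one)
  have "(\<lambda>i. (\<kappa> i - 1) * (\<kappa> 0 * C)) \<longlonglongrightarrow> (1 - 1) * (\<kappa> 0 * C)"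
    by (intro tendsto_intros \<kappa>_tendsto)
  then have "\<forall>\<^sub>F i in sequentially. (\<kappa> i - 1) * (\<kappa> 0 * C) < e / 3"
    using e by (intro order_tendstoD(2)) auto
  moreover have "\<forall>\<^sub>F i in sequentially. N f - e / 3 < Nl i f"
    using e by (intro order_tendstoD(1)[OF Nl_tendsto[OF f]]) auto
  ultimately obtain i where i: "(\<kappa> i - 1) * (\<kappa> 0 * C) < e / 3" "N f - e / 3 < Nl i f"
    using eventually_happens'[OF sequentially_bot eventually_conj] by blast
  have "(\<lambda>n. \<integral>x. G i (\<lambda>x. f x + h n x) x - G i (h n) x \<partial>M) \<longlonglongrightarrow> (\<integral>x. G i f x \<partial>M)"
  proof (rule integral_dominated_convergence)
    show "integrable M (G i f)" using f by simp
    show "AE x in M. norm (G i (\<lambda>x. f x + h n x) x - G i (h n) x) \<le> G i f x" for n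
      using G_add_diff_le[of i f "h n"] by simp
    show "AE x in M. (\<lambda>n. G i (\<lambda>x. f x + h n x) x - G i (h n) x) \<longlonglongrightarrow> G i f x"
      using AE_G_tendsto_0[OF lim, of i]
    proof eventually_elim
      case (elim x)
      have "(\<lambda>n. 2 * G i (h n) x) \<longlonglongrightarrow> 0" using tendsto_mult_right_zero[OF elim, of 2] by simp
      moreover have "norm (G i (\<lambda>x. f x + h n x) x - G i (h n) x - G i f x) \<le> 2 * G i (h n) x" for n
        using G_diff_le[of i "\<lambda>x. f x + h n x" x f] by auto
      ultimately have "(\<lambda>n. G i (\<lambda>x. f x + h n x) x - G i (h n) x - G i f x) \<longlonglongrightarrow> 0"
        by (rule tendsto_0_le)
      then show ?case by (rule LIM_zero_cancel)
    qed
  qed measurable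
  then have "(\<lambda>n. Nl i (\<lambda>x. f x + h n x) - Nl i (h n)) \<longlonglongrightarrow> Nl i f"
    using f h fh by (simp add: Nl_def)
  then have "\<forall>\<^sub>F n in sequentially. N f - e / 3 - e / 3 < Nl i (\<lambda>x. f x + h n x) - Nl i (h n)"
    using i e by (intro order_tendstoD(1)) auto
  then show ?thesis
  proof eventually_elim
    case (elim n)
    have "N (h n) - Nl i (h n) \<le> (\<kappa> i - 1) * Nl i (h n)"
      using N_le_\<kappa>[OF h[of n], of i] by (simp add: algebra_simps)
    also have "\<dots> \<le> (\<kappa> i - 1) * (\<kappa> 0 * C)"
      using \<kappa>_ge_1[of i] Nl_le_N[OF h[of n], of i] Nh[of n] by (intro mult_left_mono) auto
    finally show ?case using elim i Nl_le_N[OF fh[of n], of i] by linarith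
  qed
qed

end


section \<open>Almost everywhere convergent sequences in decreasing convex sets\<close>

lemma convergent_of_summable_min:
  fixes a :: "nat \<Rightarrow> 'b::banach"
  assumes "summable (\<lambda>k. min 1 (norm (a (Suc k) - a k)))"
  shows "convergent a"
proof -
  have "\<forall>\<^sub>F k in sequentially. min 1 (norm (a (Suc k) - a k)) < 1"
    using order_tendstoD(2)[OF summable_LIMSEQ_zero[OF assms], of 1] by simp
  then have "\<forall>\<^sub>F k in sequentially. norm (norm (a (Suc k) - a k)) \<le> min 1 (norm (a (Suc k) - a k))"
    by eventually_elim auto
  then have "summable (\<lambda>k. norm (a (Suc k) - a k))"
    by (rule summable_comparison_test_ev[OF _ assms])
  then have "summable (\<lambda>k. a (Suc k) - a k)" by (rule summable_norm_cancel)
  then have "(\<lambda>n. a 0 + (\<Sum>k<n. a (Suc k) - a k)) \<longlonglongrightarrow> a 0 + (\<Sum>k. a (Suc k) - a k)"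
    by (intro tendsto_intros summable_LIMSEQ)
  then have "a \<longlonglongrightarrow> a 0 + (\<Sum>k. a (Suc k) - a k)" by (simp add: sum_lessThan_telescope)
  then show ?thesis by (auto simp: convergent_def)
qed

lemma (in prob_space) AE_convergent_subseq:
  fixes g :: "nat \<Rightarrow> 'a \<Rightarrow> 'b::{banach, second_countable_topology}"
  assumes meas [measurable]: "\<And>n. g n \<in> borel_measurable M"
    and cauchy: "\<And>e. 0 < e \<Longrightarrow> \<exists>K. \<forall>n\<ge>K. \<forall>m\<ge>n. (\<integral>x. min 1 (norm (g m x - g n x)) \<partial>M) < e"
  obtains s h where "strict_mono (s :: nat \<Rightarrow> nat)" "h \<in> borel_measurable M"
    "AE x in M. (\<lambda>k. g (s k) x) \<longlonglongrightarrow> h x"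
proof -
  have "\<forall>k. \<exists>K. \<forall>n\<ge>K. \<forall>m\<ge>n. (\<integral>x. min 1 (norm (g m x - g n x)) \<partial>M) < (1/2) ^ k"
    using cauchy by simp
  then obtain K where K: "\<And>k n m. K k \<le> n \<Longrightarrow> n \<le> m \<Longrightarrow> (\<integral>x. min 1 (norm (g m x - g n x)) \<partial>M) < (1/2) ^ k"
    by metis
  define s where "s = rec_nat (K 0) (\<lambda>k v. max (Suc v) (K (Suc k)))"
  have s_Suc: "s (Suc k) = max (Suc (s k)) (K (Suc k))" for k by (simp add: s_def)
  have s_ge: "K k \<le> s k" for k by (cases k) (auto simp: s_def)
  have s_mono: "strict_mono s" unfolding strict_mono_Suc_iff s_Suc by (auto simp: less_max_iff_disj)
  have le: "s k \<le> s (Suc k)" for k using s_Suc[of k] by simp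
  define h where "h x = lim (\<lambda>k. g (s k) x)" for x
  have "AE x in M. summable (\<lambda>k. min 1 (norm (g (s (Suc k)) x - g (s k) x)))"
  proof (rule AE_summable_of_integral_summable)
    show "integrable M (\<lambda>x. min 1 (norm (g (s (Suc k)) x - g (s k) x)))" for k
      by (rule integrable_const_bound[of _ 1]) auto
    show "0 \<le> min 1 (norm (g (s (Suc k)) x - g (s k) x))" for k x by simp
    show "summable (\<lambda>k. \<integral>x. min 1 (norm (g (s (Suc k)) x - g (s k) x)) \<partial>M)"
    proof (rule summable_comparison_test')
      show "summable (\<lambda>k. (1/2::real) ^ k)" by (rule summable_geometric) simp
      show "norm (\<integral>x. min 1 (norm (g (s (Suc k)) x - g (s k) x)) \<partial>M) \<le> (1/2) ^ k" for k
      proof -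
        have "0 \<le> (\<integral>x. min 1 (norm (g (s (Suc k)) x - g (s k) x)) \<partial>M)"
          by (rule integral_nonneg_AE) simp
        then show ?thesis using K[OF s_ge[of k] le[of k]] by simp
      qed
    qed
  qed
  then have "AE x in M. (\<lambda>k. g (s k) x) \<longlonglongrightarrow> h x"
    by eventually_elim
      (simp add: h_def convergent_LIMSEQ_iff[symmetric] convergent_of_summable_min[of "\<lambda>k. g (s k) _"])
  moreover have "h \<in> borel_measurable M" unfolding h_def[abs_def] by measurable
  ultimately show thesis using that s_mono by blast
qed

lemma Fatou_norm:
  fixes g :: "nat \<Rightarrow> 'a \<Rightarrow> 'b::{banach, second_countable_topology}"
  assumes g: "\<And>n. integrable M (g n)" and bd: "\<And>n. (\<integral>x. norm (g n x) \<partial>M) \<le> C"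
    and [measurable]: "h \<in> borel_measurable M" and lim: "AE x in M. (\<lambda>n. g n x) \<longlonglongrightarrow> h x"
  shows "integrable M h" "(\<integral>x. norm (h x) \<partial>M) \<le> C"
proof -
  have [measurable]: "g n \<in> borel_measurable M" for n using g by simp
  have C: "0 \<le> C" by (rule order_trans[OF integral_nonneg_AE bd[of 0]]) simp
  have "(\<integral>\<^sup>+x. norm (h x) \<partial>M) = (\<integral>\<^sup>+x. liminf (\<lambda>n. ennreal (norm (g n x))) \<partial>M)"
  proof (rule nn_integral_cong_AE)
    show "AE x in M. ennreal (norm (h x)) = liminf (\<lambda>n. ennreal (norm (g n x)))"
      using lim
    proof eventually_elim
      case (elim x)
      then have "(\<lambda>n. ennreal (norm (g n x))) \<longlonglongrightarrow> ennreal (norm (h x))" by (intro tendsto_intros)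
      from lim_imp_Liminf[OF sequentially_bot this] show ?case by (rule sym)
    qed
  qed
  also have "\<dots> \<le> liminf (\<lambda>n. \<integral>\<^sup>+x. norm (g n x) \<partial>M)"
    by (rule nn_integral_liminf) measurable
  also have "\<dots> \<le> liminf (\<lambda>n. ennreal C)"
    using g bd by (intro Liminf_mono always_eventually allI)
      (simp add: nn_integral_eq_integral ennreal_leI)
  also have "\<dots> = ennreal C" by (simp add: Liminf_const)
  finally have le: "(\<integral>\<^sup>+x. norm (h x) \<partial>M) \<le> ennreal C" .
  then show h: "integrable M h"
    by (intro integrableI_bounded) (auto intro: le_less_trans)
  then show "(\<integral>x. norm (h x) \<partial>M) \<le> C"
    using le C by (simp add: nn_integral_eq_integral)
qed

text \<open>A strictly convex function of linear growth, so that its integral is finite on \<open>L\<^sub>1\<close>.\<close>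

definition bracket :: "'b::real_inner \<Rightarrow> real" where
  "bracket a = sqrt (1 + a \<bullet> a)"

lemma bracket_ge_1: "1 \<le> bracket a"
  by (simp add: bracket_def)

lemma bracket_sq: "bracket a * bracket a = 1 + a \<bullet> a"
  by (simp add: bracket_def add_nonneg_nonneg)

lemma bracket_le: "bracket a \<le> 1 + norm a"
proof -
  have "sqrt (1 + a \<bullet> a) \<le> sqrt ((1 + norm a)\<^sup>2)"
    by (simp add: power2_eq_square algebra_simps flip: power2_norm_eq_inner)
  then show ?thesis by (simp add: bracket_def)
qed

text \<open>The function is the norm of \<open>(1, a)\<close>; two such vectors are never parallel unless equal, and the defect in
  the squared Cauchy-Schwarz inequality between them is at least \<open>\<parallel>a - b\<parallel>\<^sup>2\<close>.\<close>

lemma bracket_gap: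
  assumes R: "bracket a + bracket b \<le> R"
  shows "norm (a - b) ^ 2 \<le> R ^ 3 * ((bracket a + bracket b) / 2 - bracket ((1/2) *\<^sub>R (a + b)))"
    and "bracket ((1/2) *\<^sub>R (a + b)) \<le> (bracket a + bracket b) / 2"
proof -
  define A B S where "A = bracket a" "B = bracket b" "S = bracket ((1/2) *\<^sub>R (a + b))"
  note ABS = this
  have AB: "1 \<le> A" "1 \<le> B" "1 \<le> S" by (auto simp: ABS bracket_ge_1)
  have sq: "A * A = 1 + a \<bullet> a" "B * B = 1 + b \<bullet> b" "S * S = 1 + (1/4) * ((a + b) \<bullet> (a + b))"
    by (simp_all add: ABS bracket_sq)
  have CS: "(a \<bullet> b) * (a \<bullet> b) \<le> (a \<bullet> a) * (b \<bullet> b)"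
    using Cauchy_Schwarz_ineq[of a b] by (simp add: power2_eq_square)
  define d where "d = (a - b) \<bullet> (a - b)"
  have d: "d = a \<bullet> a + b \<bullet> b - 2 * (a \<bullet> b)"
    by (simp add: d_def inner_diff_left inner_diff_right inner_commute)
  define t where "t = A * B - (1 + a \<bullet> b)"
  have key: "(A * B) * (A * B) - (1 + a \<bullet> b) * (1 + a \<bullet> b) \<ge> d"
  proof -
    have "(A * B) * (A * B) = (1 + a \<bullet> a) * (1 + b \<bullet> b)" using sq(1,2) by (metis mult.assoc mult.left_commute)
    then show ?thesis using CS d by (simp add: algebra_simps)
  qed
  have d0: "0 \<le> d" by (simp add: d_def)
  have ab_le: "1 + a \<bullet> b \<le> A * B"
  proof (rule power2_le_imp_le)
    show "(1 + a \<bullet> b)\<^sup>2 \<le> (A * B)\<^sup>2" using key d0 by (simp add: power2_eq_square)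
    show "0 \<le> A * B" using AB by simp
  qed
  have t0: "0 \<le> t" using ab_le by (simp add: t_def)
  have "d \<le> t * (A * B + (1 + a \<bullet> b))" using key by (simp add: t_def algebra_simps)
  also have "\<dots> \<le> t * (2 * (A * B))" using ab_le t0 by (intro mult_left_mono) auto
  finally have dt: "d \<le> 2 * (A * B) * t" by (simp add: algebra_simps)
  define g where "g = (A + B) / 2 - S"
  have gt: "g * ((A + B) / 2 + S) = t / 2"
  proof -
    have "g * ((A + B) / 2 + S) = (A * A + B * B + 2 * (A * B)) / 4 - S * S"
      by (simp add: g_def algebra_simps)
    also have "\<dots> = t / 2" unfolding sq t_def
      by (simp add: inner_add_left inner_add_right inner_commute algebra_simps)
    finally show ?thesis .
  qed
  have g0: "0 \<le> g"
  proof (rule ccontr)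
    assume "\<not> 0 \<le> g"
    moreover have "0 < A" "0 < B" "0 < S" by (auto simp: ABS intro: less_le_trans[OF zero_less_one bracket_ge_1])
    then have "0 < (A + B) / 2 + S" by (intro add_pos_pos divide_pos_pos) auto
    ultimately have "g * ((A + B) / 2 + S) < 0" by (intro mult_neg_pos) auto
    then show False using gt t0 by simp
  qed
  then show "bracket ((1/2) *\<^sub>R (a + b)) \<le> (bracket a + bracket b) / 2" by (simp add: g_def ABS)
  have R0: "A + B \<le> R" "0 \<le> R" using R AB by (auto simp: ABS)
  have "t = 2 * (g * ((A + B) / 2 + S))" using gt by simp
  also have "\<dots> \<le> 2 * (g * R)"
  proof (intro mult_left_mono)
    show "(A + B) / 2 + S \<le> R" using g0 R0(1) unfolding g_def by argo
  qed (use g0 in auto)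
  finally have tg: "t \<le> 2 * (g * R)" .
  have "4 * (A * B) \<le> (A + B) * (A + B)"
    using zero_le_square[of "A - B"] by (simp add: algebra_simps)
  also have "\<dots> \<le> R * R" using R0 AB by (intro mult_mono) auto
  finally have "4 * (A * B) \<le> R * R" .
  then have "2 * (A * B) * t \<le> (R * R / 2) * (2 * (g * R))"
    using tg t0 R0 by (intro mult_mono) auto
  then have "d \<le> R ^ 3 * g" using dt by (simp add: power3_eq_cube algebra_simps)
  then show "norm (a - b) ^ 2 \<le> R ^ 3 * ((bracket a + bracket b) / 2 - bracket ((1/2) *\<^sub>R (a + b)))"
    by (simp add: d_def g_def ABS power2_norm_eq_inner)
qed

lemma min_norm_le_bracket_gap:
  assumes "0 < R" "0 < c"
  shows "min 1 (norm (a - b)) \<le> (bracket a + bracket b) / R + c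
    + R ^ 3 / c * ((bracket a + bracket b) / 2 - bracket ((1/2) *\<^sub>R (a + b)))"
proof -
  let ?g = "(bracket a + bracket b) / 2 - bracket ((1/2) *\<^sub>R (a + b))"
  have g: "0 \<le> R ^ 3 / c * ?g" using bracket_gap(2)[of a b "bracket a + bracket b"] assms by simp
  have s: "0 \<le> (bracket a + bracket b) / R"
    using bracket_ge_1[of a] bracket_ge_1[of b] assms by simp
  consider "R < bracket a + bracket b" | "norm (a - b) \<le> c" | "bracket a + bracket b \<le> R" "c < norm (a - b)"
    by linarith
  then show ?thesis
  proof cases
    case 1
    then have "1 \<le> (bracket a + bracket b) / R" using assms by simp
    then show ?thesis using g assms by linarith
  next
    case 2
    then show ?thesis using g s by linarith
  next
    case 3
    have "norm (a - b) * c \<le> norm (a - b) * norm (a - b)" using 3 by (intro mult_left_mono) auto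
    also have "\<dots> \<le> R ^ 3 * ?g" using bracket_gap(1)[OF 3(1)] by (simp add: power2_eq_square)
    finally have "norm (a - b) \<le> R ^ 3 * ?g / c" using assms by (simp add: pos_le_divide_eq)
    then show ?thesis using s assms by simp
  qed
qed

text \<open>A weak form of the theorem of Komlos.  Choose \<open>g n\<close> in the \<open>n\<close>-th set so that it almost minimises the integral
  of \<open>bracket\<close>.  Midpoints of \<open>g n\<close> and \<open>g m\<close> belong to one of the sets and cannot do much better, so by strict
  convexity the sequence is Cauchy in measure.\<close>

lemma (in prob_space) decreasing_midconvex_AE_limit:
  fixes C :: "nat \<Rightarrow> ('a \<Rightarrow> 'b::euclidean_space) set"
  assumes ne: "\<And>n. C n \<noteq> {}" and dec: "\<And>n m. n \<le> m \<Longrightarrow> C m \<subseteq> C n"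
    and int: "\<And>n f. f \<in> C n \<Longrightarrow> integrable M f"
    and bd: "\<And>n f. f \<in> C n \<Longrightarrow> (\<integral>x. norm (f x) \<partial>M) \<le> B"
    and mid: "\<And>n f g. f \<in> C n \<Longrightarrow> g \<in> C n \<Longrightarrow> (\<lambda>x. (1/2) *\<^sub>R (f x + g x)) \<in> C n"
  obtains g h where "\<And>k. g k \<in> C k" "integrable M h" "AE x in M. (\<lambda>k. g k x) \<longlonglongrightarrow> h x"
proof -
  define u where "u f = (\<integral>x. bracket (f x) \<partial>M)" for f :: "'a \<Rightarrow> 'b"
  have brm: "(\<lambda>x. bracket (f x)) \<in> borel_measurable M" if [measurable]: "f \<in> borel_measurable M" for f :: "'a \<Rightarrow> 'b"
    unfolding bracket_def by measurable
  have bri: "integrable M (\<lambda>x. bracket (f x))" if f: "integrable M f" for f :: "'a \<Rightarrow> 'b"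
  proof (rule Bochner_Integration.integrable_bound)
    show "integrable M (\<lambda>x. 1 + norm (f x))" using f by simp
    show "AE x in M. norm (bracket (f x)) \<le> norm (1 + norm (f x))"
    proof (rule AE_I2)
      fix x
      show "norm (bracket (f x)) \<le> norm (1 + norm (f x))"
        using bracket_le[of "f x"] bracket_ge_1[of "f x"] by simp
    qed
  qed (use brm f in auto)
  have u_le: "u f \<le> 1 + B" if "f \<in> C n" for f n
  proof -
    have "u f \<le> (\<integral>x. 1 + norm (f x) \<partial>M)" unfolding u_def
      using int[OF that] by (intro integral_mono bri bracket_le) auto
    then show ?thesis using bd[OF that] int[OF that] by (simp add: prob_space)
  qed
  have u_ge: "0 \<le> u f" for f unfolding u_def
    by (intro integral_nonneg_AE AE_I2 order_trans[OF zero_le_one bracket_ge_1])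
  define J where "J n = (INF f\<in>C n. u f)" for n
  have bb: "bdd_below (u ` C n)" for n using u_ge by (intro bdd_belowI[of _ 0]) auto
  have J_le: "J n \<le> u f" if "f \<in> C n" for n f unfolding J_def by (rule cINF_lower[OF bb that])
  have J_mono: "J n \<le> J m" if "n \<le> m" for n m
    unfolding J_def by (rule cINF_superset_mono[OF ne bb dec[OF that]]) simp
  have "\<exists>f\<in>C n. u f < J n + 1 / Suc n" for n
    unfolding J_def using cINF_less_iff[OF ne bb, of n "J n + 1 / Suc n"] by (simp add: J_def)
  then obtain g where g: "\<And>n. g n \<in> C n" and ug: "\<And>n. u (g n) < J n + 1 / Suc n" by metis
  have gi: "integrable M (g n)" for n using int[OF g] .
  have "convergent J"
  proof -
    have "J n \<le> 1 + B" for n using J_le[OF g[of n]] u_le[OF g[of n]] by linarith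
    then have "\<exists>L. J \<longlonglongrightarrow> L" using incseq_convergent[of J "1 + B"] J_mono by (metis incseq_def)
    then show ?thesis by (simp add: convergent_def)
  qed
  then have JC: "Cauchy J" by (rule convergent_Cauchy)
  have gap: "(u (g n) + u (g m)) / 2 - u (\<lambda>x. (1/2) *\<^sub>R (g m x + g n x)) \<le> (J m - J n) / 2 + 1 / Suc n"
    if "n \<le> m" for n m
  proof -
    have "J n \<le> u (\<lambda>x. (1/2) *\<^sub>R (g m x + g n x))"
      using mid[of "g m" n "g n"] g dec[OF that] J_le by blast
    moreover have "1 / Suc m \<le> 1 / Suc n" using that by (simp add: frac_le)
    ultimately show ?thesis using ug[of n] ug[of m] by argo
  qed
  have cauchy: "\<exists>K. \<forall>n\<ge>K. \<forall>m\<ge>n. (\<integral>x. min 1 (norm (g m x - g n x)) \<partial>M) < e" if e: "0 < e" for e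
  proof -
    have B0: "0 \<le> B" by (rule order_trans[OF integral_nonneg_AE bd[OF g[of 0]]]) simp
    define R where "R = 4 * (2 + 2 * B) / e"
    define c where "c = e / 4"
    have R: "0 < R" and c: "0 < c" using e B0 by (auto simp: R_def c_def)
    define q where "q = R ^ 3 / c"
    have q: "0 < q" using R c by (simp add: q_def)
    obtain K1 where K1: "\<And>m n. K1 \<le> m \<Longrightarrow> K1 \<le> n \<Longrightarrow> norm (J m - J n) < e / (4 * q)"
      using CauchyD[OF JC, of "e / (4 * q)"] e q by auto
    obtain K2 :: nat where K2: "4 * q / e < K2" using reals_Archimedean2 by blast
    have "(\<integral>x. min 1 (norm (g m x - g n x)) \<partial>M) < e" if nm: "max K1 K2 \<le> n" "n \<le> m" for n m
    proof -
      let ?mid = "\<lambda>x. (1/2) *\<^sub>R (g m x + g n x)"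
      have midi: "integrable M ?mid" using gi by simp
      note I = bri[OF gi[of n]] bri[OF gi[of m]] bri[OF midi]
      have "(\<integral>x. min 1 (norm (g m x - g n x)) \<partial>M) \<le>
        (\<integral>x. (bracket (g m x) + bracket (g n x)) / R + c
          + q * ((bracket (g m x) + bracket (g n x)) / 2 - bracket (?mid x)) \<partial>M)"
      proof (rule integral_mono)
        show "integrable M (\<lambda>x. min 1 (norm (g m x - g n x)))"
          using gi by (intro integrable_const_bound[of _ 1]) auto
        show "integrable M (\<lambda>x. (bracket (g m x) + bracket (g n x)) / R + c
            + q * ((bracket (g m x) + bracket (g n x)) / 2 - bracket (?mid x)))"
          using I by auto
        show "min 1 (norm (g m x - g n x)) \<le> (bracket (g m x) + bracket (g n x)) / R + c
            + q * ((bracket (g m x) + bracket (g n x)) / 2 - bracket (?mid x))" for x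
          unfolding q_def by (rule min_norm_le_bracket_gap[OF R c])
      qed
      also have "\<dots> = (u (g m) + u (g n)) / R + c + q * ((u (g m) + u (g n)) / 2 - u ?mid)"
        using I unfolding u_def by (simp add: prob_space)
      also have "\<dots> \<le> (2 + 2 * B) / R + c + q * ((J m - J n) / 2 + 1 / Suc n)"
      proof -
        have "u (g m) + u (g n) \<le> 2 + 2 * B" using u_le[OF g[of m]] u_le[OF g[of n]] by linarith
        moreover have "(u (g m) + u (g n)) / 2 - u ?mid \<le> (J m - J n) / 2 + 1 / Suc n"
          using gap[OF nm(2)] by argo
        ultimately have "(u (g m) + u (g n)) / R \<le> (2 + 2 * B) / R"
          "q * ((u (g m) + u (g n)) / 2 - u ?mid) \<le> q * ((J m - J n) / 2 + 1 / Suc n)"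
          using R q by (auto intro!: divide_right_mono mult_left_mono)
        then show ?thesis by (intro add_mono[OF add_right_mono])
      qed
      also have "\<dots> < e"
      proof -
        have *: "b / (4 * b / e) = e / 4" if "0 < b" for b using that e by simp
        have 1: "(2 + 2 * B) / R = e / 4" unfolding R_def by (rule *) (use B0 in linarith)
        have "J m - J n < e / (4 * q)" using K1[of m n] nm by auto
        then have 2: "q * (J m - J n) < e / 4" using q by (simp add: field_simps)
        have "4 * q / e < Suc n" using K2 nm by linarith
        then have 3: "q * (1 / Suc n) < e / 4" using e q by (simp add: field_simps)
        have "q * ((J m - J n) / 2 + 1 / Suc n) = q * (J m - J n) / 2 + q * (1 / Suc n)"
          by (simp add: algebra_simps)
        moreover have "e / 4 + e / 4 + (x / 2 + y) < e" if "x < e / 4" "y < e / 4" for x y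
          using that e by argo
        ultimately show ?thesis unfolding 1 c_def using 2 3 by simp
      qed
      finally show ?thesis .
    qed
    then show ?thesis by blast
  qed
  have gm: "g n \<in> borel_measurable M" for n using gi by simp
  obtain s h where s: "strict_mono s" and h: "h \<in> borel_measurable M"
    and lim: "AE x in M. (\<lambda>k. g (s k) x) \<longlonglongrightarrow> h x"
    using AE_convergent_subseq[OF gm cauchy] by blast
  have "integrable M h" by (rule Fatou_norm(1)[OF gi bd[OF g] h lim])
  moreover have "g (s k) \<in> C k" for k using g[of "s k"] dec[OF seq_suble[OF s, of k]] by blast
  ultimately show thesis using that[of "\<lambda>k. g (s k)" h] lim by blast
qed

context mean_tower begin

text \<open>The limit \<open>h\<close> of an almost everywhere convergent selection from the convex sets satisfies
  \<open>N (z \<plusminus> h) \<le> N z\<close>, because what is lost in the limit is asymptotically disjoint from \<open>z \<plusminus> h\<close>; then \<open>h = 0\<close>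
  by strict convexity, and nothing is lost.\<close>

lemma midpoint_sequences:
  fixes z :: "'a \<Rightarrow> 'b::euclidean_space"
  assumes z: "integrable M z"
    and mid: "\<And>f g. integrable M f \<Longrightarrow> integrable M g \<Longrightarrow> P f \<Longrightarrow> P g \<Longrightarrow> P (\<lambda>x. (1/2) *\<^sub>R (f x + g x))"
    and ex: "\<And>e. 0 < e \<Longrightarrow> \<exists>h. integrable M h \<and> P h \<and> N (\<lambda>x. z x + h x) \<le> N z + e \<and> N (\<lambda>x. z x - h x) \<le> N z + e"
  obtains g where "\<And>k. integrable M (g k)" "\<And>k. P (g k)" "(\<lambda>k. N (g k)) \<longlonglongrightarrow> 0"
proof -
  define C where "C n = {h. integrable M h \<and> P h \<and> N (\<lambda>x. z x + h x) \<le> N z + 1 / Suc n \<and>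
      N (\<lambda>x. z x - h x) \<le> N z + 1 / Suc n}" for n :: nat
  have half: "N (\<lambda>x. (1/2) *\<^sub>R (f x + g x)) \<le> (N f + N g) / 2"
    if "integrable M f" "integrable M g" for f g :: "'a \<Rightarrow> 'b"
  proof -
    have fg: "integrable M (\<lambda>x. f x + g x)" using that by simp
    have "N (\<lambda>x. (1/2) *\<^sub>R (f x + g x)) = (1/2) * N (\<lambda>x. f x + g x)"
      by (rule N_scale[OF fg]) (use that in auto)
    then show ?thesis using N_add[OF that] by simp
  qed
  have p: "integrable M (\<lambda>x. z x + h x)" "integrable M (\<lambda>x. z x - h x)" "integrable M (\<lambda>x. - h x)"
    if "integrable M h" for h using z that by auto
  have bound: "(\<integral>x. norm (f x) \<partial>M) \<le> N z + 1" if "f \<in> C n" for n f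
  proof -
    have f: "integrable M f" and le: "N (\<lambda>x. z x + f x) \<le> N z + 1 / Suc n" "N (\<lambda>x. z x - f x) \<le> N z + 1 / Suc n"
      using that by (auto simp: C_def)
    have m: "integrable M (\<lambda>x. - (z x - f x))" using p(2)[OF f] by (rule integrable_minus)
    have e: "(\<lambda>x. (1/2) *\<^sub>R ((z x + f x) + - (z x - f x))) = f"
      by (rule ext) (simp add: scaleR_2[symmetric])
    have "N (\<lambda>x. - (z x - f x)) = 1 * N (\<lambda>x. z x - f x)"
      by (rule N_scale[OF p(2)[OF f] m]) (simp_all add: norm_minus_commute)
    then have "N f \<le> (N (\<lambda>x. z x + f x) + N (\<lambda>x. z x - f x)) / 2"
      using half[OF p(1)[OF f] m] unfolding e by simp
    moreover have "1 / real (Suc n) \<le> 1" by simp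
    ultimately have "N f \<le> N z + 1" using le by argo
    then show ?thesis using L1_le_N[OF f] by linarith
  qed
  obtain g h where g: "\<And>k. g k \<in> C k" and h: "integrable M h" and lim: "AE x in M. (\<lambda>k. g k x) \<longlonglongrightarrow> h x"
  proof (rule decreasing_midconvex_AE_limit[of C "N z + 1"])
    show "C n \<noteq> {}" for n using ex[of "1 / Suc n"] unfolding C_def by auto
    show "C m \<subseteq> C n" if "n \<le> m" for n m
    proof -
      have "1 / real (Suc m) \<le> 1 / real (Suc n)" using that by (simp add: frac_le)
      then show ?thesis unfolding C_def by fastforce
    qed
    show "integrable M f" if "f \<in> C n" for n f using that by (simp add: C_def)
    show "(\<integral>x. norm (f x) \<partial>M) \<le> N z + 1" if "f \<in> C n" for n f
      by (rule bound[OF that])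
    show "(\<lambda>x. (1/2) *\<^sub>R (f x + g x)) \<in> C n" if "f \<in> C n" "g \<in> C n" for f g n
    proof -
      have f: "integrable M f" "P f" "N (\<lambda>x. z x + f x) \<le> N z + 1 / Suc n" "N (\<lambda>x. z x - f x) \<le> N z + 1 / Suc n"
        and g: "integrable M g" "P g" "N (\<lambda>x. z x + g x) \<le> N z + 1 / Suc n" "N (\<lambda>x. z x - g x) \<le> N z + 1 / Suc n"
        using that by (auto simp: C_def)
      have hz: "z x = (1/2) *\<^sub>R z x + (1/2) *\<^sub>R z x" for x by (simp add: scaleR_2[symmetric] flip: scaleR_add_left)
      have e1: "(\<lambda>x. z x + (1/2) *\<^sub>R (f x + g x)) = (\<lambda>x. (1/2) *\<^sub>R ((z x + f x) + (z x + g x)))"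
        by (rule ext) (subst hz, simp add: scaleR_add_right)
      have e2: "(\<lambda>x. z x - (1/2) *\<^sub>R (f x + g x)) = (\<lambda>x. (1/2) *\<^sub>R ((z x - f x) + (z x - g x)))"
        by (rule ext) (subst hz, simp add: scaleR_add_right scaleR_diff_right)
      have "N (\<lambda>x. z x + (1/2) *\<^sub>R (f x + g x)) \<le> N z + 1 / Suc n"
        unfolding e1 using half[OF p(1)[OF f(1)] p(1)[OF g(1)]] f(3) g(3) by argo
      moreover have "N (\<lambda>x. z x - (1/2) *\<^sub>R (f x + g x)) \<le> N z + 1 / Suc n"
        unfolding e2 using half[OF p(2)[OF f(1)] p(2)[OF g(1)]] f(4) g(4) by argo
      moreover have "integrable M (\<lambda>x. (1/2) *\<^sub>R (f x + g x))" using f g by simp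
      ultimately show ?thesis using mid[OF f(1) g(1) f(2) g(2)] unfolding C_def by blast
    qed
  qed blast
  have gi: "integrable M (g k)" "P (g k)" and gle: "N (\<lambda>x. z x + g k x) \<le> N z + 1 / Suc k"
      "N (\<lambda>x. z x - g k x) \<le> N z + 1 / Suc k" for k
    using g[of k] by (auto simp: C_def)
  define \<rho> where "\<rho> k x = g k x - h x" for k x
  have \<rho>i: "integrable M (\<rho> k)" "integrable M (\<lambda>x. - \<rho> k x)" for k
    unfolding \<rho>_def[abs_def] using gi(1)[of k] h by auto
  have \<rho>lim: "AE x in M. (\<lambda>k. \<rho> k x) \<longlonglongrightarrow> 0" "AE x in M. (\<lambda>k. - \<rho> k x) \<longlonglongrightarrow> 0"
  proof -
    show 1: "AE x in M. (\<lambda>k. \<rho> k x) \<longlonglongrightarrow> 0"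
      using lim unfolding \<rho>_def by eventually_elim (rule LIM_zero)
    show "AE x in M. (\<lambda>k. - \<rho> k x) \<longlonglongrightarrow> 0"
      using 1 by eventually_elim (simp add: tendsto_minus_cancel_left[symmetric])
  qed
  define D' where "D' = N z + 1 + (\<integral>x. norm (h x) \<partial>M)"
  have \<rho>b: "(\<integral>x. norm (\<rho> k x) \<partial>M) \<le> D'" for k
  proof -
    have "(\<integral>x. norm (\<rho> k x) \<partial>M) \<le> (\<integral>x. norm (g k x) + norm (h x) \<partial>M)"
      using gi(1)[of k] h \<rho>i(1)[of k] by (intro integral_mono) (auto simp: \<rho>_def norm_triangle_ineq4)
    also have "\<dots> \<le> D'" using gi(1)[of k] h bound[OF g[of k]] by (simp add: D'_def)
    finally show ?thesis .
  qed
  have N\<rho>: "N (\<lambda>x. - \<rho> k x) = N (\<rho> k)" for k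
    using N_scale[OF \<rho>i(1) \<rho>i(2), of k 1 k] by simp
  have ev: "\<forall>\<^sub>F k in sequentially. N (\<lambda>x. z x + h x) + N (\<rho> k) \<le> N z + 1 / Suc k + e \<and>
      N (\<lambda>x. z x - h x) + N (\<rho> k) \<le> N z + 1 / Suc k + e" if "0 < e" for e
  proof -
    have "\<forall>\<^sub>F k in sequentially. N (\<lambda>x. z x + h x) + N (\<rho> k) \<le> N (\<lambda>x. (z x + h x) + \<rho> k x) + e"
      by (rule asymptotically_additive[OF p(1)[OF h] \<rho>i(1) \<rho>b \<rho>lim(1) that])
    moreover have "\<forall>\<^sub>F k in sequentially. N (\<lambda>x. z x - h x) + N (\<lambda>x. - \<rho> k x) \<le> N (\<lambda>x. (z x - h x) + - \<rho> k x) + e"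
      by (rule asymptotically_additive[OF p(2)[OF h] \<rho>i(2) _ \<rho>lim(2) that, of D']) (simp add: \<rho>b)
    ultimately show ?thesis
    proof eventually_elim
      case (elim k)
      have "(\<lambda>x. (z x + h x) + \<rho> k x) = (\<lambda>x. z x + g k x)" "(\<lambda>x. (z x - h x) + - \<rho> k x) = (\<lambda>x. z x - g k x)"
        by (auto simp: \<rho>_def)
      then show ?case using elim gle[of k] unfolding N\<rho> by simp
    qed
  qed
  have inv0: "(\<lambda>k. 1 / real (Suc k)) \<longlonglongrightarrow> 0" using LIMSEQ_inverse_real_of_nat by (simp add: inverse_eq_divide)
  have ev': "\<forall>\<^sub>F k in sequentially. N (\<lambda>x. z x + h x) + N (\<rho> k) \<le> N z + e \<and>
      N (\<lambda>x. z x - h x) + N (\<rho> k) \<le> N z + e" if "0 < e" for e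
  proof -
    have "\<forall>\<^sub>F k in sequentially. 1 / real (Suc k) < e / 2"
      using that by (intro order_tendstoD(2)[OF inv0]) simp
    with ev[of "e / 2"] that show ?thesis by (auto elim: eventually_elim2)
  qed
  have le: "N (\<lambda>x. z x + h x) \<le> N z" "N (\<lambda>x. z x - h x) \<le> N z"
  proof -
    have "N (\<lambda>x. z x + h x) \<le> N z + e \<and> N (\<lambda>x. z x - h x) \<le> N z + e" if e: "0 < e" for e
    proof -
      obtain k where "N (\<lambda>x. z x + h x) + N (\<rho> k) \<le> N z + e" "N (\<lambda>x. z x - h x) + N (\<rho> k) \<le> N z + e"
        using eventually_happens'[OF sequentially_bot ev'[OF e]] by blast
      then show ?thesis using N_nonneg[OF \<rho>i(1)[of k]] by linarith
    qed
    then show "N (\<lambda>x. z x + h x) \<le> N z" "N (\<lambda>x. z x - h x) \<le> N z"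
      by (auto intro: field_le_epsilon)
  qed
  have h0: "AE x in M. h x = 0" by (rule midpoint_unique[OF z h le])
  have "N (\<lambda>x. z x + h x) = N z"
    by (rule N_cong_AE[OF p(1)[OF h] z]) (use h0 in \<open>auto elim: eventually_mono\<close>)
  then have small: "\<forall>\<^sub>F k in sequentially. N (\<rho> k) \<le> e" if "0 < e" for e
    using ev'[OF that] by (auto elim: eventually_mono)
  have "N (g k) = N (\<rho> k)" for k
    by (rule N_cong_AE[OF gi(1) \<rho>i(1)]) (use h0 in \<open>auto elim: eventually_mono simp: \<rho>_def\<close>)
  then have "(\<lambda>k. N (g k)) \<longlonglongrightarrow> 0"
    unfolding tendsto_iff dist_real_def
  proof (intro allI impI)
    fix e :: real assume "0 < e"
    then have "\<forall>\<^sub>F k in sequentially. N (\<rho> k) \<le> e / 2" by (intro small) simp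
    then show "\<forall>\<^sub>F k in sequentially. \<bar>N (g k) - 0\<bar> < e"
      by eventually_elim (use \<open>0 < e\<close> \<open>\<And>k. N (g k) = N (\<rho> k)\<close> N_nonneg[OF \<rho>i(1)] in auto)
  qed
  then show thesis using that gi by blast
qed

end


section \<open>Operator norms and rank-one operators\<close>

lemma op_norm_bound:
  assumes Y: "normed_space Y" and Z: "normed_space Z" and T: "bounded_linear_between Y Z T" and x: "x \<in> vcar Y"
  shows "vnorm Z (T x) \<le> op_norm Y Z T * vnorm Y x"
proof (cases "vnorm Y x = 0")
  case True
  from T obtain C where "\<And>x. x \<in> vcar Y \<Longrightarrow> vnorm Z (T x) \<le> C * vnorm Y x"
    unfolding bounded_linear_between_def by blast
  then show ?thesis using True x by fastforce
next
  case False
  from T obtain C where C: "\<And>x. x \<in> vcar Y \<Longrightarrow> vnorm Z (T x) \<le> C * vnorm Y x"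
    unfolding bounded_linear_between_def by blast
  have pos: "0 < vnorm Y x" using False Y x by (auto simp: normed_space_def less_le)
  let ?B = "{x \<in> vcar Y. vnorm Y x \<le> 1}"
  have bdd: "bdd_above ((\<lambda>x. vnorm Z (T x)) ` ?B)"
  proof (rule bdd_aboveI2[of _ _ "\<bar>C\<bar>"])
    fix x assume x: "x \<in> ?B"
    then have "0 \<le> vnorm Y x" using Y by (auto simp: normed_space_def)
    then have "C * vnorm Y x \<le> \<bar>C\<bar> * 1" using x by (intro mult_mono) auto
    then show "vnorm Z (T x) \<le> \<bar>C\<bar>" using C[of x] x by auto
  qed
  let ?c = "of_real (inverse (vnorm Y x))"
  let ?x = "vscale Y ?c x"
  have "module (vscale Y)" using Y by (auto simp: normed_space_def vector_space_def module_def)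
  then have cx: "?x \<in> vcar Y" using Y x by (auto simp: normed_space_def module.subspace_def)
  have "vnorm Y ?x = 1" using Y x pos False by (simp add: normed_space_def norm_inverse left_inverse)
  then have "vnorm Z (T ?x) \<le> op_norm Y Z T"
    unfolding op_norm_def using cx by (intro cSUP_upper bdd) simp
  moreover have "vnorm Z (T ?x) = inverse (vnorm Y x) * vnorm Z (T x)"
    using T Z x pos by (simp add: bounded_linear_between_def normed_space_def norm_inverse)
  ultimately have "inverse (vnorm Y x) * vnorm Z (T x) \<le> op_norm Y Z T" by simp
  then show ?thesis using pos by (simp add: field_simps)
qed

lemma op_norm_least:
  assumes Y: "normed_space Y" and C: "0 \<le> C" and le: "\<And>x. x \<in> vcar Y \<Longrightarrow> vnorm Z (T x) \<le> C * vnorm Y x"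
  shows "op_norm Y Z T \<le> C"
  unfolding op_norm_def
proof (rule cSUP_least)
  have "module (vscale Y)" using Y by (auto simp: normed_space_def vector_space_def module_def)
  then have "0 \<in> vcar Y" "vnorm Y 0 = 0" using Y by (auto simp: normed_space_def module.subspace_def)
  then show "{x \<in> vcar Y. vnorm Y x \<le> 1} \<noteq> {}" by force
  fix x assume "x \<in> {x \<in> vcar Y. vnorm Y x \<le> 1}"
  then show "vnorm Z (T x) \<le> C" using le[of x] mult_left_mono[of "vnorm Y x" 1 C] C by auto
qed

lemma op_norm_nonneg:
  assumes Y: "normed_space Y" and Z: "normed_space Z" and T: "bounded_linear_between Y Z T"
    and x: "x \<in> vcar Y" "vnorm Y x \<noteq> 0"
  shows "0 \<le> op_norm Y Z T"
proof -
  have "T x \<in> vcar Z" using T x by (auto simp: bounded_linear_between_def)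
  then have "0 \<le> op_norm Y Z T * vnorm Y x"
    using op_norm_bound[OF Y Z T x(1)] Z by (fastforce simp: normed_space_def)
  moreover have "0 < vnorm Y x" using x Y by (auto simp: normed_space_def less_le)
  ultimately show ?thesis by (simp add: zero_le_mult_iff)
qed

lemma rank_one_obtain:
  assumes "vector_space (vscale X)" "rank_one X R"
  obtains b where "b \<noteq> 0" "b \<in> R ` vcar X" "\<And>x. x \<in> vcar X \<Longrightarrow> \<exists>c. R x = vscale X c b"
proof -
  interpret vector_space "vscale X" by fact
  obtain B where B: "B \<subseteq> R ` vcar X" "independent B" "R ` vcar X \<subseteq> span B" "card B = dim (R ` vcar X)"
    by (rule basis_exists)
  then have "card B = 1" using assms(2) by (simp add: rank_one_def)
  then obtain b where b: "B = {b}" by (auto simp: card_1_singleton_iff)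
  show thesis
  proof
    show "b \<noteq> 0" using B(2) b by (auto simp: dependent_single)
    show "b \<in> R ` vcar X" using B(1) b by auto
    show "\<exists>c. R x = vscale X c b" if "x \<in> vcar X" for x
      using B(3) b that by (auto simp: span_singleton)
  qed
qed

text \<open>Scaling turns an inequality at each vector into the lower bound for the operator norm; the upper bound is the triangle inequality.\<close>

lemma daugavet_propertyI:
  assumes X: "normed_space X"
    and lower: "\<And>R x B. bounded_linear_between X X R \<Longrightarrow> rank_one X R \<Longrightarrow> x \<in> vcar X \<Longrightarrow>
      (\<And>x. x \<in> vcar X \<Longrightarrow> vnorm X (x + R x) \<le> B * vnorm X x) \<Longrightarrow> vnorm X (R x) \<le> (B - 1) * vnorm X x"
  shows "daugavet_property X"
  unfolding daugavet_property_def
proof (intro allI impI)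
  fix R assume "bounded_linear_between X X R \<and> rank_one X R"
  then have R: "bounded_linear_between X X R" and r1: "rank_one X R" by auto
  have vs: "vector_space (vscale X)" using X by (simp add: normed_space_def)
  have md: "module (vscale X)" using vs by (auto simp: vector_space_def module_def)
  have sub: "0 \<in> vcar X" "\<And>x y. x \<in> vcar X \<Longrightarrow> y \<in> vcar X \<Longrightarrow> x + y \<in> vcar X"
    "\<And>c x. x \<in> vcar X \<Longrightarrow> vscale X c x \<in> vcar X"
    using X md by (auto simp: normed_space_def module.subspace_def)
  have Rc: "R x \<in> vcar X" if "x \<in> vcar X" for x using R that by (simp add: bounded_linear_between_def)
  have tri: "vnorm X (x + y) \<le> vnorm X x + vnorm X y" if "x \<in> vcar X" "y \<in> vcar X" for x y
    using X that by (simp add: normed_space_def)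
  obtain C where C: "\<And>x. x \<in> vcar X \<Longrightarrow> vnorm X (R x) \<le> C * vnorm X x"
    using R unfolding bounded_linear_between_def by blast
  have IR: "bounded_linear_between X X (\<lambda>x. x + R x)"
    unfolding bounded_linear_between_def
  proof (intro conjI ballI allI)
    show "x + R x \<in> vcar X" if "x \<in> vcar X" for x using that by (intro sub Rc)
    show "x + y + R (x + y) = x + R x + (y + R y)" if "x \<in> vcar X" "y \<in> vcar X" for x y
      using R that by (simp add: bounded_linear_between_def algebra_simps)
    show "vscale X c x + R (vscale X c x) = vscale X c (x + R x)" if "x \<in> vcar X" for c x
      using R that module.scale_right_distrib[OF md] by (simp add: bounded_linear_between_def)
    show "\<exists>C. \<forall>x\<in>vcar X. vnorm X (x + R x) \<le> C * vnorm X x"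
    proof (intro exI ballI)
      fix x assume x: "x \<in> vcar X"
      show "vnorm X (x + R x) \<le> (1 + C) * vnorm X x"
        using tri[OF x Rc[OF x]] C[OF x] by (simp add: algebra_simps)
    qed
  qed
  obtain b where b: "b \<noteq> 0" "b \<in> R ` vcar X" by (rule rank_one_obtain[OF vs r1]) blast
  have bX: "b \<in> vcar X" using b Rc by auto
  then have nb: "vnorm X b \<noteq> 0" using X b by (auto simp: normed_space_def)
  then have nb': "0 < vnorm X b" using X bX by (auto simp: normed_space_def less_le)
  have r0: "0 \<le> op_norm X X R" by (rule op_norm_nonneg[OF X X R bX nb])
  have "op_norm X X (\<lambda>x. x + R x) \<le> 1 + op_norm X X R"
  proof (rule op_norm_least[OF X])
    show "vnorm X (x + R x) \<le> (1 + op_norm X X R) * vnorm X x" if x: "x \<in> vcar X" for x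
      using tri[OF x Rc[OF x]] op_norm_bound[OF X X R x] by (simp add: algebra_simps)
  qed (use r0 in simp)
  moreover have "op_norm X X R \<le> op_norm X X (\<lambda>x. x + R x) - 1"
  proof (rule op_norm_least[OF X])
    show *: "vnorm X (R x) \<le> (op_norm X X (\<lambda>x. x + R x) - 1) * vnorm X x" if x: "x \<in> vcar X" for x
      by (rule lower[OF R r1 x op_norm_bound[OF X X IR]])
    have "0 \<le> vnorm X (R b)" using X Rc[OF bX] by (simp add: normed_space_def)
    then have "0 \<le> (op_norm X X (\<lambda>x. x + R x) - 1) * vnorm X b" using *[OF bX] by linarith
    then show "0 \<le> op_norm X X (\<lambda>x. x + R x) - 1" using nb' by (simp add: zero_le_mult_iff)
  qed
  ultimately show "op_norm X X (\<lambda>x. x + R x) = 1 + op_norm X X R" by linarith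
qed

section \<open>Spaces that split finely into almost additive pieces\<close>

locale full_normed_space =
  fixes s :: "'k::real_normed_field \<Rightarrow> 'a::ab_group_add \<Rightarrow> 'a" and N :: "'a \<Rightarrow> real"
  assumes normed: "normed_space \<lparr>vscale = s, vcar = UNIV, vnorm = N\<rparr>"
begin

abbreviation "X \<equiv> \<lparr>vscale = s, vcar = UNIV, vnorm = N\<rparr>"
abbreviation "D \<equiv> dual_space X"

sublocale vector_space s
  using normed by (simp add: normed_space_def)

lemma N_nonneg: "0 \<le> N x" and N_0_iff: "N x = 0 \<longleftrightarrow> x = 0" and N_s: "N (s c x) = norm c * N x"
  and N_tri: "N (x + y) \<le> N x + N y"
  using normed by (auto simp: normed_space_def)

lemma N_minus: "N (- x) = N x"
  using N_s[of "-1" x] by simp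

lemma N_diff: "N (x - y) \<le> N x + N y"
  using N_tri[of x "- y"] by (simp add: N_minus)

lemma N_sum: "N (\<Sum>k\<in>A. f k) \<le> (\<Sum>k\<in>A. N (f k))"
proof (induction A rule: infinite_finite_induct)
  case (insert a A)
  then show ?case using N_tri[of "f a" "sum f A"] by simp
qed (simp_all add: N_0_iff[THEN iffD2])

lemma normed_scalar: "normed_space (scalar_space :: ('k, 'k) nspace)"
proof -
  have "vector_space ((*) :: 'k \<Rightarrow> 'k \<Rightarrow> 'k)" by unfold_locales (auto simp: algebra_simps)
  moreover then have "module ((*) :: 'k \<Rightarrow> 'k \<Rightarrow> 'k)" by (auto simp: vector_space_def module_def)
  ultimately show ?thesis
    by (auto simp: normed_space_def scalar_space_def module.subspace_def norm_mult norm_triangle_ineq)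
qed

lemma in_dual: "\<phi> \<in> vcar D \<longleftrightarrow> (\<forall>x y. \<phi> (x + y) = \<phi> x + \<phi> y) \<and> (\<forall>c x. \<phi> (s c x) = c * \<phi> x) \<and>
    (\<exists>C. \<forall>x. norm (\<phi> x) \<le> C * N x)"
  by (auto simp: dual_space_def bounded_linear_between_def scalar_space_def)

lemma dualI:
  assumes "\<And>x y. \<phi> (x + y) = \<phi> x + \<phi> y" "\<And>c x. \<phi> (s c x) = c * \<phi> x" "\<And>x. norm (\<phi> x) \<le> C * N x" "0 \<le> C"
  shows "\<phi> \<in> vcar D" "vnorm D \<phi> \<le> C"
proof -
  show "\<phi> \<in> vcar D" using assms by (auto simp: in_dual)
  show "vnorm D \<phi> \<le> C"
    unfolding dual_space_def using assms op_norm_least[OF normed, of C scalar_space \<phi>]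
    by (simp add: scalar_space_def)
qed

lemma dual_bound: "\<phi> \<in> vcar D \<Longrightarrow> norm (\<phi> x) \<le> vnorm D \<phi> * N x"
  using op_norm_bound[OF normed normed_scalar, of \<phi> x] by (simp add: dual_space_def scalar_space_def)

lemma dual_linear:
  assumes "\<phi> \<in> vcar D"
  shows "\<phi> (x + y) = \<phi> x + \<phi> y" "\<phi> (s c x) = c * \<phi> x" "\<phi> (x - y) = \<phi> x - \<phi> y" "\<phi> 0 = 0"
    "\<phi> (\<Sum>k\<in>A. f k) = (\<Sum>k\<in>A. \<phi> (f k))"
proof -
  show 1: "\<phi> (x + y) = \<phi> x + \<phi> y" "\<phi> (s c x) = c * \<phi> x" for x y c
    using assms unfolding in_dual by blast+
  show 0: "\<phi> 0 = 0" using 1(2)[of 0 0] by simp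
  show "\<phi> (x - y) = \<phi> x - \<phi> y" using 1(1)[of "x - y" y] by (simp add: algebra_simps)
  show "\<phi> (\<Sum>k\<in>A. f k) = (\<Sum>k\<in>A. \<phi> (f k))"
    by (induction A rule: infinite_finite_induct) (auto simp: 0 1)
qed

lemma dual_norm_nonneg:
  assumes "\<phi> \<in> vcar D"
  shows "0 \<le> vnorm D \<phi>"
proof -
  have "\<phi> 0 = 0" by (rule dual_linear[OF assms])
  obtain C where C: "\<And>x. norm (\<phi> x) \<le> C * N x" using assms unfolding in_dual by blast
  have "norm (\<phi> 0) \<le> (SUP x\<in>{x. N x \<le> 1}. norm (\<phi> x))"
  proof (rule cSUP_upper)
    show "bdd_above ((\<lambda>x. norm (\<phi> x)) ` {x. N x \<le> 1})"
    proof (rule bdd_aboveI2[of _ _ "\<bar>C\<bar>"])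
      fix x assume "x \<in> {x. N x \<le> 1}"
      then have "C * N x \<le> \<bar>C\<bar> * 1" using N_nonneg[of x] by (intro mult_mono) auto
      then show "norm (\<phi> x) \<le> \<bar>C\<bar>" using C[of x] by simp
    qed
  qed (use N_0_iff[of 0] in simp)
  then show ?thesis using \<open>\<phi> 0 = 0\<close> by (simp add: dual_space_def op_norm_def scalar_space_def)
qed

lemma dual_add:
  assumes "\<phi> \<in> vcar D" "\<psi> \<in> vcar D"
  shows "\<phi> + \<psi> \<in> vcar D" "vnorm D (\<phi> + \<psi>) \<le> vnorm D \<phi> + vnorm D \<psi>"
proof -
  have b: "norm ((\<phi> + \<psi>) x) \<le> (vnorm D \<phi> + vnorm D \<psi>) * N x" for x
    using norm_triangle_ineq[of "\<phi> x" "\<psi> x"] dual_bound[OF assms(1), of x] dual_bound[OF assms(2), of x]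
    by (simp add: algebra_simps)
  show "\<phi> + \<psi> \<in> vcar D" "vnorm D (\<phi> + \<psi>) \<le> vnorm D \<phi> + vnorm D \<psi>"
    using dual_norm_nonneg assms
    by (auto intro!: dualI[OF _ _ b] simp: dual_linear[OF assms(1)] dual_linear[OF assms(2)] algebra_simps)
qed

lemma vscale_D: "vscale D c \<phi> = (\<lambda>x. c * \<phi> x)"
  by (simp add: dual_space_def)

lemma dual_scale:
  assumes "\<phi> \<in> vcar D"
  shows "(\<lambda>x. c * \<phi> x) \<in> vcar D" "vnorm D (\<lambda>x. c * \<phi> x) \<le> norm c * vnorm D \<phi>"
proof -
  have b: "norm (c * \<phi> x) \<le> (norm c * vnorm D \<phi>) * N x" for x
    using mult_left_mono[OF dual_bound[OF assms, of x], of "norm c"] by (simp add: norm_mult mult.assoc)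
  show "(\<lambda>x. c * \<phi> x) \<in> vcar D" "vnorm D (\<lambda>x. c * \<phi> x) \<le> norm c * vnorm D \<phi>"
    using dual_norm_nonneg assms
    by (auto intro!: dualI[OF _ _ b] simp: dual_linear[OF assms] algebra_simps)
qed

lemma zero_in_dual: "0 \<in> vcar D" "vnorm D 0 = 0"
proof -
  have "(0 :: 'a \<Rightarrow> 'k) \<in> vcar D \<and> vnorm D 0 \<le> 0"
    using dualI[of "0 :: 'a \<Rightarrow> 'k" 0] by auto
  then show "(0 :: 'a \<Rightarrow> 'k) \<in> vcar D" "vnorm D 0 = 0"
    using dual_norm_nonneg[of 0] by auto
qed

lemma normed_dual: "normed_space D"
proof -
  have vs: "vector_space (vscale D)"
    by unfold_locales (auto simp: vscale_D algebra_simps fun_eq_iff)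
  then have md: "module (vscale D)" by (auto simp: vector_space_def module_def)
  have sc: "vnorm D (vscale D c \<phi>) = norm c * vnorm D \<phi>" if \<phi>: "\<phi> \<in> vcar D" for c \<phi>
  proof (cases "c = 0")
    case True
    then have "vscale D c \<phi> = 0" by (auto simp: vscale_D)
    then show ?thesis using True zero_in_dual by simp
  next
    case False
    have "(\<lambda>x. inverse c * (c * \<phi> x)) = \<phi>" using False by (auto simp: mult.assoc[symmetric])
    then have "vnorm D \<phi> \<le> norm (inverse c) * vnorm D (\<lambda>x. c * \<phi> x)"
      using dual_scale(2)[OF dual_scale(1)[OF \<phi>, of c], of "inverse c"] by simp
    then have "norm c * vnorm D \<phi> \<le> vnorm D (\<lambda>x. c * \<phi> x)"
      using False by (simp add: norm_divide norm_inverse field_simps)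
    then show ?thesis using dual_scale(2)[OF \<phi>, of c] by (simp add: vscale_D)
  qed
  have zero: "vnorm D \<phi> = 0 \<longleftrightarrow> \<phi> = 0" if "\<phi> \<in> vcar D" for \<phi>
  proof
    assume "vnorm D \<phi> = 0"
    then show "\<phi> = 0" using dual_bound[OF that] by (auto simp: fun_eq_iff)
  qed (use zero_in_dual in simp)
  show ?thesis unfolding normed_space_def
    using vs md sc zero dual_add dual_scale zero_in_dual dual_norm_nonneg
    by (auto simp: module.subspace_def vscale_D)
qed

end

text \<open>An approximate form of being an \<open>L\<^sub>1\<close>-sum of arbitrarily small pieces: for every error and every
  vector, finitely many projections decompose the space into an almost additive sum in which the
  given vector has small pieces.  Norming functionals, which the Hahn-Banach theorem would provide,
  are available explicitly in the application.\<close>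

locale fine_splitting = full_normed_space s N
  for s :: "'k::real_normed_field \<Rightarrow> 'a::ab_group_add \<Rightarrow> 'a" and N :: "'a \<Rightarrow> real" +
  assumes splitting: "\<And>y e. 0 < e \<Longrightarrow> \<exists>n P.
      (\<forall>k f g. P k (f + g) = P k f + P k g) \<and> (\<forall>k c f. P k (s c f) = s c (P k f)) \<and>
      (\<forall>k f. P k (P k f) = P k f) \<and> (\<forall>f. (\<Sum>k<n. P k f) = f) \<and>
      (\<forall>f. (\<Sum>k<n. N (P k f)) \<le> (1 + e) * N f) \<and> (\<forall>k<n::nat. N (P k y) < e)"
    and norming: "\<And>z. \<exists>\<phi>\<in>vcar (dual_space \<lparr>vscale = s, vcar = UNIV, vnorm = N\<rparr>).
      \<phi> z = of_real (N z) \<and> (\<forall>f. norm (\<phi> f) \<le> N f)"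
begin

text \<open>Almost additivity over all pieces implies almost additivity over one piece and its complement.\<close>

lemma piece_le:
  fixes n :: nat
  assumes add: "\<And>f g. P k (f + g) = P k f + P k g"
    and dec: "(\<Sum>k<n. P k f) = f" and sum: "(\<Sum>k<n. N (P k f)) \<le> C" and k: "k < n"
  shows "N (P k f) + N (f - P k f) \<le> C"
proof -
  have "f - P k f = (\<Sum>j\<in>{..<n} - {k}. P j f)"
    using dec k by (subst sum_diff1) auto
  then have "N (f - P k f) \<le> (\<Sum>j\<in>{..<n} - {k}. N (P j f))" using N_sum by simp
  also have "\<dots> = (\<Sum>k<n. N (P k f)) - N (P k f)" using k by (subst sum_diff1) auto
  finally show ?thesis using sum by simp
qed

lemma le_of_all_small:
  fixes a b p q :: real
  assumes "\<And>e. 0 < e \<Longrightarrow> e \<le> 1 \<Longrightarrow> a \<le> (1 + e) ^ 2 * b + e * (p + q * e)"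
  shows "a \<le> b"
proof -
  have "((\<lambda>e. (1 + e) ^ 2 * b + e * (p + q * e)) \<longlongrightarrow> (1 + 0) ^ 2 * b + 0 * (p + q * 0)) (at_right 0)"
    by (intro tendsto_intros)
  moreover have "\<forall>\<^sub>F e in at_right 0. a \<le> (1 + e) ^ 2 * b + e * (p + q * e)"
    unfolding eventually_at_right_field using assms by (intro exI[of _ 1]) auto
  ultimately show ?thesis
    using tendsto_lowerbound[of _ _ "at_right (0::real)" a] by (simp add: trivial_limit_at_right_real)
qed

text \<open>On the piece with index \<open>k\<close> only a small part of the vector \<open>b\<close> spanning the range lives, so
  \<open>N (P k f + R (P k f))\<close> is almost \<open>N (P k f) + N (R (P k f))\<close>.  Summation over the pieces gives the
  estimate for \<open>f\<close>.\<close>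

lemma daugavet: "daugavet_property X"
proof (rule daugavet_propertyI[OF normed])
  fix R f B
  assume R: "bounded_linear_between X X R" and r1: "rank_one X R"
    and B: "\<And>x. x \<in> vcar X \<Longrightarrow> vnorm X (x + R x) \<le> B * vnorm X x"
  have B: "N (x + R x) \<le> B * N x" for x using B[of x] by simp
  have Radd: "R (x + y) = R x + R y" and Rs: "R (s c x) = s c (R x)" for x y c
    using R by (auto simp: bounded_linear_between_def)
  have R0: "R 0 = 0" using Rs[of 0 0] by simp
  have Rsum: "R (\<Sum>k\<in>A. g k) = (\<Sum>k\<in>A. R (g k))" for g and A :: "nat set"
    by (induction A rule: infinite_finite_induct) (auto simp: Radd R0)
  have vs: "vector_space (vscale X)" using normed by (simp only: normed_space_def)
  obtain b where "b \<noteq> 0" and "b \<in> R ` vcar X" and "\<And>x. x \<in> vcar X \<Longrightarrow> \<exists>c. R x = vscale X c b"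
    by (rule rank_one_obtain[OF vs r1]) blast
  then have "\<forall>x. \<exists>c. R x = s c b" by simp
  then obtain \<xi> where \<xi>: "\<And>x. R x = s (\<xi> x) b" by metis
  have Nb: "0 < N b" using \<open>b \<noteq> 0\<close> N_nonneg[of b] N_0_iff[of b] by linarith
  have B0: "0 \<le> B"
  proof -
    have "0 \<le> B * N b" using B[of b] N_nonneg[of "b + R b"] by linarith
    then show ?thesis using Nb by (simp add: zero_le_mult_iff)
  qed
  have "N f + N (R f) \<le> B * N f"
  proof (rule le_of_all_small)
    fix e :: real assume e: "0 < e" "e \<le> 1"
    define d where "d = e * min 1 (N b)"
    have d: "0 < d" "d \<le> e" using e Nb by (auto simp: d_def mult_le_cancel_left1)
    obtain n :: nat and P where P: "\<And>k f g. P k (f + g) = P k f + P k g" "\<And>k c f. P k (s c f) = s c (P k f)"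
      "\<And>k f. P k (P k f) = P k f" "\<And>f. (\<Sum>k<n. P k f) = f"
      "\<And>f. (\<Sum>k<n. N (P k f)) \<le> (1 + d) * N f" "\<And>k. k < n \<Longrightarrow> N (P k b) < d"
      using splitting[OF d(1), of b] by blast
    have piece: "N (P k f) + norm (\<xi> (P k f)) * (N b - 2 * d) \<le> (1 + e) * (B * N (P k f))" if k: "k < n" for k
    proof -
      let ?f = "P k f" and ?c = "\<xi> (P k f)"
      let ?g = "?f + s ?c b"
      have "N (P k ?g) + N (?g - P k ?g) \<le> (1 + d) * N ?g"
        by (rule piece_le[OF P(1) P(4) P(5) k])
      also have "\<dots> \<le> (1 + e) * N ?g" using d N_nonneg by (intro mult_right_mono) auto
      also have "\<dots> \<le> (1 + e) * (B * N ?f)" using B[of ?f] e unfolding \<xi> by (intro mult_left_mono) auto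
      finally have 1: "N (P k ?g) + N (?g - P k ?g) \<le> (1 + e) * (B * N ?f)" .
      have Pg: "P k ?g = ?f + s ?c (P k b)" by (simp add: P(1,2,3))
      have 2: "N ?f \<le> N (P k ?g) + norm ?c * N (P k b)"
        using N_diff[of "P k ?g" "s ?c (P k b)"] unfolding Pg by (simp add: N_s)
      have "?g - P k ?g = s ?c (b - P k b)" unfolding Pg by (simp add: scale_right_diff_distrib)
      then have 3: "N (?g - P k ?g) = norm ?c * N (b - P k b)" by (simp add: N_s)
      have "N b \<le> N (b - P k b) + N (P k b)" using N_tri[of "b - P k b" "P k b"] by simp
      then have "N b - 2 * d \<le> N (b - P k b) - N (P k b)" using P(6)[OF k] by linarith
      then have "norm ?c * (N b - 2 * d) \<le> norm ?c * (N (b - P k b) - N (P k b))"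
        by (intro mult_left_mono) auto
      then show ?thesis using 1 2 unfolding 3 by (simp add: algebra_simps)
    qed
    have cb: "norm c * (N b - 2 * d) \<ge> norm c * N b * (1 - 2 * e)" for c :: 'k
    proof -
      have "d \<le> e * N b" using e by (simp add: d_def)
      then have "norm c * (N b * (1 - 2 * e)) \<le> norm c * (N b - 2 * d)"
        by (intro mult_left_mono) (auto simp: algebra_simps)
      then show ?thesis by (simp add: mult.assoc)
    qed
    have piece': "N (P k f) + N (R (P k f)) \<le> (1 + e) * (B * N (P k f)) + 2 * e * N (R (P k f))" if k: "k < n" for k
      using piece[OF k] cb[of "\<xi> (P k f)"] by (simp add: \<xi> N_s algebra_simps)
    show "N f + N (R f) \<le> (1 + e) ^ 2 * (B * N f) + e * (2 * op_norm X X R * 2 * N f + 0 * e)"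
    proof -
      have oR: "0 \<le> op_norm X X R"
        using op_norm_nonneg[OF normed normed R, of b] Nb by simp
      have Rb: "N (R x) \<le> op_norm X X R * N x" for x
        using op_norm_bound[OF normed normed R, of x] by simp
      have S: "(\<Sum>k<n. N (P k f)) \<le> (1 + e) * N f"
        using P(5)[of f] mult_right_mono[of "1 + d" "1 + e" "N f"] d N_nonneg[of f] by linarith
      have "N f \<le> (\<Sum>k<n. N (P k f))" using N_sum[of "\<lambda>k. P k f" "{..<n}"] by (simp add: P(4))
      moreover have "N (R f) \<le> (\<Sum>k<n. N (R (P k f)))"
        using N_sum[of "\<lambda>k. R (P k f)" "{..<n}"] by (simp add: Rsum[symmetric] P(4))
      moreover have "(\<Sum>k<n. N (P k f)) + (\<Sum>k<n. N (R (P k f))) \<le> (\<Sum>k<n. (1 + e) * (B * N (P k f)) + 2 * e * (op_norm X X R * N (P k f)))"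
      proof -
        have "(\<Sum>k<n. N (P k f) + N (R (P k f))) \<le> (\<Sum>k<n. (1 + e) * (B * N (P k f)) + 2 * e * (op_norm X X R * N (P k f)))"
        proof (rule sum_mono)
          fix k assume "k \<in> {..<n}"
          then show "N (P k f) + N (R (P k f)) \<le> (1 + e) * (B * N (P k f)) + 2 * e * (op_norm X X R * N (P k f))"
          proof -
            have "2 * e * N (R (P k f)) \<le> 2 * e * (op_norm X X R * N (P k f))"
              using e by (intro mult_left_mono Rb) auto
            then show ?thesis using piece'[of k] \<open>k \<in> {..<n}\<close> by simp
          qed
        qed
        then show ?thesis by (simp add: sum.distrib)
      qed
      moreover have "(\<Sum>k<n. (1 + e) * (B * N (P k f)) + 2 * e * (op_norm X X R * N (P k f)))
          = ((1 + e) * B + 2 * e * op_norm X X R) * (\<Sum>k<n. N (P k f))"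
        by (simp only: sum.distrib sum_distrib_left distrib_right mult.assoc)
      moreover have "\<dots> \<le> ((1 + e) * B + 2 * e * op_norm X X R) * ((1 + e) * N f)"
        using S B0 oR e by (intro mult_left_mono) auto
      moreover have "\<dots> = (1 + e) ^ 2 * (B * N f) + (2 * e * op_norm X X R) * ((1 + e) * N f)"
        by (simp add: power2_eq_square algebra_simps)
      moreover have "(2 * e * op_norm X X R) * ((1 + e) * N f) \<le> (2 * e * op_norm X X R) * (2 * N f)"
        using e oR N_nonneg[of f] by (intro mult_left_mono mult_right_mono) auto
      ultimately show ?thesis by (simp add: algebra_simps)
    qed
  qed
  then show "vnorm X (R f) \<le> (B - 1) * vnorm X f" by (simp add: algebra_simps)
qed

lemma unimodular_obtain:
  obtains c where "norm c = 1" "c * w = of_real (norm (w :: 'k))"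
proof (cases "w = 0")
  case True
  then show thesis using that[of 1] by simp
next
  case False
  then show thesis using that[of "of_real (norm w) / w"] by (simp add: norm_divide)
qed

text \<open>Given \<open>y\<close> and a functional \<open>\<phi>1\<close> of norm one, change \<open>\<phi>1\<close> on the piece \<open>k\<close> into a functional norming
  \<open>P k y\<close>, and evaluate \<open>I + R\<close> at the changed functional and at \<open>P k y\<close>.  The sum over \<open>k\<close> of these values is
  \<open>\<Sum> N (P k y) + R \<phi>1 y\<close> up to the contribution of the changes \<open>\<theta> k\<close>; as \<open>R\<close> has rank one and all unimodular
  combinations of the \<open>\<theta> k\<close> are bounded, that contribution is at most a constant times the largest
  \<open>N (P k y)\<close>.\<close>

lemma daugavet_dual: "daugavet_property D"
proof (rule daugavet_propertyI[OF normed_dual])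
  fix R \<phi> B
  assume R: "bounded_linear_between D D R" and r1: "rank_one D R" and \<phi>: "\<phi> \<in> vcar D"
    and B: "\<And>\<phi>. \<phi> \<in> vcar D \<Longrightarrow> vnorm D (\<phi> + R \<phi>) \<le> B * vnorm D \<phi>"
  have Rin: "R f \<in> vcar D" and Rs: "R (\<lambda>x. c * f x) = (\<lambda>x. c * R f x)" if "f \<in> vcar D" for f c
    using R that by (auto simp: bounded_linear_between_def vscale_D)
  have Radd: "R (f + g) = R f + R g" if "f \<in> vcar D" "g \<in> vcar D" for f g
    using R that by (auto simp: bounded_linear_between_def)
  define C where "C = op_norm D D R"
  have C: "vnorm D (R f) \<le> C * vnorm D f" if "f \<in> vcar D" for f
    using op_norm_bound[OF normed_dual normed_dual R that] by (simp add: C_def)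
  have vs: "vector_space (vscale D)" using normed_dual by (simp only: normed_space_def)
  obtain \<psi> where "\<psi> \<noteq> 0" and "\<psi> \<in> R ` vcar D" and rank: "\<And>f. f \<in> vcar D \<Longrightarrow> \<exists>c. R f = vscale D c \<psi>"
    by (rule rank_one_obtain[OF vs r1]) blast
  then have \<psi>: "\<psi> \<in> vcar D" using Rin by auto
  obtain x0 where x0: "\<psi> x0 \<noteq> 0" using \<open>\<psi> \<noteq> 0\<close> by (auto simp: fun_eq_iff)
  define \<Lambda> where "\<Lambda> f = R f x0 / \<psi> x0" for f
  have \<Lambda>: "R f x = \<Lambda> f * \<psi> x" if f: "f \<in> vcar D" for f x
  proof -
    obtain c where "R f = (\<lambda>x. c * \<psi> x)" using rank[OF f] by (auto simp: vscale_D)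
    then show ?thesis using x0 by (simp add: \<Lambda>_def)
  qed
  have n\<psi>: "0 < vnorm D \<psi>"
    using normed_dual \<psi> \<open>\<psi> \<noteq> 0\<close> by (auto simp: normed_space_def less_le)
  have n\<psi>': "vnorm D \<psi> \<noteq> 0" using n\<psi> by simp
  have C0: "0 \<le> C" unfolding C_def by (rule op_norm_nonneg[OF normed_dual normed_dual R \<psi> n\<psi>'])
  have B0: "0 \<le> B"
  proof -
    have "0 \<le> B * vnorm D \<psi>" using B[OF \<psi>] dual_norm_nonneg[OF dual_add(1)[OF \<psi> Rin[OF \<psi>]]] by linarith
    then show ?thesis using n\<psi> by (simp add: zero_le_mult_iff)
  qed
  define K where "K = C * 2 * N x0 / norm (\<psi> x0)"
  have core: "N y + norm (R \<phi>0 y) \<le> B * N y" if \<phi>0: "\<phi>0 \<in> vcar D" "\<And>x. norm (\<phi>0 x) \<le> N x" for \<phi>0 y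
  proof (rule le_of_all_small)
    fix e :: real assume e: "0 < e" "e \<le> 1"
    obtain u where u: "norm u = 1" "u * R \<phi>0 y = of_real (norm (R \<phi>0 y))" by (rule unimodular_obtain)
    define \<phi>1 where "\<phi>1 x = u * \<phi>0 x" for x
    have \<phi>1: "\<phi>1 \<in> vcar D" unfolding \<phi>1_def[abs_def] by (rule dual_scale(1)[OF \<phi>0(1)])
    have \<phi>1b: "norm (\<phi>1 x) \<le> N x" for x using \<phi>0(2)[of x] by (simp add: \<phi>1_def norm_mult u)
    have R\<phi>1: "R \<phi>1 y = of_real (norm (R \<phi>0 y))"
      unfolding \<phi>1_def[abs_def] using Rs[OF \<phi>0(1), of u] u(2) by simp
    obtain n :: nat and P where P: "\<And>k f g. P k (f + g) = P k f + P k g" "\<And>k c f. P k (s c f) = s c (P k f)"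
      "\<And>k f. P k (P k f) = P k f" "\<And>f. (\<Sum>k<n. P k f) = f"
      "\<And>f. (\<Sum>k<n. N (P k f)) \<le> (1 + e) * N f" "\<And>k. k < n \<Longrightarrow> N (P k y) < e"
      using splitting[OF e(1), of y] by metis
    define Y where "Y k = P k y" for k
    have "\<forall>z. \<exists>\<phi>. \<phi> \<in> vcar D \<and> \<phi> z = of_real (N z) \<and> (\<forall>f. norm (\<phi> f) \<le> N f)"
      using norming by blast
    then obtain \<nu> where \<nu>: "\<forall>z. \<nu> z \<in> vcar D \<and> \<nu> z z = of_real (N z) \<and> (\<forall>f. norm (\<nu> z f) \<le> N f)"
      by (rule exE[OF choice])
    define \<eta> where "\<eta> k = \<nu> (Y k)" for k
    have \<eta>: "\<And>k. \<eta> k \<in> vcar D" "\<And>k. \<eta> k (Y k) = of_real (N (Y k))" "\<And>k f. norm (\<eta> k f) \<le> N f"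
      using \<nu> by (auto simp: \<eta>_def)
    define \<theta> where "\<theta> k f = \<eta> k (P k f) - \<phi>1 (P k f)" for k f
    have \<theta>lin: "\<theta> k (f + g) = \<theta> k f + \<theta> k g" "\<theta> k (s c f) = c * \<theta> k f" for k f g c
      by (simp_all add: \<theta>_def P(1,2) dual_linear[OF \<eta>(1)] dual_linear[OF \<phi>1] algebra_simps)
    have \<theta>b: "norm (\<theta> k f) \<le> 2 * N (P k f)" for k f
      unfolding \<theta>_def using norm_triangle_ineq4[of "\<eta> k (P k f)" "\<phi>1 (P k f)"] \<eta>(3)[of k "P k f"] \<phi>1b[of "P k f"]
      by linarith
    have Pb: "N (P k f) \<le> (1 + e) * N f" if "k < n" for k f
      using member_le_sum[of k "{..<n}" "\<lambda>k. N (P k f)"] that N_nonneg P(5)[of f] by auto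
    have \<theta>: "\<theta> k \<in> vcar D" if "k < n" for k
    proof (rule dualI(1)[OF \<theta>lin])
      show "norm (\<theta> k f) \<le> 2 * (1 + e) * N f" for f
        using \<theta>b[of k f] Pb[OF that, of f] by linarith
    qed (use e in simp)
    \<comment> \<open>Replacing \<open>\<phi>1\<close> on a single piece by a functional norming \<open>Y k\<close> hardly raises its norm.\<close>
    have F: "\<phi>1 + \<theta> k \<in> vcar D" "vnorm D (\<phi>1 + \<theta> k) \<le> 1 + e" if k: "k < n" for k
    proof -
      have "norm ((\<phi>1 + \<theta> k) f) \<le> (1 + e) * N f" for f
      proof -
        have "(\<phi>1 + \<theta> k) f = \<phi>1 (f - P k f) + \<eta> k (P k f)"
          by (simp add: \<theta>_def dual_linear[OF \<phi>1])
        then have "norm ((\<phi>1 + \<theta> k) f) \<le> norm (\<phi>1 (f - P k f)) + norm (\<eta> k (P k f))"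
          by (metis norm_triangle_ineq)
        also have "\<dots> \<le> N (P k f) + N (f - P k f)" using \<eta>(3)[of k "P k f"] \<phi>1b[of "f - P k f"] by linarith
        also have "\<dots> \<le> (1 + e) * N f" by (rule piece_le[OF P(1) P(4) P(5) k])
        finally show ?thesis .
      qed
      note b = this
      show "\<phi>1 + \<theta> k \<in> vcar D" "vnorm D (\<phi>1 + \<theta> k) \<le> 1 + e"
        by (rule dualI[OF _ _ b]; use e in \<open>simp add: \<theta>lin dual_linear[OF \<phi>1] distrib_left\<close>)+
    qed
    have Yk: "(\<phi>1 + \<theta> k) (Y k) = of_real (N (Y k))" for k
      using \<eta>(2)[of k] by (simp add: \<theta>_def Y_def P(3))
    obtain c where c: "\<And>k. norm (c k) = 1" "\<And>k. c k * \<Lambda> (\<theta> k) = of_real (norm (\<Lambda> (\<theta> k)))"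
    proof -
      have "\<forall>k. \<exists>c. norm c = 1 \<and> c * \<Lambda> (\<theta> k) = of_real (norm (\<Lambda> (\<theta> k)))"
        using unimodular_obtain by blast
      then obtain c where "\<forall>k. norm (c k) = 1 \<and> c k * \<Lambda> (\<theta> k) = of_real (norm (\<Lambda> (\<theta> k)))"
        by (rule exE[OF choice])
      then show thesis using that by blast
    qed
    define \<Theta> where "\<Theta> m = (\<lambda>f. \<Sum>k<m. c k * \<theta> k f)" for m :: nat
    have \<Theta>: "\<Theta> m \<in> vcar D \<and> \<Lambda> (\<Theta> m) = (\<Sum>k<m. c k * \<Lambda> (\<theta> k))" if "m \<le> n" for m
      using that
    proof (induction m)
      case 0
      have z: "\<Theta> 0 = 0" by (simp add: \<Theta>_def fun_eq_iff)
      have "R 0 = 0" using Radd[OF zero_in_dual(1) zero_in_dual(1)] by simp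
      then have "\<Lambda> 0 = 0" unfolding \<Lambda>_def by simp
      then show ?case unfolding z using zero_in_dual(1) by (simp only: lessThan_0 sum.empty simp_thms)
    next
      case (Suc m)
      then have m: "m < n" "\<Theta> m \<in> vcar D" by auto
      have S: "\<Theta> (Suc m) = \<Theta> m + (\<lambda>f. c m * \<theta> m f)" by (simp add: \<Theta>_def fun_eq_iff)
      have cm: "(\<lambda>f. c m * \<theta> m f) \<in> vcar D" by (rule dual_scale(1)[OF \<theta>[OF m(1)]])
      have "R (\<Theta> (Suc m)) x0 = R (\<Theta> m) x0 + c m * R (\<theta> m) x0"
        unfolding S Radd[OF m(2) cm] Rs[OF \<theta>[OF m(1)]] by simp
      then have "\<Lambda> (\<Theta> (Suc m)) = \<Lambda> (\<Theta> m) + c m * \<Lambda> (\<theta> m)"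
        by (simp add: \<Lambda>_def add_divide_distrib)
      moreover have "\<Theta> (Suc m) \<in> vcar D" unfolding S by (rule dual_add(1)[OF m(2) cm])
      ultimately show ?case using Suc by simp
    qed
    have \<Theta>n: "vnorm D (\<Theta> n) \<le> 2 * (1 + e)"
    proof (rule dualI(2))
      show "norm (\<Theta> n f) \<le> 2 * (1 + e) * N f" for f
      proof -
        have "norm (\<Theta> n f) \<le> (\<Sum>k<n. norm (c k * \<theta> k f))" unfolding \<Theta>_def by (rule norm_sum)
        also have "\<dots> \<le> (\<Sum>k<n. 2 * N (P k f))"
          by (intro sum_mono) (simp add: norm_mult c(1) \<theta>b)
        also have "\<dots> \<le> 2 * (1 + e) * N f" using P(5)[of f] unfolding sum_distrib_left[symmetric] by linarith
        finally show ?thesis .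
      qed
    qed (use e \<Theta>[of n] dual_linear[of "\<Theta> n"] in auto)
    have sum\<Lambda>: "(\<Sum>k<n. norm (\<Lambda> (\<theta> k))) \<le> K * (1 + e)"
    proof -
      have *: "of_real (\<Sum>k<n. norm (\<Lambda> (\<theta> k))) = \<Lambda> (\<Theta> n)" using \<Theta>[of n] by (simp add: c(2))
      have "0 \<le> (\<Sum>k<n. norm (\<Lambda> (\<theta> k)))" by (simp add: sum_nonneg)
      then have "(\<Sum>k<n. norm (\<Lambda> (\<theta> k))) = norm (of_real (\<Sum>k<n. norm (\<Lambda> (\<theta> k))) :: 'k)"
        by (simp only: norm_of_real abs_of_nonneg)
      also have "\<dots> = norm (\<Lambda> (\<Theta> n))" by (simp only: *)
      also have "\<dots> = norm (R (\<Theta> n) x0) / norm (\<psi> x0)" by (simp add: \<Lambda>_def norm_divide)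
      also have "\<dots> \<le> (C * (2 * (1 + e)) * N x0) / norm (\<psi> x0)"
      proof (rule divide_right_mono)
        have "norm (R (\<Theta> n) x0) \<le> vnorm D (R (\<Theta> n)) * N x0" using \<Theta>[of n] by (intro dual_bound Rin) auto
        also have "\<dots> \<le> (C * (2 * (1 + e))) * N x0"
          using C[of "\<Theta> n"] \<Theta>[of n] mult_left_mono[OF \<Theta>n C0] N_nonneg by (intro mult_right_mono) auto
        finally show "norm (R (\<Theta> n) x0) \<le> C * (2 * (1 + e)) * N x0" .
      qed simp
      finally show ?thesis by (simp add: K_def algebra_simps)
    qed
    define E where "E = (\<Sum>k<n. \<Lambda> (\<theta> k) * \<psi> (Y k))"
    have E: "norm E \<le> e * vnorm D \<psi> * (K * (1 + e))"
    proof -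
      have "norm E \<le> (\<Sum>k<n. norm (\<Lambda> (\<theta> k)) * (e * vnorm D \<psi>))"
        unfolding E_def
      proof (rule sum_norm_le)
        fix k assume "k \<in> {..<n}"
        then have "N (Y k) \<le> e" using P(6)[of k] by (simp add: Y_def)
        then have "norm (\<psi> (Y k)) \<le> vnorm D \<psi> * e"
          using dual_bound[OF \<psi>, of "Y k"] mult_left_mono[of "N (Y k)" e "vnorm D \<psi>"] n\<psi> by linarith
        then show "norm (\<Lambda> (\<theta> k) * \<psi> (Y k)) \<le> norm (\<Lambda> (\<theta> k)) * (e * vnorm D \<psi>)"
          unfolding norm_mult by (intro mult_left_mono) (auto simp: mult.commute)
      qed
      also have "\<dots> = e * vnorm D \<psi> * (\<Sum>k<n. norm (\<Lambda> (\<theta> k)))"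
        by (simp add: sum_distrib_right[symmetric] mult.commute)
      also have "\<dots> \<le> e * vnorm D \<psi> * (K * (1 + e))"
        using e n\<psi> by (intro mult_left_mono sum\<Lambda>) auto
      finally show ?thesis .
    qed
    define S where "S = (\<Sum>k<n. N (Y k))"
    have S: "N y \<le> S" "S \<le> (1 + e) * N y"
      using N_sum[of Y "{..<n}"] P(4,5)[of y] by (auto simp: S_def Y_def)
    have RF: "R (\<phi>1 + \<theta> k) (Y k) = R \<phi>1 (Y k) + \<Lambda> (\<theta> k) * \<psi> (Y k)" if "k < n" for k
      using Radd[OF \<phi>1 \<theta>[OF that]] \<Lambda>[OF \<theta>[OF that], of "Y k"] by simp
    have "(\<Sum>k<n. ((\<phi>1 + \<theta> k) + R (\<phi>1 + \<theta> k)) (Y k)) = (\<Sum>k<n. of_real (N (Y k)) + R \<phi>1 (Y k) + \<Lambda> (\<theta> k) * \<psi> (Y k))"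
      by (intro sum.cong) (auto simp: RF Yk[unfolded plus_fun_apply])
    also have "\<dots> = of_real S + R \<phi>1 y + E"
      unfolding S_def E_def sum.distrib of_real_sum
      using dual_linear(5)[OF Rin[OF \<phi>1], of Y "{..<n}"] P(4)[of y] by (simp add: Y_def)
    finally have total: "(\<Sum>k<n. ((\<phi>1 + \<theta> k) + R (\<phi>1 + \<theta> k)) (Y k)) = of_real (S + norm (R \<phi>0 y)) + E"
      by (simp add: R\<phi>1)
    have "S + norm (R \<phi>0 y) = norm (of_real (S + norm (R \<phi>0 y)) :: 'k)"
      using S(1) N_nonneg[of y] norm_ge_zero[of "R \<phi>0 y"] unfolding norm_of_real by linarith
    also have "\<dots> \<le> norm (of_real (S + norm (R \<phi>0 y)) + E) + norm E"
      using norm_triangle_ineq4[of "of_real (S + norm (R \<phi>0 y)) + E" E] by simp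
    also have "norm (of_real (S + norm (R \<phi>0 y)) + E) \<le> (\<Sum>k<n. B * (1 + e) * N (Y k))"
      unfolding total[symmetric]
    proof (rule sum_norm_le)
      fix k assume "k \<in> {..<n}"
      then have k: "k < n" by simp
      have "norm (((\<phi>1 + \<theta> k) + R (\<phi>1 + \<theta> k)) (Y k)) \<le> vnorm D ((\<phi>1 + \<theta> k) + R (\<phi>1 + \<theta> k)) * N (Y k)"
        by (intro dual_bound dual_add Rin F k)
      also have "\<dots> \<le> (B * (1 + e)) * N (Y k)"
        using B[OF F(1)[OF k]] mult_left_mono[OF F(2)[OF k] B0] N_nonneg by (intro mult_right_mono) auto
      finally show "norm (((\<phi>1 + \<theta> k) + R (\<phi>1 + \<theta> k)) (Y k)) \<le> B * (1 + e) * N (Y k)" .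
    qed
    also have "(\<Sum>k<n. B * (1 + e) * N (Y k)) = B * (1 + e) * S" by (simp add: S_def sum_distrib_left)
    also have "B * (1 + e) * S \<le> B * (1 + e) * ((1 + e) * N y)"
      using S(2) B0 e by (intro mult_left_mono) auto
    also have "B * (1 + e) * ((1 + e) * N y) = (1 + e) ^ 2 * (B * N y)"
      by (simp add: power2_eq_square algebra_simps)
    finally have "S + norm (R \<phi>0 y) \<le> (1 + e) ^ 2 * (B * N y) + norm E" by simp
    then show "N y + norm (R \<phi>0 y) \<le> (1 + e) ^ 2 * (B * N y) + e * (vnorm D \<psi> * K + vnorm D \<psi> * K * e)"
      using S(1) E by (simp add: algebra_simps)
  qed
  have pt: "norm (R \<phi> y) \<le> ((B - 1) * vnorm D \<phi>) * N y" for y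
  proof (cases "vnorm D \<phi> = 0")
    case True
    then have "\<phi> = 0" using dual_bound[OF \<phi>] by (auto simp: fun_eq_iff)
    moreover have "R 0 = 0" using Radd[OF zero_in_dual(1) zero_in_dual(1)] by simp
    ultimately show ?thesis using True by simp
  next
    case False
    then have pos: "0 < vnorm D \<phi>" using dual_norm_nonneg[OF \<phi>] by linarith
    define c where "c = inverse (vnorm D \<phi>)"
    have c: "0 < c" using pos by (simp add: c_def)
    have "norm (of_real c * \<phi> x) \<le> N x" for x
    proof -
      have "norm (of_real c * \<phi> x) = c * norm (\<phi> x)" using c by (simp add: norm_mult)
      also have "\<dots> \<le> c * (vnorm D \<phi> * N x)" using c by (intro mult_left_mono dual_bound \<phi>) auto
      also have "\<dots> = N x" using pos by (simp add: c_def)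
      finally show ?thesis .
    qed
    from core[OF dual_scale(1)[OF \<phi>] this, of y]
    have "N y + c * norm (R \<phi> y) \<le> B * N y" using c by (simp add: Rs[OF \<phi>] norm_mult)
    then show ?thesis using pos by (simp add: c_def field_simps)
  qed
  have "0 < N x0" using x0 N_0_iff[of x0] N_nonneg[of x0] dual_linear(4)[OF \<psi>] by (auto simp: less_le)
  moreover have "0 \<le> ((B - 1) * vnorm D \<phi>) * N x0" using pt[of x0] norm_ge_zero order_trans by blast
  ultimately have "0 \<le> (B - 1) * vnorm D \<phi>" by (simp add: zero_le_mult_iff)
  then show "vnorm D (R \<phi>) \<le> (B - 1) * vnorm D \<phi>"
    using dual_linear[OF Rin[OF \<phi>]] pt by (intro dualI(2)) auto
qed

end


section \<open>Dyadic rotations of the unit interval\<close>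

abbreviation I01 :: "real measure" where
  "I01 \<equiv> lebesgue_on {0..1}"

text \<open>The end point \<open>1\<close> is kept fixed, which makes the algebraic relations hold everywhere.\<close>

definition shift :: "nat \<Rightarrow> real" where
  "shift i = 1 / 2 ^ Suc i"

definition rot :: "nat \<Rightarrow> real \<Rightarrow> real" where
  "rot i x = (if x = 1 then 1 else frac (x + shift i))"

lemma prob_space_I01: "prob_space I01"
  by (rule prob_spaceI) (simp add: emeasure_restrict_space)

interpretation I01: prob_space I01
  by (rule prob_space_I01)

lemma sets_I01: "A \<in> sets I01 \<longleftrightarrow> A \<in> sets lebesgue \<and> A \<subseteq> {0..1}"
  by (auto simp: sets_restrict_space)

lemma measure_I01: "A \<subseteq> {0..1} \<Longrightarrow> measure I01 A = measure lebesgue A"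
  by (simp add: measure_restrict_space)

lemma shift_bounds: "0 < shift i" "shift i < 1"
proof -
  have "(1::real) < 2 ^ Suc i" by (rule one_less_power) auto
  then show "0 < shift i" "shift i < 1"
    by (simp_all add: shift_def divide_less_eq del: power_Suc)
qed

lemma shift_double: "shift 0 + shift 0 = 1" "shift (Suc i) + shift (Suc i) = shift i"
  by (simp_all add: shift_def field_simps)

lemma frac_diff_of_int: "frac (x - of_int n) = frac x" for x :: real
  by (simp add: frac_def)

lemma frac_add_of_int: "frac (x + of_int n) = frac x" for x :: real
  using frac_diff_of_int[of x "- n"] by simp

lemma rot_eq:
  assumes "0 \<le> x" "x < 1"
  shows "rot i x = (if x < 1 - shift i then x + shift i else x + shift i - 1)"
proof (cases "x < 1 - shift i")
  case True
  then have "frac (x + shift i) = x + shift i" using shift_bounds[of i] assms by (subst frac_eq) auto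
  then show ?thesis using True assms by (simp add: rot_def)
next
  case False
  have "frac (x + shift i) = frac (x + shift i - 1)" using frac_diff_of_int[of "x + shift i" 1] by simp
  also have "\<dots> = x + shift i - 1"
    using False shift_bounds[of i] assms by (subst frac_eq) auto
  finally show ?thesis using False assms by (simp add: rot_def)
qed

lemma rot_range: "x \<in> {0..1} \<Longrightarrow> x \<noteq> 1 \<Longrightarrow> 0 \<le> rot i x \<and> rot i x < 1"
  by (simp add: rot_def frac_lt_1)

lemma in_translate: "x \<in> (+) c ` B \<longleftrightarrow> x - c \<in> B" for x c :: real and B
  by force

text \<open>A rotation is a translation on either side of the point that is carried to the origin.\<close>

lemma rot_vimage:
  assumes "A \<subseteq> {0..1}" and c: "c = - shift i" "d = 1 - shift i"
  shows "rot i -` A \<inter> {0..1} = ((+) c ` (A \<inter> {shift i..<1}) \<union> (+) d ` (A \<inter> {0..<shift i})) \<union> (A \<inter> {1})"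
proof (rule set_eqI)
  fix x :: real
  note a = shift_bounds[of i]
  have e: "x - c = x + shift i" "x - d = x + shift i - 1" by (simp_all add: c)
  show "x \<in> rot i -` A \<inter> {0..1} \<longleftrightarrow> x \<in> ((+) c ` (A \<inter> {shift i..<1}) \<union> (+) d ` (A \<inter> {0..<shift i})) \<union> (A \<inter> {1})"
    unfolding Un_iff in_translate e
  proof (cases "0 \<le> x \<and> x < 1")
    case True
    then show "x \<in> rot i -` A \<inter> {0..1} \<longleftrightarrow> (x + shift i \<in> A \<inter> {shift i..<1} \<or> x + shift i - 1 \<in> A \<inter> {0..<shift i}) \<or> x \<in> A \<inter> {1}"
      using a by (auto simp: rot_eq)
  next
    case False
    then show "x \<in> rot i -` A \<inter> {0..1} \<longleftrightarrow> (x + shift i \<in> A \<inter> {shift i..<1} \<or> x + shift i - 1 \<in> A \<inter> {0..<shift i}) \<or> x \<in> A \<inter> {1}"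
      using a by (auto simp: rot_def)
  qed
qed

lemma rot_vimage_sets:
  assumes A: "A \<in> sets I01"
  shows "rot i -` A \<inter> {0..1} \<in> sets I01" "measure I01 (rot i -` A \<inter> {0..1}) = measure I01 A"
proof -
  note a = shift_bounds[of i]
  obtain c d where c: "c = - shift i" "d = 1 - shift i" by blast
  have A': "A \<in> sets lebesgue" "A \<subseteq> {0..1}" using A by (auto simp: sets_I01)
  define P Q where "P = A \<inter> {shift i..<1}" and "Q = A \<inter> {0..<shift i}"
  have PQ: "P \<in> sets lebesgue" "Q \<in> sets lebesgue" "A \<inter> {1} \<in> sets lebesgue"
    using A' by (auto simp: P_def Q_def)
  have eq: "rot i -` A \<inter> {0..1} = ((+) c ` P \<union> (+) d ` Q) \<union> (A \<inter> {1})"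
    using rot_vimage[OF A'(2) c] by (simp add: P_def Q_def)
  have S: "(+) c ` P \<in> sets lebesgue" "(+) d ` Q \<in> sets lebesgue"
    using PQ by (auto intro: lebesgue_sets_translation)
  show "rot i -` A \<inter> {0..1} \<in> sets I01"
    unfolding sets_I01 by (rule conjI, subst eq, intro sets.Un S PQ) auto
  have lm: "B \<in> lmeasurable" if "B \<in> sets lebesgue" "B \<subseteq> {0..1}" for B :: "real set"
    by (rule bounded_set_imp_lmeasurable[OF bounded_subset[OF bounded_closed_interval that(2)] that(1)])
  have sub: "(+) c ` P \<subseteq> {0..1}" "(+) d ` Q \<subseteq> {0..1}" "A \<inter> {1} \<subseteq> {0..1}" "P \<subseteq> {0..1}" "Q \<subseteq> {0..1}"
    using a A' by (auto simp: P_def Q_def c)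
  note L = lm[OF S(1) sub(1)] lm[OF S(2) sub(2)] lm[OF PQ(3) sub(3)] lm[OF PQ(1) sub(4)] lm[OF PQ(2) sub(5)]
  have disj: "(+) c ` P \<inter> (+) d ` Q = {}" "((+) c ` P \<union> (+) d ` Q) \<inter> (A \<inter> {1}) = {}"
      "P \<inter> Q = {}" "(P \<union> Q) \<inter> (A \<inter> {1}) = {}"
    using a by (auto simp: P_def Q_def c)
  have add: "measure lebesgue (B \<union> C) = measure lebesgue B + measure lebesgue C"
    if "B \<in> lmeasurable" "C \<in> lmeasurable" "B \<inter> C = {}" for B C :: "real set"
    using measure_Un3[OF that(1,2)] that(3) by simp
  have "measure lebesgue (rot i -` A \<inter> {0..1}) = measure lebesgue P + measure lebesgue Q + measure lebesgue (A \<inter> {1})"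
    unfolding eq add[OF fmeasurable.Un[OF L(1,2)] L(3) disj(2)] add[OF L(1,2) disj(1)] measure_translation ..
  also have "\<dots> = measure lebesgue ((P \<union> Q) \<union> (A \<inter> {1}))"
    unfolding add[OF fmeasurable.Un[OF L(4,5)] L(3) disj(4)] add[OF L(4,5) disj(3)] ..
  also have "(P \<union> Q) \<union> (A \<inter> {1}) = A" using A' a by (auto simp: P_def Q_def)
  finally show "measure I01 (rot i -` A \<inter> {0..1}) = measure I01 A"
    using A' by (simp add: measure_I01)
qed

lemma measure_I01_single: "S \<subseteq> {0..1} \<Longrightarrow> measure I01 (S \<inter> {t}) = 0"
proof -
  assume S: "S \<subseteq> {0..1}"
  have "negligible (S \<inter> {t})" by (rule negligible_subset[of "{t}"]) auto
  then have "measure lebesgue (S \<inter> {t}) = 0" by (rule negligible_imp_measure0)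
  then show "measure I01 (S \<inter> {t}) = 0" using S by (subst measure_I01) auto
qed

lemma id_measurable_I01: "(\<lambda>x. x) \<in> borel_measurable I01"
  using id_borel_measurable_lebesgue_on[of "{0..1}"] by (simp add: id_def)

lemma rot_measurable [measurable]: "rot i \<in> I01 \<rightarrow>\<^sub>M I01"
proof (rule measurableI)
  show "rot i x \<in> space I01" if "x \<in> space I01" for x
    using rot_range[of x i] that by (cases "x = 1") (auto simp: rot_def)
qed (use rot_vimage_sets in auto)

lemma distr_rot: "distr I01 I01 (rot i) = I01"
proof (rule measure_eqI)
  fix A assume "A \<in> sets (distr I01 I01 (rot i))"
  then have A: "A \<in> sets I01" by simp
  show "emeasure (distr I01 I01 (rot i)) A = emeasure I01 A"
    using rot_vimage_sets(2)[OF A, of i]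
    by (subst emeasure_distr[OF rot_measurable A]) (simp add: I01.emeasure_eq_measure)
qed simp

lemma frac_frac_add: "frac (frac x + y) = frac (x + y)" for x y :: real
proof -
  have "frac x + y = x + y - of_int \<lfloor>x\<rfloor>" by (simp add: frac_def)
  then show ?thesis by (simp only: frac_diff_of_int)
qed

lemma rot_rot:
  assumes "x \<in> {0..1}"
  shows "rot i (rot j x) = (if x = 1 then 1 else frac (x + (shift i + shift j)))"
proof (cases "x = 1")
  case False
  then have "rot j x \<noteq> 1" using rot_range[OF assms False, of j] by simp
  then show ?thesis using False by (simp add: rot_def frac_frac_add add_ac)
qed (simp add: rot_def)

text \<open>The measure of the part of \<open>S\<close> to the left of \<open>t\<close> is additive under dyadic shifts and monotone in \<open>t\<close>, hence
  linear.  So \<open>S\<close> is independent of all rays, therefore of all Borel sets, therefore of itself.\<close>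

lemma rot_ergodic:
  assumes S: "S \<in> sets I01" and inv: "\<And>i x. x \<in> space I01 \<Longrightarrow> rot i x \<in> S \<longleftrightarrow> x \<in> S"
  shows "measure I01 S = 0 \<or> measure I01 S = 1"
proof -
  have S': "S \<in> sets lebesgue" "S \<subseteq> {0..1}" using S by (auto simp: sets_I01)
  define F where "F t = measure I01 (S \<inter> {0..<t})" for t
  define c where "c = measure I01 S"
  have Fm: "S \<inter> B \<in> sets I01" if "B \<in> sets lebesgue" for B using S' that by (auto simp: sets_I01)
  have F_mono: "F s \<le> F t" if "s \<le> t" for s t
    unfolding F_def using that by (intro I01.finite_measure_mono Fm) auto
  have F0: "F 0 = 0" by (simp add: F_def)
  have F1: "F 1 = c"
  proof -
    have "S = (S \<inter> {0..<1}) \<union> (S \<inter> {1})" using S' by auto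
    then have "c = measure I01 ((S \<inter> {0..<1}) \<union> (S \<inter> {1}))" unfolding c_def by simp
    also have "\<dots> = F 1 + measure I01 (S \<inter> {1})"
      unfolding F_def by (intro I01.finite_measure_Union Fm) auto
    also have "measure I01 (S \<inter> {1}) = 0"
      using S' by (intro measure_I01_single)
    finally show ?thesis by simp
  qed
  have F_add: "F (shift i + x) = F (shift i) + F x" if x: "0 \<le> x" "x \<le> 1 - shift i" for i x
  proof -
    define a where "a = shift i"
    have a: "0 < a" "a < 1" unfolding a_def by (rule shift_bounds)+
    have x': "x \<le> 1 - a" using x by (simp add: a_def)
    have "S \<inter> {0..<a + x} = (S \<inter> {0..<a}) \<union> (S \<inter> {a..<a + x})" using x a by auto
    then have "F (a + x) = measure I01 ((S \<inter> {0..<a}) \<union> (S \<inter> {a..<a + x}))" by (simp add: F_def)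
    also have "\<dots> = F a + measure I01 (S \<inter> {a..<a + x})"
      unfolding F_def by (intro I01.finite_measure_Union Fm) auto
    also have "measure I01 (S \<inter> {a..<a + x}) = measure I01 (rot i -` (S \<inter> {a..<a + x}) \<inter> {0..1})"
      by (rule rot_vimage_sets(2)[symmetric, OF Fm]) simp
    also have "rot i -` (S \<inter> {a..<a + x}) \<inter> {0..1} = S \<inter> {0..<x}"
    proof (rule set_eqI)
      fix y :: real
      show "y \<in> rot i -` (S \<inter> {a..<a + x}) \<inter> {0..1} \<longleftrightarrow> y \<in> S \<inter> {0..<x}"
      proof (cases "0 \<le> y \<and> y < 1")
        case True
        then have "rot i y \<in> {a..<a + x} \<longleftrightarrow> y \<in> {0..<x}"
          using a x(1) x' by (auto simp: rot_eq a_def[symmetric])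
        then show ?thesis using True inv[of y i] by auto
      next
        case False
        then show ?thesis using a x(1) x' S' by (auto simp: rot_def)
      qed
    qed
    finally show ?thesis by (simp add: F_def a_def)
  qed
  have F_dyadic: "F (real k / 2 ^ Suc i) = c * (real k / 2 ^ Suc i)" if "k \<le> 2 ^ Suc i" for k i
  proof -
    have *: "F (real k / 2 ^ Suc i) = real k * F (1 / 2 ^ Suc i)" if "k \<le> 2 ^ Suc i" for k
      using that
    proof (induction k)
      case (Suc k)
      have "real (Suc k) \<le> real (2 ^ Suc i)" using Suc.prems by (simp only: of_nat_le_iff)
      then have "real (Suc k) / 2 ^ Suc i \<le> 1" by (simp only: of_nat_power of_nat_numeral) (simp add: divide_le_eq)
      then have "shift i + real k / 2 ^ Suc i \<le> 1" by (simp add: shift_def add_divide_distrib)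
      then have "F (shift i + real k / 2 ^ Suc i) = F (shift i) + F (real k / 2 ^ Suc i)"
        by (intro F_add) auto
      moreover have "real (Suc k) / 2 ^ Suc i = shift i + real k / 2 ^ Suc i"
        by (simp add: shift_def add_divide_distrib)
      ultimately show ?case using Suc by (simp add: shift_def algebra_simps del: power_Suc)
    qed (simp add: F0)
    have "c = 2 ^ Suc i * F (1 / 2 ^ Suc i)" using *[of "2 ^ Suc i"] F1 by simp
    then show ?thesis using *[OF that] by simp
  qed
  have F_lin: "F t = c * t" if t: "0 \<le> t" "t \<le> 1" for t
  proof (cases "t = 1")
    case False
    have c0: "0 \<le> c" by (simp add: c_def)
    have bound: "\<bar>F t - c * t\<bar> \<le> c * (1/2) ^ i" for i
    proof -
      define k where "k = nat \<lfloor>t * 2 ^ Suc i\<rfloor>"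
      have k: "real k \<le> t * 2 ^ Suc i" "t * 2 ^ Suc i < real k + 1"
        unfolding k_def using t by (auto simp: of_nat_nat)
      have "t * 2 ^ Suc i < 2 ^ Suc i" using t False by simp
      then have "real k < real (2 ^ Suc i)" using k(1) unfolding of_nat_power of_nat_numeral by linarith
      then have k2: "Suc k \<le> 2 ^ Suc i" by (simp only: of_nat_less_iff Suc_le_eq)
      have t1: "real k / 2 ^ Suc i \<le> t" "t \<le> real (Suc k) / 2 ^ Suc i"
        using k by (auto simp: divide_le_eq le_divide_eq mult.commute)
      have lo: "c * (real k / 2 ^ Suc i) \<le> F t" using F_mono[OF t1(1)] F_dyadic[of k i] k2 by simp
      have up: "F t \<le> c * (real (Suc k) / 2 ^ Suc i)" using F_mono[OF t1(2)] F_dyadic[OF k2] by simp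
      have "c * (real (Suc k) / 2 ^ Suc i) = c * (real k / 2 ^ Suc i) + c * (1 / 2 ^ Suc i)"
        by (simp add: algebra_simps add_divide_distrib)
      moreover have "c * (real k / 2 ^ Suc i) \<le> c * t" "c * t \<le> c * (real (Suc k) / 2 ^ Suc i)"
        by (rule mult_left_mono[OF t1(1) c0], rule mult_left_mono[OF t1(2) c0])
      moreover have "c * (1 / 2 ^ Suc i) \<le> c * (1/2) ^ i"
        using c0 by (intro mult_left_mono) (auto simp: power_divide field_simps)
      ultimately show ?thesis using lo up by linarith
    qed
    have "(\<lambda>i. c * (1/2) ^ i) \<longlonglongrightarrow> c * 0" by (intro tendsto_intros LIMSEQ_power_zero) simp
    then have "\<bar>F t - c * t\<bar> \<le> 0" using LIMSEQ_le_const[of "\<lambda>i. c * (1/2) ^ i" 0 "\<bar>F t - c * t\<bar>"] bound by simp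
    then show ?thesis by simp
  qed (simp add: F1)
  \<comment> \<open>Independence of the rays, expressed as equality of two finite Borel measures.\<close>
  define \<mu> where "\<mu> = distr (density I01 (indicator S)) borel (\<lambda>x. x)"
  define \<nu> where "\<nu> = distr (density I01 (\<lambda>_. ennreal c)) borel (\<lambda>x. x)"
  have Sm: "S \<in> sets I01" by fact
  have \<mu>: "emeasure \<mu> A = ennreal (measure I01 (S \<inter> (A \<inter> {0..1})))" if A: "A \<in> sets borel" for A
  proof -
    have A1: "A \<inter> {0..1} \<in> sets I01" using A by (auto simp: sets_I01)
    have "emeasure \<mu> A = emeasure (density I01 (indicator S)) (A \<inter> {0..1})"
      unfolding \<mu>_def using A id_measurable_I01 by (subst emeasure_distr) auto
    also have "\<dots> = (\<integral>\<^sup>+x. indicator S x * indicator (A \<inter> {0..1}) x \<partial>I01)"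
      using Sm A1 by (subst emeasure_density) auto
    also have "\<dots> = (\<integral>\<^sup>+x. indicator (S \<inter> (A \<inter> {0..1})) x \<partial>I01)"
      by (intro nn_integral_cong) (auto simp: indicator_def)
    also have "\<dots> = emeasure I01 (S \<inter> (A \<inter> {0..1}))" using Sm A1 by simp
    finally show ?thesis by (simp add: I01.emeasure_eq_measure)
  qed
  have \<nu>: "emeasure \<nu> A = ennreal (c * measure I01 (A \<inter> {0..1}))" if A: "A \<in> sets borel" for A
  proof -
    have A1: "A \<inter> {0..1} \<in> sets I01" using A by (auto simp: sets_I01)
    have "emeasure \<nu> A = emeasure (density I01 (\<lambda>_. ennreal c)) (A \<inter> {0..1})"
      unfolding \<nu>_def using A id_measurable_I01 by (subst emeasure_distr) auto
    also have "\<dots> = ennreal c * emeasure I01 (A \<inter> {0..1})"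
      using A1 by (simp add: emeasure_density_const)
    finally show ?thesis by (simp add: I01.emeasure_eq_measure ennreal_mult c_def)
  qed
  have ray: "measure I01 (S \<inter> ({t<..} \<inter> {0..1})) = c * measure I01 ({t<..} \<inter> {0..1})" for t
  proof -
    consider "t < 0" | "0 \<le> t" "t \<le> 1" | "1 < t" by linarith
    then show ?thesis
    proof cases
      case 1
      then have "{t<..} \<inter> {0..1} = {0..1}" "S \<inter> {0..1} = S" using S' by auto
      then show ?thesis using I01.prob_space by (simp add: c_def)
    next
      case 2
      have sing: "measure I01 (S \<inter> {t}) = 0"
        using S' by (intro measure_I01_single)
      have "S = (S \<inter> {0..<t}) \<union> ((S \<inter> {t}) \<union> (S \<inter> ({t<..} \<inter> {0..1})))" using S' by auto
      then have "c = measure I01 ((S \<inter> {0..<t}) \<union> ((S \<inter> {t}) \<union> (S \<inter> ({t<..} \<inter> {0..1}))))"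
        unfolding c_def by simp
      also have "\<dots> = F t + measure I01 ((S \<inter> {t}) \<union> (S \<inter> ({t<..} \<inter> {0..1})))"
        unfolding F_def by (intro I01.finite_measure_Union Fm sets.Un) auto
      also have "measure I01 ((S \<inter> {t}) \<union> (S \<inter> ({t<..} \<inter> {0..1}))) = measure I01 (S \<inter> ({t<..} \<inter> {0..1}))"
        using sing by (subst I01.finite_measure_Union) (auto intro!: Fm)
      finally have "measure I01 (S \<inter> ({t<..} \<inter> {0..1})) = c - c * t" using F_lin[OF 2] by simp
      moreover have "measure I01 ({t<..} \<inter> {0..1}) = 1 - t"
      proof -
        have "{t<..} \<inter> {0..1} = {t<..1}" "{t<..1} \<subseteq> {0..1}" using 2 by auto
        moreover have "measure lebesgue {t<..1} = 1 - t" using 2 by simp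
        ultimately show ?thesis using measure_I01[of "{t<..1}"] by simp
      qed
      ultimately show ?thesis by (simp only: right_diff_distrib mult_1_right)
    next
      case 3
      then have "{t<..} \<inter> {0..1} = {}" by auto
      then show ?thesis by simp
    qed
  qed
  have eq: "\<mu> = \<nu>"
  proof (rule measure_eqI_lessThan)
    show "sets \<mu> = sets borel" "sets \<nu> = sets borel" by (simp_all add: \<mu>_def \<nu>_def)
    show "emeasure \<mu> {x<..} < \<infinity>" for x by (simp add: \<mu>)
    show "emeasure \<mu> {x<..} = emeasure \<nu> {x<..}" for x by (simp add: \<mu> \<nu> ray)
  qed
  obtain C T where C: "fsigma C" and T: "negligible T" and CT: "C \<union> T = S" "disjnt C T"
    using lebesgue_set_almost_fsigma[OF S'(1)] by (auto simp: negligible_iff_null_sets)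
  have Cb: "C \<in> sets borel" using C by (cases rule: fsigma.cases) auto
  have CS: "C \<subseteq> S" using CT by auto
  have "measure I01 S = measure I01 C"
  proof -
    have "measure lebesgue S = measure lebesgue C"
    proof (rule measure_negligible_symdiff)
      have "C \<subseteq> {0..1}" using CS S' by auto
      then have "bounded C" by (rule bounded_subset[OF bounded_closed_interval])
      then show "C \<in> lmeasurable" using Cb by (intro bounded_set_imp_lmeasurable) auto
      show "negligible (C - S \<union> (S - C))" using T CT by (auto intro: negligible_subset)
    qed
    then show ?thesis using S' CS by (simp add: measure_I01)
  qed
  moreover have "measure I01 (S \<inter> (C \<inter> {0..1})) = c * measure I01 (C \<inter> {0..1})"
    using \<mu>[OF Cb] \<nu>[OF Cb] eq by (simp add: c_def)
  moreover have "S \<inter> (C \<inter> {0..1}) = C" "C \<inter> {0..1} = C" using CS S' by auto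
  ultimately have "c = c * c" by (simp add: c_def)
  then show ?thesis by (auto simp: c_def)
qed

text \<open>The function \<open>x \<mapsto> frac (2\<^bsup>i\<^esup> x)\<close> is invariant under the first \<open>i\<close> rotations.  Dividing its range into \<open>2\<^bsup>m\<^esup>\<close>
  intervals gives sets that are permuted cyclically by a later rotation, so they have equal measure.  The
  end point \<open>1\<close>, which the rotations fix, gets a class of its own.\<close>

lemma rot_fine_partition:
  assumes "0 < e"
  shows "\<exists>n. \<exists>J \<in> I01 \<rightarrow>\<^sub>M count_space UNIV.
          (\<forall>x\<in>space I01. J x < n \<and> (\<forall>j<i. J (rot j x) = J x)) \<and>
          (\<forall>k<n. measure I01 {x\<in>space I01. J x = (k::nat)} < e)"
proof -
  obtain m where m: "(1/2 :: real) ^ m < e" using real_arch_pow_inv[OF assms, of "1/2"] by auto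
  define q :: "real \<Rightarrow> real" where "q x = frac (2 ^ i * x)" for x
  define J where "J x = (if x = 1 then 2 ^ m else nat \<lfloor>2 ^ m * q x\<rfloor>)" for x :: real
  have qm [measurable]: "q \<in> borel_measurable I01"
  proof -
    have "(\<lambda>y::real. frac y) \<in> borel_measurable borel" unfolding frac_def by measurable
    then show ?thesis unfolding q_def[abs_def]
      by (rule measurable_compose[rotated]) (intro borel_measurable_times borel_measurable_const id_measurable_I01)
  qed
  have Jm [measurable]: "J \<in> I01 \<rightarrow>\<^sub>M count_space UNIV"
  proof -
    have nf: "(\<lambda>y::real. nat \<lfloor>y\<rfloor>) \<in> borel \<rightarrow>\<^sub>M count_space UNIV" by measurable
    have "(\<lambda>x. nat \<lfloor>2 ^ m * q x\<rfloor>) \<in> I01 \<rightarrow>\<^sub>M count_space UNIV"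
      by (rule measurable_compose[OF _ nf]) (intro borel_measurable_times borel_measurable_const qm)
    then show ?thesis unfolding J_def[abs_def]
      by (intro measurable_If measurable_const) (auto simp: sets_I01 simp flip: Int_def)
  qed
  have q01: "0 \<le> q x" "q x < 1" for x by (auto simp: q_def frac_lt_1)
  have q_rot: "q (rot j x) = frac (q x + 2 ^ i * shift j)" if "x \<noteq> 1" for j x
  proof -
    have "2 ^ i * rot j x = (2 ^ i * x + 2 ^ i * shift j) - of_int (2 ^ i * \<lfloor>x + shift j\<rfloor>)"
      using that by (simp add: rot_def frac_def algebra_simps)
    then have "q (rot j x) = frac (2 ^ i * x + 2 ^ i * shift j)" unfolding q_def by (simp only: frac_diff_of_int)
    then show ?thesis by (simp add: q_def frac_frac_add)
  qed
  have rot1: "rot j x = 1 \<longleftrightarrow> x = 1" if "x \<in> {0..1}" for j x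
    using rot_range[OF that, of j] by (auto simp: rot_def)
  have inv: "J (rot j x) = J x" if x: "x \<in> {0..1}" and j: "j < i" for j x
  proof (cases "x = 1")
    case False
    have "(2::real) ^ i * shift j = of_int (2 ^ (i - Suc j))"
    proof -
      obtain n where "i = Suc j + n" using j le_Suc_ex[of "Suc j" i] by auto
      then show ?thesis by (simp add: shift_def power_add)
    qed
    then have "q (rot j x) = frac (q x)" unfolding q_rot[OF False] by (simp only: frac_add_of_int)
    then have "q (rot j x) = q x" using q01 by (simp add: frac_eq)
    then show ?thesis using False rot1[OF x] by (simp add: J_def)
  qed (simp add: rot_def)
  have floor_lt: "nat \<lfloor>2 ^ m * q x\<rfloor> < 2 ^ m" for x
  proof -
    have "0 \<le> \<lfloor>2 ^ m * q x\<rfloor>" using q01[of x] by simp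
    moreover have "\<lfloor>2 ^ m * q x\<rfloor> < int (2 ^ m)" using q01[of x] by (simp add: floor_less_iff)
    ultimately show ?thesis using nat_less_iff by blast
  qed
  have Jlt: "J x < 2 ^ m + 1" for x
  proof (cases "x = 1")
    case False
    then have "J x = nat \<lfloor>2 ^ m * q x\<rfloor>" by (simp only: J_def if_False)
    then show ?thesis using trans_less_add1[OF floor_lt[of x], of 1] by (simp only:)
  qed (simp add: J_def)
  define E where "E k = {x \<in> space I01. J x = k}" for k
  have Em [measurable]: "E k \<in> sets I01" for k unfolding E_def by measurable
  have step: "measure I01 (E (Suc k)) = measure I01 (E k)" if k: "Suc k < 2 ^ m" for k
  proof -
    have m0: "0 < m" using k by (cases m) auto
    define j where "j = i + m - 1"
    have sj: "Suc j = i + m" using m0 by (simp add: j_def)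
    have "rot j -` E (Suc k) \<inter> {0..1} = E k"
    proof (rule set_eqI)
      fix x :: real
      show "x \<in> rot j -` E (Suc k) \<inter> {0..1} \<longleftrightarrow> x \<in> E k"
      proof (cases "x \<in> {0..1} \<and> x \<noteq> 1")
        case True
        then have x: "x \<in> {0..1}" "x \<noteq> 1" by auto
        have r: "rot j x \<in> {0..1}" "rot j x \<noteq> 1" using rot_range[OF x, of j] by auto
        have pm: "(0::real) < 2 ^ m" by simp
        have qr: "q (rot j x) = frac (q x + 1 / 2 ^ m)" unfolding q_rot[OF x(2)] shift_def sj by (simp add: power_add)
        have "nat \<lfloor>2 ^ m * q (rot j x)\<rfloor> = Suc k \<longleftrightarrow> nat \<lfloor>2 ^ m * q x\<rfloor> = k"
        proof (cases "q x + 1 / 2 ^ m < 1")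
          case True
          then have "q (rot j x) = q x + 1 / 2 ^ m" unfolding qr using q01[of x] by (subst frac_eq) auto
          then have "2 ^ m * q (rot j x) = 2 ^ m * q x + 1" by (simp add: algebra_simps)
          then have "\<lfloor>2 ^ m * q (rot j x)\<rfloor> = \<lfloor>2 ^ m * q x\<rfloor> + 1" by simp
          moreover have "nat (a + 1) = Suc (nat a)" if "0 \<le> a" for a :: int using that by simp
          moreover have "0 \<le> \<lfloor>2 ^ m * q x\<rfloor>" using q01[of x] by simp
          ultimately show ?thesis by (simp only: nat.inject)
        next
          case False
          have p1: "1 / 2 ^ m \<le> (1::real)" by (simp add: divide_le_eq)
          have "0 \<le> q x + 1 / 2 ^ m - 1" "q x + 1 / 2 ^ m - 1 < 1" using False q01[of x] p1 by linarith+
          then have "frac (q x + 1 / 2 ^ m - 1) = q x + 1 / 2 ^ m - 1" by (simp only: frac_eq)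
          then have fr: "frac (q x + 1 / 2 ^ m) = q x + 1 / 2 ^ m - 1"
            using frac_diff_of_int[of "q x + 1 / 2 ^ m" 1] by (simp only: of_int_1)
          have "2 ^ m * q (rot j x) = 2 ^ m * q x + 1 - 2 ^ m"
            unfolding qr fr by (simp add: right_diff_distrib distrib_left)
          moreover have "2 ^ m * q x < 2 ^ m" using q01[of x] by simp
          ultimately have "2 ^ m * q (rot j x) < 1" by linarith
          then have "\<lfloor>2 ^ m * q (rot j x)\<rfloor> < 1" by (simp add: floor_less_iff)
          then have a: "nat \<lfloor>2 ^ m * q (rot j x)\<rfloor> \<noteq> Suc k" by auto
          have "2 ^ m - 1 \<le> 2 ^ m * q x" using False pm by (simp add: field_simps)
          then have "2 ^ m - 1 \<le> \<lfloor>2 ^ m * q x\<rfloor>" by (simp add: le_floor_iff)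
          moreover have "int (Suc k) < 2 ^ m" using k by (metis of_nat_less_iff of_nat_numeral of_nat_power)
          ultimately have "nat \<lfloor>2 ^ m * q x\<rfloor> \<noteq> k" by auto
          then show ?thesis using a by simp
        qed
        then show ?thesis using x r by (simp add: E_def J_def)
      next
        case False
        then show ?thesis using k by (auto simp: E_def J_def rot_def)
      qed
    qed
    then show ?thesis using rot_vimage_sets(2)[OF Em, of j "Suc k"] by simp
  qed
  have const: "measure I01 (E k) = measure I01 (E 0)" if "k < 2 ^ m" for k
    using that by (induction k) (auto simp: step)
  have "2 ^ m * measure I01 (E 0) = (\<Sum>k<(2::nat) ^ m. measure I01 (E 0))" by simp
  also have "\<dots> = (\<Sum>k<2 ^ m. measure I01 (E k))"
    by (rule sum.cong[OF refl]) (rule const[symmetric], simp)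
  also have "\<dots> = measure I01 (\<Union>k<2 ^ m. E k)"
  proof (rule I01.finite_measure_finite_Union[symmetric])
    show "disjoint_family_on E {..<2 ^ m}" by (auto simp: disjoint_family_on_def E_def)
  qed (use Em in auto)
  also have "\<dots> \<le> 1" by (rule I01.prob_le_1)
  finally have "measure I01 (E 0) \<le> (1/2) ^ m" by (simp add: power_divide field_simps)
  then have small: "measure I01 (E k) < e" if "k < 2 ^ m" for k using const[OF that] m by simp
  have last: "measure I01 (E (2 ^ m)) = 0"
  proof -
    have "E (2 ^ m) \<subseteq> {1}"
    proof
      fix x assume "x \<in> E (2 ^ m)"
      then have "J x = 2 ^ m" by (simp add: E_def)
      moreover have "nat \<lfloor>2 ^ m * q x\<rfloor> < 2 ^ m" by (rule floor_lt)
      ultimately show "x \<in> {1}" by (auto simp: J_def split: if_splits)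
    qed
    moreover have "{1} \<in> sets I01" by (simp add: sets_I01)
    ultimately have "measure I01 (E (2 ^ m)) \<le> measure I01 {1}" by (rule I01.finite_measure_mono)
    also have "measure I01 {1} = 0" by (simp add: measure_I01)
    finally show ?thesis by (simp add: measure_le_0_iff)
  qed
  have all: "measure I01 {x\<in>space I01. J x = k} < e" if "k < 2 ^ m + 1" for k
  proof (cases "k = 2 ^ m")
    case True
    then show ?thesis using last assms by (simp add: E_def)
  next
    case False
    then show ?thesis using small[of k] that by (simp add: E_def)
  qed
  show ?thesis
    by (rule exI[of _ "2 ^ m + 1"], rule bexI[OF _ Jm]) (use Jlt inv all in auto)
qed

lemma mean_tower_rot:
  assumes "\<And>i. 0 < d i" "summable d" "summable (\<lambda>i. real i * d i)"
  shows "mean_tower I01 rot d"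
proof
  show "distr I01 I01 (rot i) = I01" for i by (rule distr_rot)
  show "rot i (rot j x) = rot j (rot i x)" if "x \<in> space I01" for i j x
    using that by (simp add: rot_rot add.commute)
  show "rot 0 (rot 0 x) = x" if "x \<in> space I01" for x
  proof (cases "x = 1")
    case False
    then have "frac (x + 1) = x" using that by (simp add: frac_eq frac_1_eq)
    then show ?thesis using that False by (subst rot_rot) (auto simp: shift_double)
  qed (simp add: rot_def)
  show "rot (Suc i) (rot (Suc i) x) = rot i x" if "x \<in> space I01" for i x
    using that by (subst rot_rot) (auto simp: rot_def shift_double)
qed (use assms rot_ergodic rot_fine_partition in auto)


section \<open>Splitting functions along tail sets\<close>

context mean_tower begin

text \<open>Absolute continuity of the integral.\<close>

lemma N_restrict_small:
  fixes y :: "'a \<Rightarrow> 'b::{banach, second_countable_topology}"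
  assumes y: "integrable M y" and e: "0 < e"
  shows "\<exists>d>0. \<forall>A\<in>sets M. prob A < d \<longrightarrow> N (\<lambda>x. if x \<in> A then y x else 0) < e"
proof -
  have [measurable]: "y \<in> borel_measurable M" using y by simp
  have k: "0 < \<kappa> 0" using \<kappa>_ge_1[of 0] by linarith
  have "(\<lambda>n. \<integral>x. norm (y x) * indicator {x \<in> space M. real n < norm (y x)} x \<partial>M) \<longlonglongrightarrow> (\<integral>x. 0 \<partial>M)"
  proof (rule integral_dominated_convergence)
    show "integrable M (\<lambda>x. norm (y x))" using y by simp
    show "AE x in M. (\<lambda>n. norm (y x) * indicator {x \<in> space M. real n < norm (y x)} x) \<longlonglongrightarrow> 0"
    proof (rule AE_I2)
      fix x
      obtain m :: nat where m: "norm (y x) < m" using reals_Archimedean2 by blast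
      have "\<forall>\<^sub>F n in sequentially. norm (y x) * indicator {x \<in> space M. real n < norm (y x)} x = 0"
        using eventually_ge_at_top[of m] by eventually_elim (use m in \<open>auto simp: indicator_def\<close>)
      then show "(\<lambda>n. norm (y x) * indicator {x \<in> space M. real n < norm (y x)} x) \<longlonglongrightarrow> 0"
        by (rule tendsto_eventually)
    qed
    show "AE x in M. norm (norm (y x) * indicator {x \<in> space M. real n < norm (y x)} x) \<le> norm (y x)" for n
      by (auto simp: indicator_def)
  qed measurable
  then have "\<forall>\<^sub>F n in sequentially. (\<integral>x. norm (y x) * indicator {x \<in> space M. real n < norm (y x)} x \<partial>M) < e / (2 * \<kappa> 0)"
    using e k by (intro order_tendstoD(2)) auto
  then obtain n where n: "(\<integral>x. norm (y x) * indicator {x \<in> space M. real n < norm (y x)} x \<partial>M) < e / (2 * \<kappa> 0)"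
    using eventually_happens'[OF sequentially_bot] by blast
  let ?L = "{x \<in> space M. real n < norm (y x)}"
  define d where "d = e / (2 * \<kappa> 0 * (real n + 1))"
  have d: "0 < d" using e k by (simp add: d_def)
  have "N (\<lambda>x. if x \<in> A then y x else 0) < e" if A [measurable]: "A \<in> sets M" and small: "prob A < d" for A
  proof -
    have yA: "integrable M (\<lambda>x. if x \<in> A then y x else 0)"
      by (rule Bochner_Integration.integrable_bound[OF y]) auto
    have IA: "integrable M (\<lambda>x. real n * indicator A x)"
      by (intro integrable_mult_right integrable_real_indicator A) (simp add: emeasure_eq_measure)
    have IL: "integrable M (\<lambda>x. norm (y x) * indicator ?L x)"
      by (rule Bochner_Integration.integrable_bound[OF y]) (auto simp: indicator_def)
    have "(\<integral>x. norm (if x \<in> A then y x else 0) \<partial>M) \<le> (\<integral>x. real n * indicator A x + norm (y x) * indicator ?L x \<partial>M)"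
    proof (rule integral_mono)
      show "integrable M (\<lambda>x. real n * indicator A x + norm (y x) * indicator ?L x)" using IA IL by simp
      show "norm (if x \<in> A then y x else 0) \<le> real n * indicator A x + norm (y x) * indicator ?L x" if "x \<in> space M" for x
        using that by (auto simp: indicator_def)
    qed (use yA in simp)
    also have "\<dots> = real n * prob A + (\<integral>x. norm (y x) * indicator ?L x \<partial>M)"
      using IA IL A by simp
    also have "\<dots> < e / (2 * \<kappa> 0) + e / (2 * \<kappa> 0)"
    proof (rule add_le_less_mono[OF _ n])
      have "real n * prob A \<le> (real n + 1) * d" using small by (intro mult_mono) auto
      also have "(real n + 1) * d = e / (2 * \<kappa> 0)"
      proof -
        have "a * (e / (2 * \<kappa> 0 * a)) = e / (2 * \<kappa> 0)" if "0 < a" for a using that by simp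
        then show ?thesis unfolding d_def by simp
      qed
      finally show "real n * prob A \<le> e / (2 * \<kappa> 0)" .
    qed
    also have "\<dots> = e / \<kappa> 0" by simp
    finally have "\<kappa> 0 * (\<integral>x. norm (if x \<in> A then y x else 0) \<partial>M) < e" using k by (simp add: field_simps)
    then show ?thesis using N_le_L1[OF yA] by linarith
  qed
  then show ?thesis using d by blast
qed

lemma Nl_pieces:
  fixes f :: "'a \<Rightarrow> 'b::{banach, second_countable_topology}"
  assumes f: "integrable M f" and J: "J \<in> M \<rightarrow>\<^sub>M count_space UNIV"
    and Jn: "\<And>x. x \<in> space M \<Longrightarrow> J x < n" and inv: "\<And>x j. x \<in> space M \<Longrightarrow> j < i \<Longrightarrow> J (\<tau> j x) = J x"
  shows "(\<Sum>k<n::nat. Nl i (\<lambda>x. if J x = k then f x else 0)) = Nl i f"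
proof -
  have [measurable]: "J \<in> M \<rightarrow>\<^sub>M count_space UNIV" "f \<in> borel_measurable M" using J f by auto
  have G: "G i (\<lambda>x. if J x = k then f x else 0) x = (if J x = k then G i f x else 0)" if "x \<in> space M" for k x
    using G_restrict[of x i "{x. J x = k}" f] that inv by simp
  have I: "integrable M (\<lambda>x. if J x = k then G i f x else 0)" for k
    by (rule Bochner_Integration.integrable_bound[OF G_integrable[OF f, of i]]) auto
  have "(\<Sum>k<n. Nl i (\<lambda>x. if J x = k then f x else 0)) = (\<Sum>k<n. \<integral>x. (if J x = k then G i f x else 0) \<partial>M)"
    unfolding Nl_def by (intro sum.cong refl Bochner_Integration.integral_cong) (auto simp: G)
  also have "\<dots> = (\<integral>x. (\<Sum>k<n. if J x = k then G i f x else 0) \<partial>M)"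
    by (rule Bochner_Integration.integral_sum[symmetric]) (rule I)
  also have "\<dots> = Nl i f"
    unfolding Nl_def by (intro Bochner_Integration.integral_cong) (auto simp: Jn)
  finally show ?thesis .
qed

text \<open>On invariant sets for the first \<open>i\<close> maps the \<open>i\<close>-th norm is additive, and it differs from \<open>N\<close> by a factor
  of at most \<open>\<kappa> i\<close>.\<close>

lemma almost_additive_pieces:
  fixes y :: "'a \<Rightarrow> 'b::{banach, second_countable_topology}"
  assumes y: "integrable M y" and e: "0 < e"
  obtains n :: nat and J where "J \<in> M \<rightarrow>\<^sub>M count_space UNIV" "\<And>x. x \<in> space M \<Longrightarrow> J x < n"
    "\<And>f :: 'a \<Rightarrow> 'b. integrable M f \<Longrightarrow> (\<Sum>k<n. N (\<lambda>x. if J x = k then f x else 0)) \<le> (1 + e) * N f"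
    "\<And>k. k < n \<Longrightarrow> N (\<lambda>x. if J x = k then y x else 0) < e"
proof -
  have "\<forall>\<^sub>F i in sequentially. \<kappa> i < 1 + e" using e by (intro order_tendstoD(2)[OF \<kappa>_tendsto]) simp
  then obtain i where i: "\<kappa> i < 1 + e" using eventually_happens'[OF sequentially_bot] by blast
  obtain d where d: "0 < d" "\<And>A. A \<in> sets M \<Longrightarrow> prob A < d \<Longrightarrow> N (\<lambda>x. if x \<in> A then y x else 0) < e"
    using N_restrict_small[OF y e] by blast
  obtain n J where J: "J \<in> M \<rightarrow>\<^sub>M count_space UNIV" and Jx: "\<forall>x\<in>space M. J x < n \<and> (\<forall>j<i. J (\<tau> j x) = J x)"
    and small: "\<forall>k<n. prob {x\<in>space M. J x = (k::nat)} < d"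
    using fine_partition[OF d(1), of i] by blast
  note [measurable] = J
  show thesis
  proof (rule that[OF J])
    show "J x < n" if "x \<in> space M" for x using Jx that by blast
    show "(\<Sum>k<n. N (\<lambda>x. if J x = k then f x else 0)) \<le> (1 + e) * N f" if f: "integrable M f" for f :: "'a \<Rightarrow> 'b"
    proof -
      have [measurable]: "f \<in> borel_measurable M" using f by simp
      have fk: "integrable M (\<lambda>x. if J x = k then f x else 0)" for k
        by (rule Bochner_Integration.integrable_bound[OF f]) auto
      have "(\<Sum>k<n. N (\<lambda>x. if J x = k then f x else 0)) \<le> (\<Sum>k<n. \<kappa> i * Nl i (\<lambda>x. if J x = k then f x else 0))"
        by (intro sum_mono N_le_\<kappa> fk)
      also have "\<dots> = \<kappa> i * Nl i f"
        using Nl_pieces[OF f J, of n i] Jx by (simp add: sum_distrib_left[symmetric])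
      also have "\<dots> \<le> (1 + e) * N f"
        using i e Nl_le_N[OF f, of i] Nl_nonneg[OF f, of i] by (intro mult_mono) auto
      finally show ?thesis .
    qed
    show "N (\<lambda>x. if J x = k then y x else 0) < e" if k: "k < n" for k
    proof -
      have [measurable]: "y \<in> borel_measurable M" using y by simp
      have yk: "integrable M (\<lambda>x. if J x = k then y x else 0)" "integrable M (\<lambda>x. if x \<in> {x \<in> space M. J x = k} then y x else 0)"
        by (rule Bochner_Integration.integrable_bound[OF y]; auto)+
      have "N (\<lambda>x. if J x = k then y x else 0) = N (\<lambda>x. if x \<in> {x \<in> space M. J x = k} then y x else 0)"
        by (rule N_cong_AE[OF yk]) auto
      also have "\<dots> < e" using small k by (intro d(2)) auto
      finally show ?thesis .
    qed
  qed
qed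

text \<open>The functional \<open>grad z\<close> in a form that is linear over the scalar field: multiplication by the inverse of
  \<open>sgn (z x)\<close> is multiplication by its conjugate.\<close>

definition norming_functional :: "('a \<Rightarrow> 'b) \<Rightarrow> ('a \<Rightarrow> 'b) \<Rightarrow> 'b::{real_normed_field, euclidean_space}" where
  "norming_functional z y = (\<integral>x. y x * (inverse (sgn (z x)) * of_real (V 0 z x)) \<partial>M)"

context
  fixes y z :: "'a \<Rightarrow> 'b::{real_normed_field, euclidean_space}"
  assumes y: "integrable M y" and z: "integrable M z"
begin

lemma norm_norming_integrand:
  "AE x in M. norm (y x * (inverse (sgn (z x)) * of_real (V 0 z x))) \<le> norm (y x) * V 0 z x"
  using AE_tame[OF z]
proof eventually_elim
  case (elim x)
  have "norm (inverse (sgn (z x))) \<le> 1" by (simp add: norm_inverse norm_sgn)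
  moreover have "0 \<le> V 0 z x" by (rule V_bounds[OF elim])
  ultimately have "norm (y x) * (norm (inverse (sgn (z x))) * V 0 z x) \<le> norm (y x) * (1 * V 0 z x)"
    by (intro mult_left_mono mult_right_mono) auto
  then show ?case using \<open>0 \<le> V 0 z x\<close> by (simp add: norm_mult)
qed

lemma integrable_norming: "integrable M (\<lambda>x. y x * (inverse (sgn (z x)) * of_real (V 0 z x)))"
proof (rule Bochner_Integration.integrable_bound[OF integrable_norm_V[OF y z]])
  have [measurable]: "z \<in> borel_measurable M" "y \<in> borel_measurable M" using y z by auto
  show "(\<lambda>x. y x * (inverse (sgn (z x)) * of_real (V 0 z x))) \<in> borel_measurable M" by measurable
  show "AE x in M. norm (y x * (inverse (sgn (z x)) * of_real (V 0 z x))) \<le> norm (norm (y x) * V 0 z x)"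
    using norm_norming_integrand by eventually_elim auto
qed

lemma norm_norming_functional: "norm (norming_functional z y) \<le> N y"
proof -
  have "norm (norming_functional z y) \<le> (\<integral>x. norm (y x) * V 0 z x \<partial>M)"
    unfolding norming_functional_def
    by (rule order_trans[OF integral_norm_bound integral_mono_AE[OF integrable_norm[OF integrable_norming]
            integrable_norm_V[OF y z] norm_norming_integrand]])
  also have "\<dots> \<le> N y" using integral_GV_le[OF y z, of 0] by simp
  finally show ?thesis .
qed

end

lemma norming_functional_self:
  fixes z :: "'a \<Rightarrow> 'b::{real_normed_field, euclidean_space}"
  assumes z: "integrable M z"
  shows "norming_functional z z = of_real (N z)"
proof -
  have "a * inverse (sgn a) = of_real (norm a)" for a :: 'b
    by (cases "a = 0") (simp_all add: sgn_div_norm scaleR_conv_of_real)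
  then have "norming_functional z z = (\<integral>x. of_real (norm (z x) * V 0 z x) \<partial>M)"
    unfolding norming_functional_def by (simp add: mult.assoc[symmetric])
  also have "\<dots> = of_real (\<integral>x. norm (z x) * V 0 z x \<partial>M)"
    by (rule integral_of_real[OF integrable_norm_V[OF z z]])
  finally show ?thesis using integral_GV_self[OF z, of 0] by simp
qed

end

section \<open>The renormings of \<open>L\<^sub>1\<close>\<close>

lemma L1_rep_integrable [simp]: "integrable I01 (rep_L1 F)"
  using Quotient3_rep_reflp[OF Quotient3_L1, of F] by (simp add: L1_rel_def)

lemma L1_rep_abs:
  assumes "integrable I01 f"
  shows "AE x in I01. rep_L1 (abs_L1 f) x = f x"
  using rep_abs_rsp_left[OF Quotient3_L1, of f f] assms by (auto simp: L1_rel_def)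

lemma L1_abs_rep: "abs_L1 (rep_L1 F) = F"
  by (rule Quotient3_abs_rep[OF Quotient3_L1])

lemma L1_abs_eq:
  assumes "integrable I01 f" "integrable I01 g" "AE x in I01. f x = g x"
  shows "abs_L1 f = abs_L1 g"
  using assms by (intro Quotient3_rel_abs[OF Quotient3_L1]) (auto simp: L1_rel_def)

lemma L1_eqI:
  assumes "AE x in I01. rep_L1 F x = rep_L1 G x"
  shows "F = G"
  using L1_abs_eq[OF L1_rep_integrable L1_rep_integrable assms] by (simp add: L1_abs_rep)

lemma L1_plus: "AE x in I01. rep_L1 (F + G) x = rep_L1 F x + rep_L1 G x"
proof -
  have "F + G = abs_L1 (\<lambda>x. rep_L1 F x + rep_L1 G x)" by (simp add: plus_L1_def)
  then show ?thesis using L1_rep_abs[of "\<lambda>x. rep_L1 F x + rep_L1 G x"] by simp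
qed

lemma L1_minus: "AE x in I01. rep_L1 (F - G) x = rep_L1 F x - rep_L1 G x"
proof -
  have "F - G = abs_L1 (\<lambda>x. rep_L1 F x - rep_L1 G x)" by (simp add: minus_L1_def)
  then show ?thesis using L1_rep_abs[of "\<lambda>x. rep_L1 F x - rep_L1 G x"] by simp
qed

lemma L1_scale: "AE x in I01. rep_L1 (scale_L1 c F) x = c * rep_L1 F x"
proof -
  have "scale_L1 c F = abs_L1 (\<lambda>x. c * rep_L1 F x)" by (simp add: scale_L1_def)
  then show ?thesis using L1_rep_abs[of "\<lambda>x. c * rep_L1 F x"] by simp
qed

lemma L1_zero: "AE x in I01. rep_L1 0 x = 0"
  unfolding zero_L1_def by (rule L1_rep_abs) simp

lemma norm1_rep: "norm1 F = (\<integral>x. norm (rep_L1 F x) \<partial>I01)"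
  by (simp add: norm1_def)

lemma vector_space_L1:
  "vector_space (scale_L1 :: 'k::{real_normed_field, banach, second_countable_topology} \<Rightarrow> _)"
proof
  fix a b :: 'k and F G :: "'k L1"
  show "scale_L1 a (F + G) = scale_L1 a F + scale_L1 a G"
    by transfer (auto simp: L1_rel_def distrib_left)
  show "scale_L1 (a + b) F = scale_L1 a F + scale_L1 b F"
    by transfer (auto simp: L1_rel_def distrib_right)
  show "scale_L1 a (scale_L1 b F) = scale_L1 (a * b) F"
    by transfer (auto simp: L1_rel_def mult.assoc)
  show "scale_L1 1 F = F"
    by transfer (auto simp: L1_rel_def)
qed

locale rotation_tower =
  fixes d :: "nat \<Rightarrow> real"
  assumes d_pos: "\<And>i. 0 < d i" and d_summable: "summable d" "summable (\<lambda>i. real i * d i)"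
begin

sublocale mean_tower I01 rot d
  by (rule mean_tower_rot[OF d_pos d_summable])

definition NL :: "'k::{real_normed_field, euclidean_space} L1 \<Rightarrow> real" where
  "NL F = N (rep_L1 F)"

lemma NL_eq:
  assumes "integrable I01 f" "AE x in I01. rep_L1 F x = f x"
  shows "NL F = N f"
  unfolding NL_def by (rule N_cong_AE[OF L1_rep_integrable assms])

lemma NL_abs: "integrable I01 f \<Longrightarrow> NL (abs_L1 f) = N f"
  by (rule NL_eq[OF _ L1_rep_abs])

lemma NL_plus: "NL (F + H) = N (\<lambda>x. rep_L1 F x + rep_L1 H x)"
  by (rule NL_eq[OF _ L1_plus]) simp

lemma NL_minus: "NL (F - H) = N (\<lambda>x. rep_L1 F x - rep_L1 H x)"
  by (rule NL_eq[OF _ L1_minus]) simp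

lemma norm1_le_NL: "norm1 F \<le> NL F" "NL F \<le> \<kappa> 0 * norm1 F"
  unfolding NL_def norm1_rep by (rule L1_le_N N_le_L1; simp)+

lemma normed_space_NL: "normed_space (L1_with (NL :: 'k::{real_normed_field, euclidean_space} L1 \<Rightarrow> real))"
proof -
  have md: "module (scale_L1 :: 'k \<Rightarrow> _)" using vector_space_L1 by (auto simp: vector_space_def module_def)
  have z: "NL F = 0 \<longleftrightarrow> F = 0" for F :: "'k L1"
  proof -
    have "NL F = 0 \<longleftrightarrow> (AE x in I01. rep_L1 F x = 0)" unfolding NL_def by (rule N_eq_0_iff) simp
    also have "\<dots> \<longleftrightarrow> F = 0"
    proof
      assume "AE x in I01. rep_L1 F x = 0"
      then have "AE x in I01. rep_L1 F x = rep_L1 0 x" using L1_zero by eventually_elim simp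
      then show "F = 0" by (rule L1_eqI)
    qed (use L1_zero in simp)
    finally show ?thesis .
  qed
  have s: "NL (scale_L1 c F) = norm c * NL F" for c and F :: "'k L1"
  proof -
    have "NL (scale_L1 c F) = N (\<lambda>x. c * rep_L1 F x)" by (rule NL_eq[OF _ L1_scale]) simp
    also have "\<dots> = norm c * NL F" unfolding NL_def by (rule N_scale) (auto simp: norm_mult)
    finally show ?thesis .
  qed
  have t: "NL (F + G) \<le> NL F + NL G" for F G :: "'k L1"
    unfolding NL_plus unfolding NL_def by (rule N_add) simp_all
  have n: "0 \<le> NL F" for F :: "'k L1" unfolding NL_def by (rule N_nonneg) simp
  show ?thesis
    unfolding normed_space_def L1_with_def
    using vector_space_L1 md z s t n by (simp add: module.subspace_def)
qed

lemma strict_at_midpoint: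
  fixes Z H :: "'k::{real_normed_field, euclidean_space} L1"
  assumes "NL (Z + H) \<le> NL Z" "NL (Z - H) \<le> NL Z"
  shows "H = 0"
proof -
  have "AE x in I01. rep_L1 H x = 0"
    using assms unfolding NL_plus NL_minus unfolding NL_def by (intro midpoint_unique[of "rep_L1 Z"]) auto
  then have "AE x in I01. rep_L1 H x = rep_L1 0 x" using L1_zero by eventually_elim simp
  then show ?thesis by (rule L1_eqI)
qed

lemma full_normed_space_NL: "full_normed_space scale_L1 (NL :: 'k::{real_normed_field, euclidean_space} L1 \<Rightarrow> real)"
  by unfold_locales (use normed_space_NL in \<open>simp add: L1_with_def\<close>)

lemma strictly_convex_NL: "strictly_convex (L1_with (NL :: 'k::{real_normed_field, euclidean_space} L1 \<Rightarrow> real))"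
  unfolding strictly_convex_def
proof (intro ballI impI)
  fix F G :: "'k L1"
  assume "F \<in> unit_sphere (L1_with NL)" "G \<in> unit_sphere (L1_with NL)" and ne: "F \<noteq> G"
  then have FG: "NL F = 1" "NL G = 1" by (auto simp: unit_sphere_def L1_with_def)
  interpret vector_space "scale_L1 :: 'k \<Rightarrow> _" by (rule vector_space_L1)
  define Z H where "Z = scale_L1 (1/2) (F + G)" and "H = scale_L1 (1/2) (F - G)"
  have half: "scale_L1 (1/2) E + scale_L1 (1/2) E = E" for E :: "'k L1"
  proof -
    have "scale_L1 (1/2) E + scale_L1 (1/2) E = scale_L1 (1/2 + 1/2) E" by (rule scale_left_distrib[symmetric])
    then show ?thesis by simp
  qed
  have "Z + H = F" "Z - H = G" using half
    by (simp_all add: Z_def H_def scale_right_distrib scale_right_diff_distrib)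
  moreover have "H \<noteq> 0"
  proof
    assume "H = 0"
    then have "F = G" using \<open>Z + H = F\<close> \<open>Z - H = G\<close> by simp
    then show False using ne by simp
  qed
  ultimately have "NL Z < 1" using strict_at_midpoint[of Z H] FG by force
  then show "vnorm (L1_with NL) (vscale (L1_with NL) (1 / 2) (F + G)) < 1"
    by (simp add: L1_with_def Z_def)
qed

lemma gateaux_smooth_NL: "gateaux_smooth (L1_with (NL :: 'k::{real_normed_field, euclidean_space} L1 \<Rightarrow> real))"
  unfolding gateaux_smooth_def
proof (intro ballI)
  fix F G :: "'k L1"
  assume "F \<in> unit_sphere (L1_with NL)"
  then have F: "N (rep_L1 F) \<noteq> 0" by (simp add: unit_sphere_def L1_with_def NL_def)
  have "NL (F + scale_L1 (of_real t) G) = N (\<lambda>x. rep_L1 F x + t *\<^sub>R rep_L1 G x)" for t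
  proof (rule NL_eq)
    show "AE x in I01. rep_L1 (F + scale_L1 (of_real t) G) x = rep_L1 F x + t *\<^sub>R rep_L1 G x"
      using L1_plus[of F "scale_L1 (of_real t) G"] L1_scale[of "of_real t" G]
      by eventually_elim (simp add: scaleR_conv_of_real)
  qed simp
  then show "\<exists>L. ((\<lambda>t. (vnorm (L1_with NL) (F + vscale (L1_with NL) (of_real t) G) - vnorm (L1_with NL) F) / t) \<longlongrightarrow> L) (at 0)"
    using N_has_directional_derivative[OF L1_rep_integrable L1_rep_integrable F, of G]
    by (auto simp: L1_with_def NL_def[symmetric])
qed

text \<open>A bounded functional that does not tend to \<open>0\<close> along the sequence is at least \<open>\<eta>\<close> in some direction of the
  scalar field infinitely often, and this condition defines a convex set.\<close>

lemma wMLUR_NL: "wMLUR (L1_with (NL :: 'k::{real_normed_field, euclidean_space} L1 \<Rightarrow> real))"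
  unfolding wMLUR_def weakly_null_def
proof (intro ballI allI impI)
  interpret full: full_normed_space "scale_L1 :: 'k \<Rightarrow> _" NL by (rule full_normed_space_NL)
  fix F :: "'k L1" and H :: "nat \<Rightarrow> 'k L1" and \<phi> :: "'k L1 \<Rightarrow> 'k"
  assume "F \<in> unit_sphere (L1_with NL)" and H: "(\<forall>n. H n \<in> vcar (L1_with NL)) \<and>
      (\<lambda>n. vnorm (L1_with NL) (F + H n)) \<longlonglongrightarrow> 1 \<and> (\<lambda>n. vnorm (L1_with NL) (F - H n)) \<longlonglongrightarrow> 1"
    and "\<phi> \<in> vcar (dual_space (L1_with NL))"
  then have F: "NL F = 1" and \<phi>: "\<phi> \<in> vcar full.D"
    and lim: "(\<lambda>n. NL (F + H n)) \<longlonglongrightarrow> 1" "(\<lambda>n. NL (F - H n)) \<longlonglongrightarrow> 1"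
    by (auto simp: unit_sphere_def L1_with_def)
  show "(\<lambda>n. \<phi> (H n)) \<longlonglongrightarrow> 0"
  proof (rule ccontr)
    assume "\<not> (\<lambda>n. \<phi> (H n)) \<longlonglongrightarrow> 0"
    then obtain b where b: "b \<in> Basis" "\<not> (\<lambda>n. \<phi> (H n) \<bullet> b) \<longlonglongrightarrow> 0"
      using tendsto_componentwise_iff[of "\<lambda>n. \<phi> (H n)" 0 sequentially] by auto
    from b(2) obtain \<eta> where \<eta>: "0 < \<eta>" "\<exists>\<^sub>F n in sequentially. \<eta> \<le> \<bar>\<phi> (H n) \<bullet> b\<bar>"
      by (auto simp: tendsto_iff not_eventually not_less)
    have "\<exists>\<^sub>F n in sequentially. \<eta> \<le> \<phi> (H n) \<bullet> b \<or> \<eta> \<le> \<phi> (H n) \<bullet> (- b)"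
      using \<eta>(2) by (rule frequently_elim1) (auto simp: abs_if split: if_splits)
    then obtain v where v: "norm v = 1" "\<exists>\<^sub>F n in sequentially. \<eta> \<le> \<phi> (H n) \<bullet> v"
      unfolding frequently_disj_iff using b(1) that by (metis norm_Basis norm_minus_cancel)
    define Q where "Q f \<longleftrightarrow> \<eta> \<le> \<phi> (abs_L1 f) \<bullet> v" for f
    obtain g where g: "\<And>k. integrable I01 (g k)" "\<And>k. Q (g k)" "(\<lambda>k. N (g k)) \<longlonglongrightarrow> 0"
    proof (rule midpoint_sequences[OF L1_rep_integrable[of F], of Q])
      fix f g :: "real \<Rightarrow> 'k"
      assume f: "integrable I01 f" and g: "integrable I01 g" and Q: "Q f" "Q g"
      have "abs_L1 (\<lambda>x. (1/2) *\<^sub>R (f x + g x)) = scale_L1 (of_real (1/2)) (abs_L1 f + abs_L1 g)"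
      proof (rule L1_eqI)
        have "integrable I01 (\<lambda>x. (1/2) *\<^sub>R (f x + g x))" using f g by simp
        from L1_rep_abs[OF this] L1_scale[of "of_real (1/2)" "abs_L1 f + abs_L1 g"]
          L1_plus[of "abs_L1 f" "abs_L1 g"] L1_rep_abs[OF f] L1_rep_abs[OF g]
        show "AE x in I01. rep_L1 (abs_L1 (\<lambda>x. (1/2) *\<^sub>R (f x + g x))) x
            = rep_L1 (scale_L1 (of_real (1/2)) (abs_L1 f + abs_L1 g)) x"
          by eventually_elim (simp only: scaleR_conv_of_real)
      qed
      then have "\<phi> (abs_L1 (\<lambda>x. (1/2) *\<^sub>R (f x + g x))) = (1/2) *\<^sub>R (\<phi> (abs_L1 f) + \<phi> (abs_L1 g))"
        using full.dual_linear(1,2)[OF \<phi>] by (simp only: scaleR_conv_of_real)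
      then show "Q (\<lambda>x. (1/2) *\<^sub>R (f x + g x))" using Q by (simp add: Q_def inner_add_left)
    next
      fix e :: real assume e: "0 < e"
      have "\<forall>\<^sub>F n in sequentially. NL (F + H n) < NL F + e \<and> NL (F - H n) < NL F + e"
        using e F by (intro eventually_conj order_tendstoD(2)[OF lim(1)] order_tendstoD(2)[OF lim(2)]) auto
      with v(2) have "\<exists>\<^sub>F n in sequentially. \<eta> \<le> \<phi> (H n) \<bullet> v \<and> NL (F + H n) < NL F + e \<and> NL (F - H n) < NL F + e"
        by (rule frequently_eventually_frequently)
      then obtain n where n: "\<eta> \<le> \<phi> (H n) \<bullet> v" "NL (F + H n) < NL F + e" "NL (F - H n) < NL F + e"
        by (auto dest: frequently_ex)
      then show "\<exists>h. integrable I01 h \<and> Q h \<and> N (\<lambda>x. rep_L1 F x + h x) \<le> N (rep_L1 F) + e \<and>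
          N (\<lambda>x. rep_L1 F x - h x) \<le> N (rep_L1 F) + e"
        by (intro exI[of _ "rep_L1 (H n)"]) (simp add: Q_def L1_abs_rep NL_plus NL_minus NL_def[symmetric] less_imp_le)
    qed blast
    have "\<eta> \<le> vnorm full.D \<phi> * N (g k)" for k
    proof -
      have "\<eta> \<le> norm (\<phi> (abs_L1 (g k))) * norm v"
        using g(2)[of k] norm_cauchy_schwarz[of "\<phi> (abs_L1 (g k))" v] by (simp add: Q_def)
      also have "\<dots> \<le> vnorm full.D \<phi> * NL (abs_L1 (g k))"
        using full.dual_bound[OF \<phi>] v(1) by simp
      finally show ?thesis by (simp add: NL_abs g(1))
    qed
    moreover have "(\<lambda>k. vnorm full.D \<phi> * N (g k)) \<longlonglongrightarrow> vnorm full.D \<phi> * 0"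
      by (intro tendsto_intros g(3))
    ultimately have "\<eta> \<le> vnorm full.D \<phi> * 0" by (intro LIMSEQ_le_const) auto
    then show False using \<eta>(1) by simp
  qed
qed

lemma banach_space_NL: "banach_space (L1_with (NL :: 'k::{real_normed_field, euclidean_space} L1 \<Rightarrow> real))"
  unfolding banach_space_def
proof (intro conjI allI impI normed_space_NL)
  interpret full: full_normed_space "scale_L1 :: 'k \<Rightarrow> _" NL by (rule full_normed_space_NL)
  fix H :: "nat \<Rightarrow> 'k L1"
  assume "(\<forall>n. H n \<in> vcar (L1_with NL)) \<and>
    (\<forall>e>0. \<exists>M. \<forall>m\<ge>M. \<forall>n\<ge>M. vnorm (L1_with NL) (H m - H n) < e)"
  then have cauchy: "\<exists>M. \<forall>m\<ge>M. \<forall>n\<ge>M. NL (H m - H n) < e" if "0 < e" for e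
    using that by (simp add: L1_with_def)
  define h where "h n = rep_L1 (H n)" for n
  have h: "integrable I01 (h n)" for n by (simp add: h_def)
  have hm: "h n \<in> borel_measurable I01" for n using h by (rule borel_measurable_integrable)
  have dist: "(\<integral>x. norm (h m x - h n x) \<partial>I01) \<le> NL (H m - H n)" for m n
    unfolding NL_minus h_def by (rule L1_le_N) simp
  have "\<exists>K. \<forall>n\<ge>K. \<forall>m\<ge>n. (\<integral>x. min 1 (norm (h m x - h n x)) \<partial>I01) < e" if e: "0 < e" for e
  proof -
    obtain K where K: "\<forall>m\<ge>K. \<forall>n\<ge>K. NL (H m - H n) < e" using cauchy[OF e] by blast
    have "(\<integral>x. min 1 (norm (h m x - h n x)) \<partial>I01) < e" if "n \<ge> K" "m \<ge> n" for m n
    proof -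
      have "(\<integral>x. min 1 (norm (h m x - h n x)) \<partial>I01) \<le> (\<integral>x. norm (h m x - h n x) \<partial>I01)"
      proof (rule integral_mono)
        show "integrable I01 (\<lambda>x. min 1 (norm (h m x - h n x)))"
          using hm by (intro I01.integrable_const_bound[of _ 1]) auto
        show "integrable I01 (\<lambda>x. norm (h m x - h n x))" using h by auto
      qed simp
      moreover have "NL (H m - H n) < e" using K that by simp
      ultimately show ?thesis using dist[of m n] by linarith
    qed
    then show ?thesis by blast
  qed
  from I01.AE_convergent_subseq[OF hm this] obtain s :: "nat \<Rightarrow> nat" and g
    where s: "strict_mono s" and gm: "g \<in> borel_measurable I01" and lim: "AE x in I01. (\<lambda>k. h (s k) x) \<longlonglongrightarrow> g x"
    by blast
  have tail: "\<exists>K. \<forall>m\<ge>K. integrable I01 (\<lambda>x. h m x - g x) \<and> (\<integral>x. norm (h m x - g x) \<partial>I01) \<le> e" if e: "0 < e" for e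
  proof -
    obtain K where K: "\<forall>m\<ge>K. \<forall>n\<ge>K. NL (H m - H n) < e" using cauchy[OF e] by blast
    have "integrable I01 (\<lambda>x. h m x - g x) \<and> (\<integral>x. norm (h m x - g x) \<partial>I01) \<le> e" if m: "m \<ge> K" for m
    proof -
      have int: "integrable I01 (\<lambda>x. h m x - h (s (k + K)) x)" for k using h by auto
      have bd: "(\<integral>x. norm (h m x - h (s (k + K)) x) \<partial>I01) \<le> e" for k
      proof -
        have "K \<le> s (k + K)" using seq_suble[OF s, of "k + K"] by simp
        then have "NL (H m - H (s (k + K))) < e" using K m by blast
        then show ?thesis using dist[of m "s (k + K)"] by linarith
      qed
      have meas: "(\<lambda>x. h m x - g x) \<in> borel_measurable I01" using hm gm by auto
      have "AE x in I01. (\<lambda>k. h m x - h (s (k + K)) x) \<longlonglongrightarrow> h m x - g x"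
        using lim
      proof eventually_elim
        case (elim x)
        from LIMSEQ_ignore_initial_segment[OF elim, of K] show ?case by (intro tendsto_intros)
      qed
      from Fatou_norm[OF int bd meas this] show ?thesis by blast
    qed
    then show ?thesis by blast
  qed
  obtain K where "integrable I01 (\<lambda>x. h K x - g x)" using tail[of 1] by auto
  then have "integrable I01 (\<lambda>x. h K x - (h K x - g x))"
    by (rule Bochner_Integration.integrable_diff[OF h])
  then have gi: "integrable I01 g" by simp
  have NLg: "NL (H n - abs_L1 g) \<le> \<kappa> 0 * (\<integral>x. norm (h n x - g x) \<partial>I01)" for n
  proof -
    have i: "integrable I01 (\<lambda>x. h n x - g x)" using h gi by auto
    have "NL (H n - abs_L1 g) = N (\<lambda>x. h n x - g x)"
    proof (rule NL_eq[OF i])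
      show "AE x in I01. rep_L1 (H n - abs_L1 g) x = h n x - g x"
        using L1_minus[of "H n" "abs_L1 g"] L1_rep_abs[OF gi] by eventually_elim (simp add: h_def)
    qed
    then show ?thesis using N_le_L1[OF i] by simp
  qed
  have "(\<lambda>n. NL (H n - abs_L1 g)) \<longlonglongrightarrow> 0"
    unfolding tendsto_iff dist_real_def eventually_sequentially
  proof (intro allI impI)
    fix e :: real assume e: "0 < e"
    have k: "0 < \<kappa> 0" using \<kappa>_ge_1[of 0] by linarith
    obtain K where K: "\<And>m. m \<ge> K \<Longrightarrow> (\<integral>x. norm (h m x - g x) \<partial>I01) \<le> e / (2 * \<kappa> 0)"
      using tail[of "e / (2 * \<kappa> 0)"] e k by auto
    have "\<bar>NL (H n - abs_L1 g) - 0\<bar> < e" if "n \<ge> K" for n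
    proof -
      have "NL (H n - abs_L1 g) \<le> \<kappa> 0 * (e / (2 * \<kappa> 0))"
        using NLg[of n] mult_left_mono[OF K[OF that], of "\<kappa> 0"] k by linarith
      also have "\<dots> = e / 2" using k by simp
      finally show ?thesis using e full.N_nonneg[of "H n - abs_L1 g"] by simp
    qed
    then show "\<exists>K. \<forall>n\<ge>K. \<bar>NL (H n - abs_L1 g) - 0\<bar> < e" by blast
  qed
  then show "\<exists>x\<in>vcar (L1_with NL). (\<lambda>n. vnorm (L1_with NL) (H n - x)) \<longlonglongrightarrow> 0"
    by (auto simp: L1_with_def)
qed

lemma fine_splitting_NL: "fine_splitting scale_L1 (NL :: 'k::{real_normed_field, euclidean_space} L1 \<Rightarrow> real)"
proof (intro fine_splitting.intro full_normed_space_NL fine_splitting_axioms.intro)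
  fix Y :: "'k L1" and e :: real
  assume e: "0 < e"
  obtain n :: nat and J where J: "J \<in> I01 \<rightarrow>\<^sub>M count_space UNIV" "\<And>x. x \<in> space I01 \<Longrightarrow> J x < n"
    and sum: "\<And>f :: real \<Rightarrow> 'k. integrable I01 f \<Longrightarrow> (\<Sum>k<n. N (\<lambda>x. if J x = k then f x else 0)) \<le> (1 + e) * N f"
    and small: "\<And>k. k < n \<Longrightarrow> N (\<lambda>x. if J x = k then rep_L1 Y x else 0) < e"
    by (rule almost_additive_pieces[OF L1_rep_integrable[of Y] e]) blast
  note [measurable] = J(1)
  define p where "p k f = (\<lambda>x. if J x = k then f x else 0)" for k and f :: "real \<Rightarrow> 'k"
  define P where "P k F = abs_L1 (p k (rep_L1 F))" for k F
  have pi: "integrable I01 (p k f)" if f: "integrable I01 f" for k f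
  proof -
    have [measurable]: "f \<in> borel_measurable I01" using f by simp
    show ?thesis unfolding p_def by (rule Bochner_Integration.integrable_bound[OF f]) auto
  qed
  have rP: "AE x in I01. rep_L1 (P k F) x = p k (rep_L1 F) x" for k F
    unfolding P_def by (rule L1_rep_abs[OF pi]) simp
  have NP: "NL (P k F) = N (p k (rep_L1 F))" for k F
    unfolding P_def by (rule NL_abs[OF pi]) simp
  have 1: "P k (F + G) = P k F + P k G" for k F G
  proof (rule L1_eqI)
    show "AE x in I01. rep_L1 (P k (F + G)) x = rep_L1 (P k F + P k G) x"
      using rP[of k "F + G"] L1_plus[of "P k F" "P k G"] rP[of k F] rP[of k G] L1_plus[of F G]
      by eventually_elim (simp add: p_def)
  qed
  have 2: "P k (scale_L1 c F) = scale_L1 c (P k F)" for k c F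
  proof (rule L1_eqI)
    show "AE x in I01. rep_L1 (P k (scale_L1 c F)) x = rep_L1 (scale_L1 c (P k F)) x"
      using rP[of k "scale_L1 c F"] L1_scale[of c "P k F"] rP[of k F] L1_scale[of c F]
      by eventually_elim (simp add: p_def)
  qed
  have 3: "P k (P k F) = P k F" for k F
  proof (rule L1_eqI)
    show "AE x in I01. rep_L1 (P k (P k F)) x = rep_L1 (P k F) x"
      using rP[of k "P k F"] rP[of k F] by eventually_elim (simp add: p_def)
  qed
  have psum: "AE x in I01. rep_L1 (\<Sum>k<m. P k F) x = (\<Sum>k<m. p k (rep_L1 F) x)" for m F
  proof (induction m)
    case 0
    then show ?case using L1_zero by simp
  next
    case (Suc m)
    from this L1_plus[of "\<Sum>k<m. P k F" "P m F"] rP[of m F] show ?case by eventually_elim simp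
  qed
  have 4: "(\<Sum>k<n. P k F) = F" for F
  proof (rule L1_eqI)
    show "AE x in I01. rep_L1 (\<Sum>k<n. P k F) x = rep_L1 F x"
      using psum[of F n] AE_space
      by eventually_elim (simp add: p_def J(2))
  qed
  have 5: "(\<Sum>k<n. NL (P k F)) \<le> (1 + e) * NL F" for F
    unfolding NP unfolding p_def NL_def by (rule sum[OF L1_rep_integrable])
  have 6: "NL (P k Y) < e" if "k < n" for k
    using small[OF that] by (simp only: NP p_def)
  show "\<exists>n P. (\<forall>k f g. P k (f + g) = P k f + P k g) \<and> (\<forall>k c f. P k (scale_L1 c f) = scale_L1 c (P k f)) \<and>
      (\<forall>k f. P k (P k f) = P k f) \<and> (\<forall>f. (\<Sum>k<n. P k f) = f) \<and>
      (\<forall>f. (\<Sum>k<n. NL (P k f)) \<le> (1 + e) * NL f) \<and> (\<forall>k<n::nat. NL (P k Y) < e)"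
    by (rule exI[of _ n], rule exI[of _ P]) (use 1 2 3 4 5 6 in blast)
next
  interpret full: full_normed_space "scale_L1 :: 'k \<Rightarrow> _" NL by (rule full_normed_space_NL)
  fix Z :: "'k L1"
  define \<phi> where "\<phi> F = norming_functional (rep_L1 Z) (rep_L1 F)" for F
  have cong: "norming_functional (rep_L1 Z) f = norming_functional (rep_L1 Z) g"
    if "integrable I01 f" "integrable I01 g" "AE x in I01. f x = g x" for f g :: "real \<Rightarrow> 'k"
  proof -
    have [measurable]: "f \<in> borel_measurable I01" "g \<in> borel_measurable I01" "rep_L1 Z \<in> borel_measurable I01"
      using that by (auto intro: borel_measurable_integrable)
    show ?thesis unfolding norming_functional_def
      by (rule integral_cong_AE) (use that(3) in \<open>auto elim: eventually_mono\<close>)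
  qed
  note I = integrable_norming[OF L1_rep_integrable L1_rep_integrable, of _ Z]
  have b: "norm (\<phi> F) \<le> 1 * NL F" for F
    unfolding \<phi>_def NL_def using norm_norming_functional[OF L1_rep_integrable L1_rep_integrable, of Z F] by simp
  have "\<phi> (F + G) = \<phi> F + \<phi> G" for F G
    unfolding \<phi>_def
    by (subst cong[OF _ _ L1_plus]) (use I[of F] I[of G] in \<open>simp_all add: norming_functional_def distrib_right\<close>)
  moreover have "\<phi> (scale_L1 c F) = c * \<phi> F" for c F
    unfolding \<phi>_def
    by (subst cong[OF _ _ L1_scale]) (use I[of F] in \<open>simp_all add: norming_functional_def mult.assoc\<close>)
  ultimately have "\<phi> \<in> vcar full.D" by (rule full.dualI(1)[OF _ _ b]) simp
  moreover have "\<phi> Z = of_real (NL Z)"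
    unfolding \<phi>_def NL_def by (rule norming_functional_self) simp
  ultimately show "\<exists>\<phi>\<in>vcar full.D. \<phi> Z = of_real (NL Z) \<and> (\<forall>f. norm (\<phi> f) \<le> NL f)"
    using b by (intro bexI[of _ \<phi>]) auto
qed

lemma daugavet_NL:
  "daugavet_property (L1_with (NL :: 'k::{real_normed_field, euclidean_space} L1 \<Rightarrow> real))"
  "daugavet_property (dual_space (L1_with (NL :: 'k::{real_normed_field, euclidean_space} L1 \<Rightarrow> real)))"
  using fine_splitting.daugavet[OF fine_splitting_NL] fine_splitting.daugavet_dual[OF fine_splitting_NL]
  by (simp_all add: L1_with_def)

end

text \<open>With \<open>\<delta>\<^sub>i = c 2\<^bsup>-(i+1)\<^esup>\<close> the total distortion is \<open>2\<^bsup>c\<^esup>\<close>.\<close>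

lemma rotation_tower_small:
  assumes "0 < \<epsilon>"
  obtains d where "rotation_tower d" "\<And>F :: 'k::{real_normed_field, euclidean_space} L1.
    rotation_tower.NL d F \<le> (1 + \<epsilon>) * norm1 F"
proof -
  define c where "c = log 2 (1 + \<epsilon>)"
  have c: "0 < c" using assms by (simp add: c_def)
  define d where "d i = c * (1/2) ^ Suc i" for i :: nat
  have sums: "d sums c"
    unfolding d_def using sums_mult[OF power_half_series, of c] by simp
  have "summable (\<lambda>i. real (Suc i) * (1/2::real) ^ i)"
    using geometric_deriv_sums[of "1/2::real"] by (auto intro: sums_summable)
  then have "summable (\<lambda>i. c / 2 * (real (Suc i) * (1/2::real) ^ i))" by (rule summable_mult)
  then have s2: "summable (\<lambda>i. real i * d i)"
    by (rule summable_comparison_test'[of _ 0])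
      (use c in \<open>auto simp: d_def abs_mult intro!: mult_right_mono mult_left_mono\<close>)
  interpret rotation_tower d
    by unfold_locales (use c sums s2 in \<open>auto simp: d_def[abs_def] intro: sums_summable\<close>)
  have "\<kappa> 0 = 1 + \<epsilon>"
  proof -
    have "\<kappa> 0 = 2 powr c" using sums_unique[OF sums] by (simp add: \<kappa>_def)
    then show ?thesis using assms by (simp add: c_def)
  qed
  then have "NL F \<le> (1 + \<epsilon>) * norm1 F" for F :: "'k L1" using norm1_le_NL(2)[of F] by simp
  then show thesis using that rotation_tower_axioms by blast
qed

lemma renorming:
  assumes "0 < \<epsilon>"
  obtains N :: "'k::{real_normed_field, euclidean_space} L1 \<Rightarrow> real"
  where "banach_space (L1_with N)" "\<And>f. norm1 f \<le> N f" "\<And>f. N f \<le> (1 + \<epsilon>) * norm1 f"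
    "wMLUR (L1_with N)" "strictly_convex (L1_with N)" "gateaux_smooth (L1_with N)"
    "daugavet_property (L1_with N)" "daugavet_property (dual_space (L1_with N))"
proof -
  obtain d where "rotation_tower d" and le: "\<And>F :: 'k L1. rotation_tower.NL d F \<le> (1 + \<epsilon>) * norm1 F"
    using rotation_tower_small[OF assms] by blast
  then interpret rotation_tower d by blast
  show thesis
    by (rule that[OF banach_space_NL norm1_le_NL(1) le wMLUR_NL strictly_convex_NL gateaux_smooth_NL daugavet_NL])
qed

lemma L1_nontrivial: "(UNIV :: 'k::{real_normed_field, banach, second_countable_topology} L1 set) \<noteq> {0}"
proof
  assume *: "(UNIV :: 'k L1 set) = {0}"
  have i: "integrable I01 (\<lambda>x. 1 :: 'k)" by simp
  have "abs_L1 (\<lambda>x. 1 :: 'k) = 0" using * by blast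
  then have "AE x in I01. rep_L1 (0 :: 'k L1) x = 1" using L1_rep_abs[OF i] by simp
  then have "AE x in I01. False" using L1_zero[where 'a='k] by eventually_elim simp
  then show False using I01.AE_False by simp
qed

lemma ex_renorming:
  assumes "0 < \<epsilon>"
  shows "\<exists>N :: 'k::{real_normed_field, euclidean_space} L1 \<Rightarrow> real.
            normed_space (L1_with N) \<and>
            (\<forall>f. norm1 f \<le> N f \<and> N f \<le> (1 + \<epsilon>) * norm1 f) \<and>
            wMLUR (L1_with N) \<and>
            gateaux_smooth (L1_with N) \<and>
            daugavet_property (dual_space (L1_with N))"
proof (rule renorming[OF assms, where 'k='k])
  fix N :: "'k L1 \<Rightarrow> real"
  assume "banach_space (L1_with N)" "\<And>f. norm1 f \<le> N f" "\<And>f. N f \<le> (1 + \<epsilon>) * norm1 f"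
    "wMLUR (L1_with N)" "gateaux_smooth (L1_with N)" "daugavet_property (dual_space (L1_with N))"
  then show ?thesis unfolding banach_space_def by (intro exI[of _ N]) simp
qed

lemma ex_strictly_convex_smooth_daugavet:
  "\<exists>X :: ('k::{real_normed_field, euclidean_space}, 'k L1) nspace.
            banach_space X \<and> vcar X \<noteq> {0} \<and>
            strictly_convex X \<and> gateaux_smooth X \<and> daugavet_property X"
proof (rule renorming[OF zero_less_one, where 'k='k])
  fix N :: "'k L1 \<Rightarrow> real"
  assume "banach_space (L1_with N)" "strictly_convex (L1_with N)" "gateaux_smooth (L1_with N)"
    "daugavet_property (L1_with N)"
  moreover have "vcar (L1_with N) \<noteq> {0}" using L1_nontrivial[where 'k='k] by (simp add: L1_with_def)
  ultimately show ?thesis by (intro exI[of _ "L1_with N"]) simp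
qed

theorem mainTheorem1:
  shows "(\<forall>\<epsilon>>0. \<exists>N :: real L1 \<Rightarrow> real.
            normed_space (L1_with N) \<and>
            (\<forall>f. norm1 f \<le> N f \<and> N f \<le> (1 + \<epsilon>) * norm1 f) \<and>
            wMLUR (L1_with N) \<and>
            gateaux_smooth (L1_with N) \<and>
            daugavet_property (dual_space (L1_with N))) \<and>
         (\<forall>\<epsilon>>0. \<exists>N :: complex L1 \<Rightarrow> real.
            normed_space (L1_with N) \<and>
            (\<forall>f. norm1 f \<le> N f \<and> N f \<le> (1 + \<epsilon>) * norm1 f) \<and>
            wMLUR (L1_with N) \<and>
            gateaux_smooth (L1_with N) \<and>
            daugavet_property (dual_space (L1_with N))) \<and>
         (\<exists>X :: (real, real L1) nspace.
            banach_space X \<and> vcar X \<noteq> {0} \<and>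
            strictly_convex X \<and> gateaux_smooth X \<and> daugavet_property X) \<and>
         (\<exists>X :: (complex, complex L1) nspace.
            banach_space X \<and> vcar X \<noteq> {0} \<and>
            strictly_convex X \<and> gateaux_smooth X \<and> daugavet_property X)"
  by (intro conjI allI impI ex_renorming ex_strictly_convex_smooth_daugavet)

end
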